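(* The immersive topologies on $\tilde{\mathcal M}$ and on $\tilde{\mathcal E}$ are second countable and Hausdorff.
   Context: Let $\Delta$ be the open oriented topological $2$-disk with basepoint $x_0$. A pointed local homeomorphism is an orientation-preserving local homeomorphism $\phi:\Delta\to\mathbb R^2$ with $\phi(x_0)=\mathbf 0$. Two such maps $\phi,\psi$ are isomorphic if $\psi=\phi\circ h^{-1}$ for some orientation-preserving homeomorphism $h$ of $\Delta$ fixing $x_0$. The moduli space $\tilde{\mathcal M}$ is the set of isomorphism classes; an element $P\in\tilde{\mathcal M}$ is a planar surface, regarded as a topological open disk with basepoint $o_P$ and developing map $\mathrm{dev}_P:P\to\mathbb R^2$, an orientation-preserving local homeomorphism with $\mathrm{dev}_P(o_P)=\mathbf 0$. The set $\tilde{\mathcal E}$ is the set of pairs $(P,p)$ with $P$ a planar surface and $p\in P$; $\tilde\pi(P,p)=P$. $\mathrm{PC}(P)$ is the set of path-connected subsets of $P$ containing $o_P$. For $A\in\mathrm{PC}(P)$, $B\in\mathrm{PC}(Q)$, an immersion $\iota:A\rightsquigarrow B$ is a continuous map with $\iota(o_P)=o_Q$ and $\mathrm{dev}_Q\circ\iota=\mathrm{dev}_P$ on $A$. An embedding is an injective immersion ($\hookrightarrow$). $\overline{\mathrm{Disk}}(P)$: elements of $\mathrm{PC}(P)$ homeomorphic to a closed $2$-disk with $o_P$ in their interior; $\mathrm{Disk}(P)$: elements of $\mathrm{PC}(P)$ homeomorphic to an open $2$-disk. The immersive topology on $\tilde{\mathcal M}$ is the coarsest topology in which $\{Q:K\rightsquigarrow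 Q\}$ is open for every $K\in\overline{\mathrm{Disk}}(P)$ and $\{Q:U\not\hookrightarrow Q\}$ is open for every $U\in\mathrm{Disk}(P)$, over all planar surfaces $P$. For compact $K\in\mathrm{PC}(P)$ and open $U\subset K^\circ$, $\tilde{\mathcal E}_+(K,U)=\{(Q,q):\exists\,\iota:K\rightsquigarrow Q,\ q\in\iota(U)\}$. The immersive topology on $\tilde{\mathcal E}$ is the coarsest topology making $\tilde\pi$ continuous and every $\tilde{\mathcal E}_+(K,U)$ open. *)

theory Defs
  imports "HOL-Analysis.Analysis"
begin

text \<open>The oriented open disk Delta is modelled as the open unit disk of the complex
plane (standard orientation) with basepoint 0; the target plane R^2 is the complex
plane with its standard orientation.\<close>

abbreviation Dsk :: "complex set" where "Dsk \<equiv> ball 0 1"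

definition local_homeo :: "complex set \<Rightarrow> (complex \<Rightarrow> complex) \<Rightarrow> bool" where
  "local_homeo S f \<longleftrightarrow> (\<forall>x\<in>S. \<exists>V. open V \<and> x \<in> V \<and> V \<subseteq> S \<and> open (f ` V) \<and>
      (\<exists>g. homeomorphism V (f ` V) f g))"

text \<open>Orientation preservation via local degree +1: around every point, the image of a
small circle (on which f is injective) winds once positively around the image point.
Winding is expressed through a continuous logarithmic lift.\<close>
definition orient_pres :: "complex set \<Rightarrow> (complex \<Rightarrow> complex) \<Rightarrow> bool" where
  "orient_pres S f \<longleftrightarrow> (\<forall>x\<in>S. \<exists>r>0. cball x r \<subseteq> S \<and> inj_on f (cball x r) \<and>
      (\<exists>\<theta>. continuous_on {0..1} \<theta> \<and>
           (\<forall>t\<in>{0..1::real}. exp (\<theta> t) = f (x + of_real r * cis (2 * pi * t)) - f x) \<and>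
           \<theta> 1 = \<theta> 0 + 2 * of_real pi * \<i>))"

text \<open>Pointed orientation-preserving local homeomorphisms Delta \<rightarrow> R^2
(values outside Delta are irrelevant).\<close>
definition pointed_lh :: "(complex \<Rightarrow> complex) \<Rightarrow> bool" where
  "pointed_lh \<phi> \<longleftrightarrow> continuous_on Dsk \<phi> \<and> local_homeo Dsk \<phi> \<and> orient_pres Dsk \<phi> \<and> \<phi> 0 = 0"

definition disk_auto :: "(complex \<Rightarrow> complex) \<Rightarrow> (complex \<Rightarrow> complex) \<Rightarrow> bool" where
  "disk_auto h g \<longleftrightarrow> homeomorphism Dsk Dsk h g \<and> orient_pres Dsk h \<and> h 0 = 0"

definition iso_lh :: "(complex \<Rightarrow> complex) \<Rightarrow> (complex \<Rightarrow> complex) \<Rightarrow> bool" where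
  "iso_lh \<phi> \<psi> \<longleftrightarrow> pointed_lh \<phi> \<and> pointed_lh \<psi> \<and>
     (\<exists>h g. disk_auto h g \<and> (\<forall>x\<in>Dsk. \<psi> x = \<phi> (g x)))"

definition Mt :: "(complex \<Rightarrow> complex) set set" where
  "Mt = {{\<psi>. iso_lh \<phi> \<psi>} | \<phi>. pointed_lh \<phi>}"

text \<open>Pairs (P,p): classes of (phi,x), with (phi,x) ~ (phi o h^{-1}, h x).\<close>
definition iso_pt :: "(complex \<Rightarrow> complex) \<times> complex \<Rightarrow> (complex \<Rightarrow> complex) \<times> complex \<Rightarrow> bool" where
  "iso_pt a b \<longleftrightarrow> pointed_lh (fst a) \<and> pointed_lh (fst b) \<and> snd a \<in> Dsk \<and> snd b \<in> Dsk \<and>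
     (\<exists>h g. disk_auto h g \<and> (\<forall>x\<in>Dsk. fst b x = fst a (g x)) \<and> snd b = h (snd a))"

definition Et :: "((complex \<Rightarrow> complex) \<times> complex) set set" where
  "Et = {{b. iso_pt a b} | a. pointed_lh (fst a) \<and> snd a \<in> Dsk}"

definition pit :: "((complex \<Rightarrow> complex) \<times> complex) set \<Rightarrow> (complex \<Rightarrow> complex) set" where
  "pit e = (THE c. c \<in> Mt \<and> (\<exists>a\<in>e. fst a \<in> c))"

definition PC :: "complex set \<Rightarrow> bool" where
  "PC A \<longleftrightarrow> A \<subseteq> Dsk \<and> path_connected A \<and> 0 \<in> A"

definition cdisk :: "complex set \<Rightarrow> bool" where
  "cdisk K \<longleftrightarrow> PC K \<and> K homeomorphic cball (0::complex) 1 \<and> 0 \<in> interior K"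

definition odisk :: "complex set \<Rightarrow> bool" where
  "odisk U \<longleftrightarrow> PC U \<and> U homeomorphic ball (0::complex) 1"

definition immersion :: "(complex \<Rightarrow> complex) \<Rightarrow> complex set \<Rightarrow> (complex \<Rightarrow> complex) \<Rightarrow> (complex \<Rightarrow> complex) \<Rightarrow> bool" where
  "immersion \<phi> A \<psi> \<iota> \<longleftrightarrow> continuous_on A \<iota> \<and> \<iota> ` A \<subseteq> Dsk \<and> \<iota> 0 = 0 \<and> (\<forall>x\<in>A. \<psi> (\<iota> x) = \<phi> x)"

definition embedding :: "(complex \<Rightarrow> complex) \<Rightarrow> complex set \<Rightarrow> (complex \<Rightarrow> complex) \<Rightarrow> (complex \<Rightarrow> complex) \<Rightarrow> bool" where
  "embedding \<phi> A \<psi> \<iota> \<longleftrightarrow> immersion \<phi> A \<psi> \<iota> \<and> inj_on \<iota> A"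

definition Mt_subbasis :: "(complex \<Rightarrow> complex) set set set" where
  "Mt_subbasis =
     {{c \<in> Mt. \<exists>\<psi>\<in>c. \<exists>\<iota>. immersion \<phi> K \<psi> \<iota>} | \<phi> K. pointed_lh \<phi> \<and> cdisk K} \<union>
     {{c \<in> Mt. \<exists>\<psi>\<in>c. \<not> (\<exists>\<iota>. embedding \<phi> U \<psi> \<iota>)} | \<phi> U. pointed_lh \<phi> \<and> odisk U}"

definition Mt_top :: "(complex \<Rightarrow> complex) set topology" where
  "Mt_top = topology_generated_by (insert Mt Mt_subbasis)"

definition Et_plus :: "(complex \<Rightarrow> complex) \<Rightarrow> complex set \<Rightarrow> complex set \<Rightarrow> ((complex \<Rightarrow> complex) \<times> complex) set set" where
  "Et_plus \<phi> K U = {e \<in> Et. \<exists>(\<psi>, y)\<in>e. \<exists>\<iota>. immersion \<phi> K \<psi> \<iota> \<and> y \<in> \<iota> ` U}"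

definition Et_subbasis :: "((complex \<Rightarrow> complex) \<times> complex) set set set" where
  "Et_subbasis =
     {{e \<in> Et. pit e \<in> V} | V. openin Mt_top V} \<union>
     {Et_plus \<phi> K U | \<phi> K U. pointed_lh \<phi> \<and> compact K \<and> PC K \<and> open U \<and> U \<subseteq> interior K}"

definition Et_top :: "((complex \<Rightarrow> complex) \<times> complex) set topology" where
  "Et_top = topology_generated_by (insert Et Et_subbasis)"

end

theory Submission
  imports Defs "HOL-Complex_Analysis.Complex_Analysis"
begin

text \<open>A continuous map into the plane that lifts through a
  local homeomorphism still lifts after a uniformly small perturbation, because the local sections
  of a local homeomorphism over convex sets patch together. As spaces of continuous functions on a
  compact disk are separable, immersions and obstructions to embeddings can be factored through a countable
  family of disks, which gives second countability.

  The key to the Hausdorff property is that a closed disk of \<open>P\<close> embeds in every \<open>R\<close> close to \<open>P\<close>.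
  Otherwise consider the largest concentric open disk of \<open>P\<close> embedded in \<open>R\<close>: two of its boundary points
  \<open>x\<close> and \<open>y\<close> are identified in \<open>R\<close>, and the radii to \<open>x\<close> and \<open>y\<close> form a Jordan curve in \<open>R\<close>. Every point enclosed by
  it has a disk of a fixed radius around it (a maximum principle), and the number of enclosed points over a
  point of the plane is a winding number computed in \<open>P\<close> (the argument principle). So the enclosed regions
  fall into finitely many isomorphism types. A disk neighbourhood of any of them does not immerse in
  \<open>P\<close>, as \<open>x \<noteq> y\<close> there, and hence the \<open>R\<close> containing one of finitely many such disks can be excluded by a neighbourhood
  of \<open>P\<close>.\<close>

section \<open>Sections and lifts of local homeomorphisms\<close>

text \<open>Non-embedding is open only for one prescribed disk at a time, so a neighbourhood of
  \<open>P\<close> can forbid only finitely many disks, although the enclosed region lives in the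
  unknown surface \<open>R\<close>. Every bound on it must therefore be read off in \<open>P\<close>
  along the two radii. Finiteness then comes from a combinatorial datum: the region is covered by a
  list of round disks with prescribed positions in the plane, and the relation telling which of them
  meet determines their union, because round disks have connected intersections. The pair
  \<open>x\<close>, \<open>y\<close> also varies with \<open>R\<close>. Here an identification
  spreads from one pair to any close pair with a common image in the plane; minimality of the
  modulus then lets one reference pair stand for all pairs in a small ball, and compactness leaves
  finitely many. All maps are merely continuous, so the argument principle is obtained by splitting
  off linear factors from functions with zeros of degree one. For countability, arbitrary disks are
  reparametrised as concentric ones, so that all surfaces are compared as functions on one
  domain.\<close>

definition local_imm :: "complex set \<Rightarrow> (complex \<Rightarrow> complex) \<Rightarrow> bool" where
  "local_imm S f \<longleftrightarrow> open S \<and> continuous_on S f \<and> (\<forall>x\<in>S. \<exists>e>0. ball x e \<subseteq> S \<and> inj_on f (ball x e))"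

text \<open>An inverse branch of \<open>f\<close> over a round disk of the target, that is, a
  schlicht disk of radius \<open>r\<close> centred at \<open>x\<close>. The set \<open>S\<close>
  bounds where the branch takes its values, so a smaller \<open>S\<close> makes a stronger
  statement; this is used with concentric disks.\<close>

definition is_sec :: "complex set \<Rightarrow> (complex \<Rightarrow> complex) \<Rightarrow> complex \<Rightarrow> real \<Rightarrow> (complex \<Rightarrow> complex) \<Rightarrow> bool" where
  "is_sec S f x r g \<longleftrightarrow> continuous_on (ball (f x) r) g \<and> g \<in> ball (f x) r \<rightarrow> S \<and> g (f x) = x \<and>
     (\<forall>w\<in>ball (f x) r. f (g w) = w)"

definition thick :: "complex set \<Rightarrow> (complex \<Rightarrow> complex) \<Rightarrow> complex \<Rightarrow> real \<Rightarrow> bool" where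
  "thick S f x r \<longleftrightarrow> (\<exists>g. is_sec S f x r g)"

lemma local_imm_subset:
  assumes "local_imm S f" "open T" "T \<subseteq> S"
  shows "local_imm T f"
  unfolding local_imm_def
proof (intro conjI ballI)
  show "continuous_on T f" using assms continuous_on_subset by (auto simp: local_imm_def)
  fix x assume x: "x \<in> T"
  then obtain e where "e > 0" "ball x e \<subseteq> S" "inj_on f (ball x e)"
    using assms unfolding local_imm_def by blast
  moreover obtain d where "d > 0" "ball x d \<subseteq> T" using assms x open_contains_ball by blast
  ultimately show "\<exists>e>0. ball x e \<subseteq> T \<and> inj_on f (ball x e)"
    by (intro exI[of _ "min d e"]) (auto intro: inj_on_subset)
qed (use assms in auto)

lemma lift_unique:
  fixes p q :: "'a::topological_space \<Rightarrow> complex"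
  assumes f: "local_imm S f" and X: "connected X"
    and p: "continuous_on X p" "p \<in> X \<rightarrow> S" and q: "continuous_on X q" "q \<in> X \<rightarrow> S"
    and eq: "\<And>x. x \<in> X \<Longrightarrow> f (p x) = f (q x)" and x0: "x0 \<in> X" "p x0 = q x0" and x: "x \<in> X"
  shows "p x = q x"
proof -
  let ?E = "{x \<in> X. p x - q x = 0}"
  have "closedin (top_of_set X) ?E"
    by (intro continuous_closedin_preimage_constant continuous_intros p q)
  moreover have "openin (top_of_set X) ?E"
  proof (subst openin_subopen, intro ballI)
    fix y assume y: "y \<in> ?E"
    then obtain e where e: "e > 0" "inj_on f (ball (p y) e)"
      using f p unfolding local_imm_def by blast
    let ?V = "(X \<inter> p -` ball (p y) e) \<inter> (X \<inter> q -` ball (p y) e)"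
    have "openin (top_of_set X) ?V"
      by (intro openin_Int continuous_openin_preimage_gen p q) auto
    moreover have "y \<in> ?V" using y e by auto
    moreover have "?V \<subseteq> ?E" using inj_onD[OF e(2)] eq by auto
    ultimately show "\<exists>T. openin (top_of_set X) T \<and> y \<in> T \<and> T \<subseteq> ?E" by blast
  qed
  ultimately have "?E = {} \<or> ?E = X" using X unfolding connected_clopen by blast
  moreover have "x0 \<in> ?E" using x0 by simp
  ultimately show ?thesis using x by auto
qed

lemma is_sec_restrict:
  assumes "is_sec S f x r g" "y = g (f y)" "ball (f y) s \<subseteq> ball (f x) r"
  shows "is_sec S f y s g"
  using assms unfolding is_sec_def by (auto intro: continuous_on_subset)

lemma sec_agree:
  assumes f: "local_imm S f" and g: "is_sec S f x r g" and h: "is_sec S f y s h"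
    and w: "w \<in> ball (f x) r" "w \<in> ball (f y) s" "g w = h w"
    and v: "v \<in> ball (f x) r" "v \<in> ball (f y) s"
  shows "g v = h v"
proof (rule lift_unique[OF f, where p=g and q=h and x=v and X="ball (f x) r \<inter> ball (f y) s" and x0=w])
  show "connected (ball (f x) r \<inter> ball (f y) s)" by (simp add: convex_connected convex_Int)
  show "continuous_on (ball (f x) r \<inter> ball (f y) s) g" "continuous_on (ball (f x) r \<inter> ball (f y) s) h"
    using g h by (auto simp: is_sec_def intro: continuous_on_subset)
  show "g \<in> ball (f x) r \<inter> ball (f y) s \<rightarrow> S" "h \<in> ball (f x) r \<inter> ball (f y) s \<rightarrow> S"
    using g h by (auto simp: is_sec_def)
  show "f (g u) = f (h u)" if "u \<in> ball (f x) r \<inter> ball (f y) s" for u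
    using g h that by (auto simp: is_sec_def)
qed (use w v in auto)

text \<open>The section inverts \<open>f\<close> on one side only. Near \<open>x\<close> it does so
  on the other side too: by continuity \<open>g (f y)\<close> falls into a ball on which
  \<open>f\<close> is injective, and it has the same image as \<open>y\<close>.\<close>

lemma sec_near:
  assumes f: "local_imm S f" and x: "x \<in> S" and r: "r > 0" and g: "is_sec S f x r g"
  obtains d where "d > 0" "\<And>y. y \<in> ball x d \<Longrightarrow> y \<in> S \<and> f y \<in> ball (f x) r \<and> g (f y) = y"
proof -
  obtain e where e: "e > 0" "ball x e \<subseteq> S" "inj_on f (ball x e)"
    using f x unfolding local_imm_def by blast
  have S: "open S" "continuous_on S f" using f by (auto simp: local_imm_def)
  let ?A = "S \<inter> f -` ball (f x) r"
  have oA: "open ?A" by (rule continuous_open_preimage[OF S(2,1)]) simp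
  have cA: "continuous_on ?A (\<lambda>y. g (f y))"
    by (rule continuous_on_compose2[of "ball (f x) r" g])
      (use g S in \<open>auto simp: is_sec_def intro: continuous_on_subset\<close>)
  let ?B = "?A \<inter> (\<lambda>y. g (f y)) -` ball x e"
  have "open ?B" by (rule continuous_open_preimage[OF cA oA]) simp
  moreover have "x \<in> ?B" using x r e g by (auto simp: is_sec_def)
  ultimately obtain d where d: "d > 0" "ball x d \<subseteq> ?B" using open_contains_ball by blast
  show ?thesis
  proof
    show "min d e > 0" using d e by simp
    fix y assume y: "y \<in> ball x (min d e)"
    then have "y \<in> ?B" "y \<in> ball x e" using d by auto
    then show "y \<in> S \<and> f y \<in> ball (f x) r \<and> g (f y) = y"
      using g inj_onD[OF e(3), of "g (f y)" y] unfolding is_sec_def by auto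
  qed
qed

lemma local_thick:
  assumes f: "local_imm S f" and x: "x \<in> S"
  obtains r where "r > 0" "thick S f x r"
proof -
  obtain e where e: "e > 0" "ball x e \<subseteq> S" "inj_on f (ball x e)"
    using f x unfolding local_imm_def by blast
  have c: "continuous_on (ball x e) f" using f e by (auto simp: local_imm_def intro: continuous_on_subset)
  obtain g where g: "homeomorphism (ball x e) (f ` ball x e) f g"
    using invariance_of_domain_homeomorphism[OF _ c _ e(3)] by auto
  have "open (f ` ball x e)" using invariance_of_domain[OF c _ e(3)] by simp
  then obtain r where r: "r > 0" "ball (f x) r \<subseteq> f ` ball x e"
    using e(1) open_contains_ball by (metis centre_in_ball image_eqI)
  have "g \<in> f ` ball x e \<rightarrow> ball x e" "continuous_on (f ` ball x e) g" "\<And>w. w \<in> f ` ball x e \<Longrightarrow> f (g w) = w" "g (f x) = x"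
    using g e(1) unfolding homeomorphism_def by auto
  then have "is_sec S f x r g" unfolding is_sec_def using r e by (blast intro: continuous_on_subset)
  then show ?thesis using that r by (auto simp: thick_def)
qed

lemma thick_mono:
  assumes "thick S f x r" "s \<le> r" "S \<subseteq> T"
  shows "thick T f x s"
proof -
  obtain g where "is_sec S f x r g" using assms by (auto simp: thick_def)
  then have "is_sec T f x s g" using assms(2,3) unfolding is_sec_def
    by (auto intro: continuous_on_subset)
  then show ?thesis by (auto simp: thick_def)
qed

lemma thick_near:
  assumes f: "local_imm S f" and x: "x \<in> S" and r: "r > 0" and t: "thick S f x r"
  obtains d where "d > 0" "\<And>y. y \<in> ball x d \<Longrightarrow> thick S f y (r/2)"
proof -
  obtain g where g: "is_sec S f x r g" using t by (auto simp: thick_def)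
  then have "is_sec S f x (r/2) g" using r by (auto simp: is_sec_def intro: continuous_on_subset)
  then obtain d where d: "d > 0" "\<And>y. y \<in> ball x d \<Longrightarrow> y \<in> S \<and> f y \<in> ball (f x) (r/2) \<and> g (f y) = y"
    using sec_near[OF f x _ , of "r/2" g] r by auto
  show ?thesis
  proof (rule that[OF d(1)])
    fix y assume "y \<in> ball x d"
    then have y: "dist (f x) (f y) < r/2" "g (f y) = y" using d(2)[of y] by auto
    have "ball (f y) (r/2) \<subseteq> ball (f x) r"
      using y(1) by (simp add: ball_subset_ball_iff dist_commute)
    then have "is_sec S f y (r/2) g" using is_sec_restrict[OF g] y by simp
    then show "thick S f y (r/2)" by (auto simp: thick_def)
  qed
qed

lemma compact_thick:
  assumes f: "local_imm S f" and K: "compact K" "K \<subseteq> S"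
  obtains r where "r > 0" "\<And>x. x \<in> K \<Longrightarrow> thick S f x r"
proof -
  have "\<exists>d r. d > 0 \<and> r > 0 \<and> (\<forall>y\<in>ball x d. thick S f y r)" if "x \<in> K" for x
  proof -
    have x: "x \<in> S" using that K by auto
    obtain r where r: "r > 0" "thick S f x r" using local_thick[OF f x] .
    obtain d where "d > 0" "\<And>y. y \<in> ball x d \<Longrightarrow> thick S f y (r/2)" using thick_near[OF f x r] by blast
    then show ?thesis using r by (intro exI[of _ d] exI[of _ "r/2"]) auto
  qed
  then obtain d r where dr: "\<And>x. x \<in> K \<Longrightarrow> d x > 0" "\<And>x. x \<in> K \<Longrightarrow> r x > 0"
    "\<And>x y. x \<in> K \<Longrightarrow> y \<in> ball x (d x) \<Longrightarrow> thick S f y (r x :: real)" by metis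
  have "K \<subseteq> (\<Union>x\<in>K. ball x (d x))" using dr(1) by force
  then obtain F where F: "F \<subseteq> K" "finite F" "K \<subseteq> (\<Union>x\<in>F. ball x (d x))"
    using compactE_image[OF K(1), of K "\<lambda>x. ball x (d x)"] by auto
  \<comment> \<open>The entry 1 keeps the minimum defined when the finite cover is empty.\<close>
  let ?R = "Min (insert 1 (r ` F))"
  show ?thesis
  proof
    show "?R > 0" using F dr by (subst Min_gr_iff) auto
    fix x assume "x \<in> K"
    then obtain y where y: "y \<in> F" "x \<in> ball y (d y)" using F by auto
    then have "thick S f x (r y)" using dr F by auto
    moreover have "?R \<le> r y" using y F by auto
    ultimately show "thick S f x ?R" using thick_mono by blast
  qed
qed

text \<open>The sections of \<open>f\<close> through the points \<open>p x\<close> patch together, because two sections on balls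
  agree on the convex intersection as soon as they agree at one point.\<close>
lemma lift_perturb:
  fixes p u :: "'a::topological_space \<Rightarrow> complex"
  assumes f: "local_imm S f" and p: "continuous_on X p" "p \<in> X \<rightarrow> S"
    and t: "\<And>x. x \<in> X \<Longrightarrow> thick S f (p x) r"
    and u: "continuous_on X u" "\<And>x. x \<in> X \<Longrightarrow> dist (f (p x)) (u x) < r"
  obtains q where "continuous_on X q" "q \<in> X \<rightarrow> S" "\<And>x. x \<in> X \<Longrightarrow> f (q x) = u x"
    "\<And>x. x \<in> X \<Longrightarrow> u x = f (p x) \<Longrightarrow> q x = p x"
proof -
  obtain G where G: "\<And>x. x \<in> X \<Longrightarrow> is_sec S f (p x) r (G x)"
    using t unfolding thick_def by metis
  define q where "q x = G x (u x)" for x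
  have ux: "u x \<in> ball (f (p x)) r" if "x \<in> X" for x using u(2) that by simp
  have r: "r > 0" if "x \<in> X" for x using u(2)[OF that] by (meson le_less_trans zero_le_dist)
  have fp: "continuous_on X (\<lambda>x. f (p x))"
    using f p by (auto simp: local_imm_def intro: continuous_on_compose2)
  show ?thesis
  proof
    show "continuous_on X q" unfolding continuous_on_def
    proof
      fix x assume x: "x \<in> X"
      note gx = G[OF x]
      have px: "p x \<in> S" using p x by auto
      obtain d where d: "d > 0" "\<And>y. y \<in> ball (p x) d \<Longrightarrow> y \<in> S \<and> f y \<in> ball (f (p x)) r \<and> G x (f y) = y"
        using sec_near[OF f px r[OF x] gx] by blast
      have ev1: "\<forall>\<^sub>F y in at x within X. p y \<in> ball (p x) d"
      proof -
        have "(p \<longlongrightarrow> p x) (at x within X)" using p x by (auto simp: continuous_on_def)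
        then show ?thesis using d(1) by (intro topological_tendstoD) auto
      qed
      have ev2: "\<forall>\<^sub>F y in at x within X. u y \<in> ball (f (p x)) r"
      proof -
        have "(u \<longlongrightarrow> u x) (at x within X)" using u x by (auto simp: continuous_on_def)
        then show ?thesis using ux[OF x] by (intro topological_tendstoD) auto
      qed
      have "\<forall>\<^sub>F y in at x within X. y \<in> X" by (simp add: eventually_at_filter)
      \<comment> \<open>Near \<open>x\<close> the section chosen at \<open>x\<close> may replace the
        one chosen at \<open>y\<close>: both pass through \<open>p y\<close> over
        \<open>f (p y)\<close>, so they also agree at \<open>u y\<close>.\<close>
      with ev1 ev2 have "\<forall>\<^sub>F y in at x within X. G x (u y) = q y"
      proof eventually_elim
        case (elim y)
        have gy: "is_sec S f (p y) r (G y)" using G elim by auto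
        have "G x (f (p y)) = G y (f (p y))" using d(2)[of "p y"] elim gy by (auto simp: is_sec_def)
        then show ?case unfolding q_def
          using sec_agree[OF f gx gy, of "f (p y)" "u y"] d(2)[of "p y"] elim ux r by auto
      qed
      moreover have "((\<lambda>y. G x (u y)) \<longlongrightarrow> q x) (at x within X)"
      proof -
        have "isCont (G x) (u x)"
          using gx ux[OF x] by (auto simp: is_sec_def continuous_on_eq_continuous_at)
        moreover have "(u \<longlongrightarrow> u x) (at x within X)" using u x by (auto simp: continuous_on_def)
        ultimately show ?thesis unfolding q_def using isCont_tendsto_compose by blast
      qed
      ultimately show "(q \<longlongrightarrow> q x) (at x within X)" by (rule Lim_transform_eventually[rotated])
    qed
    show "q \<in> X \<rightarrow> S" "\<And>x. x \<in> X \<Longrightarrow> f (q x) = u x"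
      using G ux unfolding q_def is_sec_def by blast+
    \<comment> \<open>Later this clause keeps basepoints and the starting points of lifted segments
      fixed.\<close>
    show "\<And>x. x \<in> X \<Longrightarrow> u x = f (p x) \<Longrightarrow> q x = p x"
      using G unfolding q_def is_sec_def by auto
  qed
qed

section \<open>Winding numbers and the argument principle\<close>

text \<open>Imaginary parts in a ball of radius 1 differ by less than the period
  \<open>2 * pi\<close>. With this, comparing continuous logarithms becomes an instance of
  uniqueness of lifts.\<close>

lemma local_imm_exp: "local_imm UNIV exp"
  unfolding local_imm_def
proof (intro conjI ballI)
  fix x :: complex
  have "inj_on exp (ball x 1)"
  proof (rule inj_onI)
    fix u v assume uv: "u \<in> ball x 1" "v \<in> ball x 1" "exp u = exp v"
    have "\<bar>Im (u - x)\<bar> < 1" "\<bar>Im (v - x)\<bar> < 1"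
      using uv abs_Im_le_cmod[of "u - x"] abs_Im_le_cmod[of "v - x"] by (auto simp: dist_norm norm_minus_commute)
    then have "\<bar>Im u - Im v\<bar> < 2 * pi" using pi_gt3 by auto
    then show "u = v" using uv exp_complex_eqI by blast
  qed
  then show "\<exists>e>0. ball x e \<subseteq> UNIV \<and> inj_on exp (ball x e)" by (intro exI[of _ 1]) auto
qed (auto intro: continuous_intros)

text \<open>Some continuous logarithm has the right increment; any other one lifts the same path
  through \<open>exp\<close> and so differs from it by a constant.\<close>

lemma winding_number_from_log:
  assumes q: "continuous_on {0..1} q" and p: "\<And>t. t \<in> {0..1} \<Longrightarrow> p t = z + exp (q t)"
  shows "2 * of_real pi * \<i> * winding_number p z = q 1 - q 0"
proof -
  have "continuous_on {0..1} (\<lambda>t. z + exp (q t))" by (intro continuous_intros q)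
  then have pp: "path p" unfolding path_def by (rule continuous_on_eq) (simp add: p)
  have "z \<notin> path_image p" using p by (auto simp: path_image_def)
  then obtain l where l: "path l" "pathfinish l - pathstart l = 2 * of_real pi * \<i> * winding_number p z"
    "\<And>t. t \<in> {0..1} \<Longrightarrow> p t = z + exp (l t)"
    using winding_number_as_continuous_log[OF pp] by blast
  have e: "exp (l t) = exp (q t)" if "t \<in> {0..1}" for t using l(3)[OF that] p[OF that] by simp
  have "l 1 = q 1 + (l 0 - q 0)"
  proof (rule lift_unique[OF local_imm_exp, where X="{0..1::real}" and p=l and q="\<lambda>t. q t + (l 0 - q 0)" and x=1 and ?x0.0=0])
    fix t :: real assume "t \<in> {0..1}"
    then show "exp (l t) = exp (q t + (l 0 - q 0))" using e[of t] e[of 0] by (simp add: exp_add exp_diff)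
  qed (use l(1) in \<open>auto simp: path_def intro!: continuous_intros q\<close>)
  then show ?thesis using l(2) by (simp add: pathfinish_def pathstart_def algebra_simps)
qed

lemma winding_number_mult:
  assumes p: "path p" "0 \<notin> path_image p" and q: "path q" "0 \<notin> path_image q"
  shows "winding_number (\<lambda>t. p t * q t) 0 = winding_number p 0 + winding_number q 0"
proof -
  obtain l where l: "path l" "pathfinish l - pathstart l = 2 * of_real pi * \<i> * winding_number p 0"
    "\<And>t. t \<in> {0..1} \<Longrightarrow> p t = 0 + exp (l t)"
    using winding_number_as_continuous_log[OF p] by blast
  obtain m where m: "path m" "pathfinish m - pathstart m = 2 * of_real pi * \<i> * winding_number q 0"
    "\<And>t. t \<in> {0..1} \<Longrightarrow> q t = 0 + exp (m t)"
    using winding_number_as_continuous_log[OF q] by blast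
  have "2 * of_real pi * \<i> * winding_number (\<lambda>t. p t * q t) 0 = (l 1 + m 1) - (l 0 + m 0)"
    by (rule winding_number_from_log)
      (use l m in \<open>auto simp: path_def exp_add intro!: continuous_intros\<close>)
  also have "\<dots> = 2 * of_real pi * \<i> * (winding_number p 0 + winding_number q 0)"
    using l(2) m(2) by (simp add: pathfinish_def pathstart_def algebra_simps)
  finally show ?thesis by simp
qed

text \<open>On a contractible set \<open>f\<close> has a continuous logarithm, which returns to its
  initial value along a closed path.\<close>

lemma winding_number_nonvanishing:
  fixes S :: "complex set"
  assumes f: "continuous_on S f" "\<And>x. x \<in> S \<Longrightarrow> f x \<noteq> 0" and S: "contractible S"
    and l: "path l" "path_image l \<subseteq> S" "pathfinish l = pathstart l"
  shows "winding_number (\<lambda>t. f (l t)) 0 = 0"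
proof -
  obtain g where g: "continuous_on S g" "\<And>x. x \<in> S \<Longrightarrow> f x = exp (g x)"
  proof (rule continuous_logarithm_on_contractible[OF f(1) S])
    show "f x \<noteq> 0" if "x \<in> S" for x using f(2) that .
  qed blast
  have "2 * of_real pi * \<i> * winding_number (\<lambda>t. f (l t)) 0 = g (l 1) - g (l 0)"
  proof (rule winding_number_from_log)
    show "continuous_on {0..1} (\<lambda>t. g (l t))"
      by (rule continuous_on_compose2[OF g(1)]) (use l in \<open>auto simp: path_def path_image_def\<close>)
    show "f (l t) = 0 + exp (g (l t))" if "t \<in> {0..1}" for t
      using that l(2) by (auto simp: path_image_def intro!: g(2))
  qed
  then show ?thesis using l(3) by (simp add: pathfinish_def pathstart_def)
qed

text \<open>Parametrised by \<open>cis\<close> exactly as in \<open>orient_pres\<close>, so that its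
  logarithmic lifts can be used directly.\<close>

definition circ :: "complex \<Rightarrow> real \<Rightarrow> real \<Rightarrow> complex" where
  "circ a r t = a + of_real r * cis (2 * pi * t)"

lemma path_circ: "path (circ a r)"
  unfolding path_def circ_def by (intro continuous_intros)

lemma circ_closed: "pathfinish (circ a r) = pathstart (circ a r)"
  by (simp add: pathfinish_def pathstart_def circ_def cis.ctr one_complex.code)

lemma circ_in_sphere: "r \<ge> 0 \<Longrightarrow> circ a r t \<in> sphere a r"
  by (simp add: circ_def dist_norm norm_mult)

lemma path_image_circ_subset: "r \<ge> 0 \<Longrightarrow> path_image (circ a r) \<subseteq> sphere a r"
  using circ_in_sphere by (auto simp: path_image_def)

lemma winding_number_circ:
  assumes "r > 0"
  shows "winding_number (\<lambda>t. circ a r t - a) 0 = 1"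
proof -
  have "2 * of_real pi * \<i> * winding_number (\<lambda>t. circ a r t - a) 0 =
    (of_real (ln r) + 2 * of_real pi * \<i> * of_real 1) - (of_real (ln r) + 2 * of_real pi * \<i> * of_real 0)"
  proof (rule winding_number_from_log)
    show "continuous_on {0..1} (\<lambda>t. of_real (ln r) + 2 * of_real pi * \<i> * of_real t :: complex)"
      by (intro continuous_intros)
    show "circ a r t - a = 0 + exp (of_real (ln r) + 2 * of_real pi * \<i> * of_real t)" for t
      using assms by (simp add: circ_def exp_add exp_of_real cis_conv_exp mult_ac)
  qed
  then show ?thesis by simp
qed

text \<open>Winding number zero makes the loop null-homotopic in the punctured plane, which gives a
  logarithm on the circle. Tietze's theorem is applied to the logarithm and not to \<open>f\<close>,
  so that \<open>exp (g x)\<close> is an extension without zeros.\<close>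

lemma circle_log_extension:
  assumes r: "r > 0" and f: "continuous_on (sphere a r) f" "\<And>x. x \<in> sphere a r \<Longrightarrow> f x \<noteq> 0"
    and w: "winding_number (\<lambda>t. f (circ a r t)) 0 = 0"
  obtains g where "continuous_on UNIV g" "\<And>x. x \<in> sphere a r \<Longrightarrow> f x = exp (g x)"
proof -
  let ?p = "\<lambda>t. f (circ a r t)"
  have "path ?p" unfolding path_def
    by (rule continuous_on_compose2[OF f(1)]) (use path_circ circ_in_sphere r in \<open>auto simp: path_def\<close>)
  moreover have "0 \<notin> path_image ?p"
    using f(2) circ_in_sphere[of r a] r by (force simp: path_image_def)
  ultimately obtain c where "homotopic_loops (-{0}) ?p (\<lambda>t. c)"
    using winding_number_homotopic_loops_null_eq w by blast
  then have "homotopic_with_canon (\<lambda>h. True) (sphere 0 1) (-{0}) (\<lambda>z. ?p (Arg2pi z / (2 * pi))) (\<lambda>z. c)"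
    using homotopic_loops_imp_homotopic_circlemaps[of "-{0}" ?p "\<lambda>t. c"] by (simp add: o_def)
  then have "\<exists>g. continuous_on (sphere 0 1) g \<and> (\<forall>z\<in>sphere 0 1. ?p (Arg2pi z / (2 * pi)) = exp (g z))"
    by (intro iffD1[OF inessential_eq_continuous_logarithm] exI)
  then obtain g where g: "continuous_on (sphere 0 1) g"
    "\<And>z. z \<in> sphere 0 1 \<Longrightarrow> f (circ a r (Arg2pi z / (2 * pi))) = exp (g z)"
    by blast
  define h where "h x = g ((x - a) / of_real r)" for x
  have s: "(x - a) / of_real r \<in> sphere 0 1" if "x \<in> sphere a r" for x
    using that r by (simp add: norm_divide dist_norm norm_minus_commute)
  have h: "f x = exp (h x)" if x: "x \<in> sphere a r" for x
  proof -
    let ?z = "(x - a) / of_real r"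
    have "cis (Arg2pi ?z) = ?z"
      using s[OF x] Arg2pi_eq[of ?z] by (simp add: cis_conv_exp)
    then have "circ a r (Arg2pi ?z / (2 * pi)) = x" using r by (simp add: circ_def)
    then show ?thesis using g(2)[OF s[OF x]] by (simp add: h_def)
  qed
  have "continuous_on (sphere a r) h" unfolding h_def
  proof (rule continuous_on_compose2[OF g(1)])
    show "continuous_on (sphere a r) (\<lambda>x. (x - a) / of_real r)" using r by (intro continuous_intros) auto
  qed (use s in blast)
  then obtain k where "continuous_on UNIV k" "\<And>x. x \<in> sphere a r \<Longrightarrow> k x = h x"
    using Tietze_unbounded[of "sphere a r" h UNIV] by auto
  then show ?thesis using that h by simp
qed

text \<open>A zero of local degree one. All small radii are included so that the circle can be
  shrunk away from other sets.\<close>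

definition simple_zero :: "complex set \<Rightarrow> (complex \<Rightarrow> complex) \<Rightarrow> complex \<Rightarrow> bool" where
  "simple_zero S f a \<longleftrightarrow> f a = 0 \<and> (\<exists>\<rho>>0. cball a \<rho> \<subseteq> S \<and> (\<forall>x\<in>cball a \<rho> - {a}. f x \<noteq> 0) \<and>
     (\<forall>r\<in>{0<..\<rho>}. winding_number (\<lambda>t. f (circ a r t)) 0 = 1))"

text \<open>The topological counterpart of dividing by \<open>x - a\<close>. Numerator and
  denominator both wind once around a small circle, so the quotient winds zero times and its values
  inside can be replaced by nonvanishing ones. The closed set \<open>N\<close> is what this
  modification must not touch.\<close>

lemma remove_simple_zero:
  assumes S: "open S" and f: "continuous_on S f" and a: "simple_zero S f a"
    and N: "closed N" "a \<notin> N"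
  obtains f' \<delta> where "\<delta> > 0" "cball a \<delta> \<subseteq> S - N" "continuous_on S f'"
    "\<And>x. x \<in> S \<Longrightarrow> f' x = 0 \<longleftrightarrow> f x = 0 \<and> x \<noteq> a"
    "\<And>x. x \<in> S - cball a \<delta> \<Longrightarrow> f x = (x - a) * f' x"
proof -
  obtain \<rho> where \<rho>: "\<rho> > 0" "cball a \<rho> \<subseteq> S" "\<And>x. x \<in> cball a \<rho> \<Longrightarrow> x \<noteq> a \<Longrightarrow> f x \<noteq> 0"
    "\<And>r. r \<in> {0<..\<rho>} \<Longrightarrow> winding_number (\<lambda>t. f (circ a r t)) 0 = 1" and fa: "f a = 0"
    using a unfolding simple_zero_def by blast
  obtain e where e: "e > 0" "ball a e \<inter> N = {}"
    using N open_contains_ball[of "-N"] by blast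
  define \<delta> where "\<delta> = min \<rho> (e/2)"
  have \<delta>: "\<delta> > 0" "\<delta> \<le> \<rho>" "cball a \<delta> \<subseteq> ball a e" "cball a \<delta> \<subseteq> cball a \<rho>"
    using \<rho> e by (auto simp: \<delta>_def)
  let ?q = "\<lambda>x. f x / (x - a)"
  have q: "continuous_on (S - {a}) ?q" by (intro continuous_intros continuous_on_subset[OF f]) auto
  have sS: "sphere a \<delta> \<subseteq> S - {a}" using \<delta> \<rho> by auto
  have wq: "winding_number (\<lambda>t. ?q (circ a \<delta> t)) 0 = 0"
  proof -
    have "winding_number (\<lambda>t. ?q (circ a \<delta> t) * (circ a \<delta> t - a)) 0
      = winding_number (\<lambda>t. ?q (circ a \<delta> t)) 0 + winding_number (\<lambda>t. circ a \<delta> t - a) 0"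
    proof (rule winding_number_mult)
      show "path (\<lambda>t. ?q (circ a \<delta> t))" unfolding path_def
      proof (rule continuous_on_compose2[OF q])
        show "circ a \<delta> ` {0..1} \<subseteq> S - {a}"
          using path_image_circ_subset[of \<delta> a] \<delta> sS unfolding path_image_def by (meson less_imp_le order_trans)
      qed (use path_circ[of a \<delta>] in \<open>simp add: path_def\<close>)
      show "path (\<lambda>t. circ a \<delta> t - a)" using path_circ[of a \<delta>] unfolding path_def by (intro continuous_intros)
      have "f (circ a \<delta> t) \<noteq> 0 \<and> circ a \<delta> t \<noteq> a" for t
      proof -
        have "circ a \<delta> t \<in> cball a \<rho>" "circ a \<delta> t \<noteq> a" using circ_in_sphere[of \<delta> a t] \<delta> by auto
        then show ?thesis using \<rho>(3) by blast
      qed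
      then show "0 \<notin> path_image (\<lambda>t. ?q (circ a \<delta> t))" "0 \<notin> path_image (\<lambda>t. circ a \<delta> t - a)"
        by (auto simp: path_image_def)
    qed
    moreover have "(\<lambda>t. ?q (circ a \<delta> t) * (circ a \<delta> t - a)) = (\<lambda>t. f (circ a \<delta> t))"
      using circ_in_sphere[of \<delta> a] \<delta> by (auto simp: fa)
    ultimately show ?thesis using winding_number_circ[of \<delta> a] \<rho>(4)[of \<delta>] \<delta> by simp
  qed
  obtain g where g: "continuous_on UNIV g" "\<And>x. x \<in> sphere a \<delta> \<Longrightarrow> ?q x = exp (g x)"
  proof (rule circle_log_extension[OF \<delta>(1) continuous_on_subset[OF q sS] _ wq])
    show "?q x \<noteq> 0" if "x \<in> sphere a \<delta>" for x
    proof -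
      have "x \<in> cball a \<rho>" "x \<noteq> a" using that \<delta> by auto
      then show ?thesis using \<rho>(3) by simp
    qed
  qed blast
  define f' where "f' x = (if x \<in> cball a \<delta> then exp (g x) else ?q x)" for x
  show ?thesis
  proof (rule that[OF \<delta>(1)])
    show "cball a \<delta> \<subseteq> S - N" using \<delta> \<rho> e by blast
    have "continuous_on (cball a \<delta> \<union> (S - ball a \<delta>)) f'" unfolding f'_def
    proof (rule continuous_on_cases_local)
      show "closedin (top_of_set (cball a \<delta> \<union> (S - ball a \<delta>))) (cball a \<delta>)"
        by (intro closed_subset) auto
      have "S - ball a \<delta> = (cball a \<delta> \<union> (S - ball a \<delta>)) \<inter> (- ball a \<delta>)"
        using \<delta> \<rho> by auto
      then show "closedin (top_of_set (cball a \<delta> \<union> (S - ball a \<delta>))) (S - ball a \<delta>)"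
        by (metis closed_Compl closedin_closed_Int open_ball)
      show "continuous_on (cball a \<delta>) (\<lambda>x. exp (g x))"
        by (intro continuous_intros continuous_on_subset[OF g(1)]) auto
      show "continuous_on (S - ball a \<delta>) ?q"
        by (rule continuous_on_subset[OF q]) (use \<delta> in auto)
      show "exp (g x) = ?q x" if "x \<in> cball a \<delta> \<and> x \<notin> cball a \<delta> \<or> x \<in> S - ball a \<delta> \<and> x \<in> cball a \<delta>" for x
        using that g(2)[of x] by (auto simp: not_less)
    qed
    moreover have "cball a \<delta> \<union> (S - ball a \<delta>) = S" using \<delta> \<rho> by (auto simp: not_less)
    ultimately show "continuous_on S f'" by simp
    show "f' x = 0 \<longleftrightarrow> f x = 0 \<and> x \<noteq> a" if "x \<in> S" for x
    proof (cases "x \<in> cball a \<delta>")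
      case True
      then have "x \<in> cball a \<rho>" using \<delta> by blast
      then show ?thesis using True \<rho>(3)[of x] by (auto simp: f'_def)
    qed (use \<delta> in \<open>auto simp: f'_def\<close>)
    show "f x = (x - a) * f' x" if "x \<in> S - cball a \<delta>" for x
      using that \<delta> by (auto simp: f'_def)
  qed
qed

text \<open>An argument principle for continuous functions, by induction on the zeros: the factor
  \<open>x - a\<close> contributes \<open>winding_number l a\<close>, and the other factor has one
  zero fewer. The function is generalised because it changes at each step.\<close>

lemma winding_number_eq_sum_simple_zeros:
  assumes "finite A" and S: "open S" "contractible S" and "continuous_on S f" "{x\<in>S. f x = 0} = A"
    and "\<And>a. a \<in> A \<Longrightarrow> simple_zero S f a"
    and l: "path l" "path_image l \<subseteq> S - A" "pathfinish l = pathstart l"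
  shows "winding_number (\<lambda>t. f (l t)) 0 = (\<Sum>a\<in>A. winding_number l a)"
  using assms(1,4-6) l(2)
proof (induction A arbitrary: f rule: finite_induct)
  case empty
  then show ?case using winding_number_nonvanishing[of S f l] S l by auto
next
  case (insert a A f)
  have N: "closed (path_image l \<union> A)" "a \<notin> path_image l \<union> A"
    using l insert.hyps insert.prems(4) by (auto simp: closed_path_image finite_imp_closed)
  obtain f' \<delta> where \<delta>: "\<delta> > 0" and c: "cball a \<delta> \<subseteq> S - (path_image l \<union> A)" and f': "continuous_on S f'"
    and z: "\<And>x. x \<in> S \<Longrightarrow> f' x = 0 \<longleftrightarrow> f x = 0 \<and> x \<noteq> a"
    and e: "\<And>x. x \<in> S - cball a \<delta> \<Longrightarrow> f x = (x - a) * f' x"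
  proof (rule remove_simple_zero[OF S(1) insert.prems(1) _ N])
    show "simple_zero S f a" using insert.prems(3) by simp
  qed blast
  have zA: "{x\<in>S. f' x = 0} = A" using z insert.prems(2) insert.hyps(2) by auto
  have prod: "winding_number (\<lambda>t. f (k t)) 0 = winding_number (\<lambda>t. k t - a) 0 + winding_number (\<lambda>t. f' (k t)) 0"
    if k: "path k" "path_image k \<subseteq> S - cball a \<delta> - A" for k
  proof -
    have kin: "k t \<in> S - cball a \<delta> - A" if "t \<in> {0..1}" for t using k(2) that unfolding path_image_def by blast
    have nz: "k t \<noteq> a" "f' (k t) \<noteq> 0" if "t \<in> {0..1}" for t using kin[OF that] \<delta> zA by auto
    have pf: "path (\<lambda>t. f' (k t))" unfolding path_def
      by (rule continuous_on_compose2[OF f']) (use k(1) kin in \<open>auto simp: path_def\<close>)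
    have pk: "path (\<lambda>t. k t - a)" using k(1) unfolding path_def by (intro continuous_intros)
    have "winding_number (\<lambda>t. (k t - a) * f' (k t)) 0
      = winding_number (\<lambda>t. k t - a) 0 + winding_number (\<lambda>t. f' (k t)) 0"
      by (rule winding_number_mult[OF pk _ pf]) (use nz in \<open>force simp: path_image_def\<close>)+
    moreover have "winding_number (\<lambda>t. f (k t)) 0 = winding_number (\<lambda>t. (k t - a) * f' (k t)) 0"
      by (rule winding_number_cong) (use e kin in auto)
    ultimately show ?thesis by simp
  qed
  \<comment> \<open>Along small circles at \<open>b\<close> the factor \<open>x - a\<close> does not
    wind, so \<open>f'\<close> has the same degree there as \<open>f\<close>.\<close>
  have "simple_zero S f' b" if b: "b \<in> A" for b
  proof -
    obtain \<rho> where \<rho>: "\<rho> > 0" "cball b \<rho> \<subseteq> S" "\<And>x. x \<in> cball b \<rho> \<Longrightarrow> x \<noteq> b \<Longrightarrow> f x \<noteq> 0"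
      "\<And>r. r \<in> {0<..\<rho>} \<Longrightarrow> winding_number (\<lambda>t. f (circ b r t)) 0 = 1"
      using insert.prems(3)[of b] b unfolding simple_zero_def by blast
    have "b \<notin> cball a \<delta>" using c b by auto
    then obtain e where e: "e > 0" "ball b e \<subseteq> - cball a \<delta>"
      using open_contains_ball[of "- cball a \<delta>"] by blast
    define s where "s = min \<rho> (e/2)"
    have s: "s > 0" "s \<le> \<rho>" "cball b s \<subseteq> ball b e" "cball b s \<subseteq> cball b \<rho>" using e \<rho> by (auto simp: s_def)
    have "winding_number (\<lambda>t. f' (circ b r t)) 0 = 1" if r: "r \<in> {0<..s}" for r
    proof -
      have sph: "sphere b r \<subseteq> cball b s - {b}" using r by auto
      then have "sphere b r \<subseteq> S - cball a \<delta> - A"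
        using s e \<rho>(2,3) insert.prems(2) by blast
      then have "winding_number (\<lambda>t. f (circ b r t)) 0
        = winding_number (\<lambda>t. circ b r t - a) 0 + winding_number (\<lambda>t. f' (circ b r t)) 0"
        using prod[OF path_circ, of b r] path_image_circ_subset[of r b] r by force
      moreover have "winding_number (\<lambda>t. circ b r t - a) 0 = 0"
      proof (rule winding_number_nonvanishing[where S="cball b s" and f="\<lambda>x. x - a" and l="circ b r"])
        show "x - a \<noteq> 0" if "x \<in> cball b s" for x
        proof -
          have "a \<in> cball a \<delta>" using \<delta> by simp
          then have "a \<notin> cball b s" using s(3) e(2) by blast
          then show ?thesis using that by auto
        qed
        show "path_image (circ b r) \<subseteq> cball b s" using path_image_circ_subset[of r b] sph r by auto
      qed (auto simp: path_circ circ_closed convex_imp_contractible intro!: continuous_intros)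
      moreover have "winding_number (\<lambda>t. f (circ b r t)) 0 = 1" using \<rho>(4) r s by auto
      ultimately show ?thesis by simp
    qed
    moreover have "f' x \<noteq> 0" if "x \<in> cball b s - {b}" for x
      
    proof -
      have "x \<in> cball b \<rho>" "x \<noteq> b" using that s(4) by auto
      then show ?thesis using z[of x] \<rho>(2,3) by blast
    qed
    moreover have "f' b = 0" using b zA by auto
    ultimately show ?thesis unfolding simple_zero_def using s \<rho> by (intro conjI exI[of _ s]) auto
  qed
  then have IH: "winding_number (\<lambda>t. f' (l t)) 0 = (\<Sum>a\<in>A. winding_number l a)"
    using insert.prems(4) by (intro insert.IH f' zA) auto
  have "path_image l \<subseteq> S - cball a \<delta> - A" using c insert.prems(4) by auto
  then show ?case
    using prod[OF l(1)] IH insert.hyps winding_number_offset[of l a] by simp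
qed

lemma compact_subset_ball_shrink:
  fixes K :: "complex set"
  assumes "compact K" "K \<subseteq> ball 0 s" "0 < s"
  obtains r where "0 < r" "r < s" "K \<subseteq> ball 0 r"
proof (cases "K = {}")
  case True
  then show ?thesis using that[of "s/2"] assms by auto
next
  case False
  then obtain x where x: "x \<in> K" "\<And>y. y \<in> K \<Longrightarrow> norm y \<le> norm x"
    using continuous_attains_sup[OF assms(1) False, of norm] by (auto intro: continuous_intros)
  obtain r where "norm x < r" "r < s" using x(1) assms(2) dense[of "norm x" s] by (auto simp: subset_iff)
  then show ?thesis using that[of r] x(2) norm_ge_zero[of x] by force
qed

section \<open>Orientation-preserving local homeomorphisms and counting of preimages\<close>

lemma local_homeo_local_imm:
  assumes f: "local_homeo S f" "continuous_on S f"
  shows "local_imm S f"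
proof -
  have V: "\<exists>V. open V \<and> x \<in> V \<and> V \<subseteq> S \<and> inj_on f V" if "x \<in> S" for x
    using f(1) that unfolding local_homeo_def homeomorphism_def by (metis inj_on_inverseI)
  then have "open S" by (subst open_subopen) blast
  moreover have "\<exists>e>0. ball x e \<subseteq> S \<and> inj_on f (ball x e)" if x: "x \<in> S" for x
  proof -
    obtain U where U: "open U" "x \<in> U" "U \<subseteq> S" "inj_on f U" using V[OF x] by blast
    then obtain e where "e > 0" "ball x e \<subseteq> U" using open_contains_ball by blast
    then show ?thesis using U by (intro exI[of _ e]) (auto intro: inj_on_subset)
  qed
  ultimately show ?thesis using f by (simp add: local_imm_def)
qed

lemma pointed_lh_local_imm: "pointed_lh \<phi> \<Longrightarrow> local_imm Dsk \<phi>"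
  using local_homeo_local_imm by (simp add: pointed_lh_def)

text \<open>The radius in \<open>orient_pres\<close> may be shrunk, since the image circles are homotopic in the
  complement of the centre.\<close>
lemma orient_pres_simple_zero:
  assumes f: "orient_pres S f" "continuous_on S f" and a: "a \<in> S"
  shows "simple_zero S (\<lambda>x. f x - f a) a"
proof -
  obtain \<rho> \<theta> where \<rho>: "\<rho> > 0" "cball a \<rho> \<subseteq> S" "inj_on f (cball a \<rho>)" and \<theta>: "continuous_on {0..1} \<theta>"
    "\<And>t. t \<in> {0..1::real} \<Longrightarrow> exp (\<theta> t) = f (a + of_real \<rho> * cis (2 * pi * t)) - f a"
    "\<theta> 1 = \<theta> 0 + 2 * of_real pi * \<i>"
    using f a unfolding orient_pres_def by blast
  have nz: "f x \<noteq> f a" if "x \<in> cball a \<rho>" "x \<noteq> a" for x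
    using inj_onD[OF \<rho>(3), of x a] that \<rho>(1) by auto
  have top: "winding_number (\<lambda>t. f (circ a \<rho> t) - f a) 0 = 1"
  proof -
    have "2 * of_real pi * \<i> * winding_number (\<lambda>t. f (circ a \<rho> t) - f a) 0 = \<theta> 1 - \<theta> 0"
      by (rule winding_number_from_log[OF \<theta>(1)]) (simp add: \<theta>(2) circ_def)
    then show ?thesis by (simp add: \<theta>(3))
  qed
  have "winding_number (\<lambda>t. f (circ a r t) - f a) 0 = 1" if r: "r \<in> {0<..\<rho>}" for r
  proof -
    define k where "k z = circ a ((1 - fst z) * \<rho> + fst z * r) (snd z)" for z :: "real \<times> real"
    have k: "k z \<in> cball a \<rho> - {a}" if "z \<in> {0..1} \<times> {0..1}" for z
    proof -
      let ?s = "(1 - fst z) * \<rho> + fst z * r"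
      have "?s \<ge> (1 - fst z) * r + fst z * r" "?s \<le> (1 - fst z) * \<rho> + fst z * \<rho>"
        using that r by (auto intro!: mult_left_mono)
      then have "?s \<ge> r" "?s \<le> \<rho>" by (simp_all add: algebra_simps)
      then show ?thesis using circ_in_sphere[of ?s a "snd z"] r unfolding k_def by auto
    qed
    have "homotopic_loops (-{0}) (\<lambda>t. f (circ a \<rho> t) - f a) (\<lambda>t. f (circ a r t) - f a)"
      unfolding homotopic_loops
    proof (intro exI conjI ballI)
      let ?h = "\<lambda>z. f (k z) - f a"
      have "continuous_on ({0..1} \<times> {0..1}) k"
        unfolding k_def circ_def by (intro continuous_intros)
      then show "continuous_on ({0..1} \<times> {0..1}) ?h"
        by (intro continuous_intros continuous_on_compose2[OF f(2), of _ k]) (use k \<rho>(2) in auto)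
      show "?h \<in> {0..1} \<times> {0..1} \<rightarrow> -{0}"
      proof
        fix z :: "real \<times> real" assume "z \<in> {0..1} \<times> {0..1}"
        then show "?h z \<in> -{0}" using k[of z] nz[of "k z"] by simp
      qed
      show "pathfinish (?h \<circ> Pair s) = pathstart (?h \<circ> Pair s)" for s
        using circ_closed[of a "(1 - s) * \<rho> + s * r"] by (simp add: k_def pathfinish_def pathstart_def)
    qed (simp_all add: k_def)
    then show ?thesis using winding_number_homotopic_loops top by metis
  qed
  then show ?thesis unfolding simple_zero_def using \<rho> nz by (intro conjI exI[of _ \<rho>]) auto
qed

text \<open>Infinitely many preimages would accumulate at some \<open>x\<close> in \<open>K\<close>.
  Since \<open>f x = z\<close> is not known, the contradiction takes two different points of the
  fibre, chosen at different distances from \<open>x\<close>, in a ball on which \<open>f\<close> is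
  injective.\<close>

lemma finite_preimage:
  assumes f: "local_imm S f" and K: "compact K" "K \<subseteq> S"
  shows "finite {x\<in>K. f x = z}"
proof -
  have "\<not> x islimpt {x\<in>K. f x = z}" if "x \<in> K" for x
  proof
    assume l: "x islimpt {x\<in>K. f x = z}"
    have "x \<in> S" using K(2) that by blast
    then obtain e where e: "e > 0" "inj_on f (ball x e)" using f unfolding local_imm_def by blast
    have l': "\<exists>y\<in>{x\<in>K. f x = z}. y \<noteq> x \<and> dist y x < e" if "e > 0" for e
      using l that by (simp add: islimpt_approachable)
    obtain y where y: "y \<in> K" "f y = z" "y \<noteq> x" "dist y x < e" using l'[OF e(1)] by blast
    obtain y' where y': "y' \<in> K" "f y' = z" "y' \<noteq> x" "dist y' x < dist y x"
    proof -
      have "dist y x > 0" using y(3) by simp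
      then show ?thesis using l' that by blast
    qed
    have "y = y'" using inj_onD[OF e(2), of y y'] y y' by (auto simp: dist_commute)
    then show False using y' by simp
  qed
  then have "finite (K \<inter> {x\<in>K. f x = z})" using finite_not_islimpt_in_compact[OF K(1)] by blast
  then show ?thesis by (simp add: Int_def)
qed

text \<open>Orientation preservation makes every preimage a zero of degree one, so neither signs nor
  multiplicities occur in the sum.\<close>

lemma argument_principle:
  assumes f: "local_imm S f" "orient_pres S f" and R: "cball c R \<subseteq> S"
    and l: "path l" "path_image l \<subseteq> ball c R" "pathfinish l = pathstart l"
    and z: "z \<notin> f ` path_image l"
  shows "winding_number (\<lambda>t. f (l t)) z = (\<Sum>a\<in>{a\<in>ball c R. f a = z}. winding_number l a)"
proof -
  have cf: "continuous_on S f" using f by (simp add: local_imm_def)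
  let ?A = "{a\<in>ball c R. f a = z}"
  have "finite {a\<in>cball c R. f a = z}" using finite_preimage[OF f(1) _ R] by simp
  then have "finite ?A" by (rule rev_finite_subset) auto
  moreover have "continuous_on (ball c R) (\<lambda>x. f x - z)"
    by (intro continuous_intros continuous_on_subset[OF cf]) (use R in auto)
  moreover have "simple_zero (ball c R) (\<lambda>x. f x - z) a" if a: "a \<in> ?A" for a
  proof -
    have "a \<in> S" using a R by auto
    then have "simple_zero S (\<lambda>x. f x - z) a" using orient_pres_simple_zero[OF f(2) cf, of a] a by auto
    then obtain \<rho> where \<rho>: "\<rho> > 0" "\<And>x. x \<in> cball a \<rho> - {a} \<Longrightarrow> f x - z \<noteq> 0"
     "\<And>r. r \<in> {0<..\<rho>} \<Longrightarrow> winding_number (\<lambda>t. f (circ a r t) - z) 0 = 1"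
      unfolding simple_zero_def by blast
    have "a \<in> ball c R" using a by simp
    then obtain e where e: "e > 0" "cball a e \<subseteq> ball c R" using open_contains_cball[of "ball c R"] open_ball by blast
    show ?thesis unfolding simple_zero_def
    proof (intro conjI exI[of _ "min e \<rho>"] ballI)
      show "cball a (min e \<rho>) \<subseteq> ball c R" using e by auto
      show "f x - z \<noteq> 0" if "x \<in> cball a (min e \<rho>) - {a}" for x using \<rho>(2) that by auto
    qed (use \<rho> e a in auto)
  qed
  ultimately have "winding_number (\<lambda>t. f (l t) - z) 0 = (\<Sum>a\<in>?A. winding_number l a)"
  proof (intro winding_number_eq_sum_simple_zeros[where S="ball c R" and f="\<lambda>x. f x - z"])
    show "path_image l \<subseteq> ball c R - ?A" using z l by auto
  qed (use l in \<open>auto simp: convex_imp_contractible\<close>)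
  then show ?thesis using winding_number_offset[of "\<lambda>t. f (l t)" z] by simp
qed

text \<open>The image under \<open>\<psi>\<close> of the loop \<open>?l\<close>, itself the image
  under \<open>h\<close> of a small circle, winds once about \<open>\<phi> x\<close>. By the
  argument principle this is a sum over the points lying over \<open>\<phi> x\<close>. Those outside
  the image of the disk are not encircled, and the only one inside is \<open>h x\<close>; so
  \<open>?l\<close> winds once about \<open>h x\<close>.\<close>

lemma orient_pres_factor:
  assumes \<phi>: "pointed_lh \<phi>" and \<psi>: "pointed_lh \<psi>" and h: "homeomorphism Dsk Dsk h g"
    and eq: "\<And>x. x \<in> Dsk \<Longrightarrow> \<psi> (h x) = \<phi> x"
  shows "orient_pres Dsk h"
  unfolding orient_pres_def
proof
  fix x assume x: "x \<in> Dsk"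
  have hc: "continuous_on Dsk h" and him: "h ` Dsk = Dsk" and hinj: "inj_on h Dsk"
    using h by (auto simp: homeomorphism_def intro: inj_on_inverseI)
  have \<phi>o: "orient_pres Dsk \<phi>" and \<phi>c: "continuous_on Dsk \<phi>" and \<psi>o: "orient_pres Dsk \<psi>"
    using \<phi> \<psi> by (auto simp: pointed_lh_def)
  obtain \<rho> where \<rho>: "\<rho> > 0" "cball x \<rho> \<subseteq> Dsk" "\<And>y. y \<in> cball x \<rho> \<Longrightarrow> y \<noteq> x \<Longrightarrow> \<phi> y \<noteq> \<phi> x"
    "winding_number (\<lambda>t. \<phi> (circ x \<rho> t) - \<phi> x) 0 = 1"
    using orient_pres_simple_zero[OF \<phi>o \<phi>c x] unfolding simple_zero_def by force
  have cm: "circ x \<rho> t \<in> cball x \<rho>" "circ x \<rho> t \<noteq> x" for t using circ_in_sphere[of \<rho> x t] \<rho>(1) by auto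
  then have cD: "circ x \<rho> t \<in> Dsk" for t using \<rho>(2) by blast
  let ?l = "\<lambda>t. h (circ x \<rho> t)"
  have pl: "path ?l" unfolding path_def
    by (rule continuous_on_compose2[OF hc]) (use path_circ cD in \<open>auto simp: path_def\<close>)
  have cl: "pathfinish ?l = pathstart ?l" using circ_closed[of x \<rho>] by (simp add: pathfinish_def pathstart_def)
  have comp: "compact (h ` cball x \<rho>)"
    by (intro compact_continuous_image continuous_on_subset[OF hc] \<rho>(2)) auto
  have "h ` cball x \<rho> \<subseteq> Dsk" using him \<rho>(2) by blast
  then obtain R where R: "0 < R" "R < 1" "h ` cball x \<rho> \<subseteq> ball 0 R"
    using compact_subset_ball_shrink[OF comp, of 1] by auto
  have pim: "path_image ?l \<subseteq> h ` cball x \<rho>" using cm by (auto simp: path_image_def)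
  have w: "winding_number ?l b = 0" if "b \<notin> h ` cball x \<rho>" for b
  proof -
    have "winding_number (\<lambda>t. h (circ x \<rho> t) - b) 0 = 0"
    proof (rule winding_number_nonvanishing[where S="cball x \<rho>" and f="\<lambda>y. h y - b" and l="circ x \<rho>"])
      show "continuous_on (cball x \<rho>) (\<lambda>y. h y - b)"
        by (intro continuous_intros continuous_on_subset[OF hc \<rho>(2)])
      show "path_image (circ x \<rho>) \<subseteq> cball x \<rho>" using cm by (auto simp: path_image_def)
    qed (use that in \<open>auto simp: path_circ circ_closed convex_imp_contractible\<close>)
    then show ?thesis using winding_number_offset[of ?l b] by simp
  qed
  let ?A = "{a\<in>ball 0 R. \<psi> a = \<phi> x}"
  have "x \<in> cball x \<rho>" using \<rho>(1) by simp
  then have "h x \<in> ball 0 R" using R(3) by blast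
  then have xA: "h x \<in> ?A" using eq[OF x] by simp
  have A: "a = h x" if "a \<in> ?A" "a \<in> h ` cball x \<rho>" for a
  proof -
    obtain y where y: "y \<in> cball x \<rho>" "a = h y" using \<open>a \<in> h ` cball x \<rho>\<close> by blast
    then have "\<phi> y = \<phi> x" using that(1) eq[of y] \<rho>(2) by auto
    then show ?thesis using \<rho>(3)[OF y(1)] y(2) by blast
  qed
  have nim: "\<phi> x \<notin> \<psi> ` path_image ?l"
  proof
    assume "\<phi> x \<in> \<psi> ` path_image ?l"
    then obtain t where "\<phi> x = \<psi> (?l t)" by (auto simp: path_image_def)
    then show False using eq[OF cD[of t]] \<rho>(3)[OF cm(1)[of t] cm(2)[of t]] by simp
  qed
  have RD: "cball 0 R \<subseteq> Dsk" using R by auto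
  have "winding_number (\<lambda>t. \<psi> (?l t)) (\<phi> x) = (\<Sum>a\<in>?A. winding_number ?l a)"
    using R pim by (intro argument_principle[OF pointed_lh_local_imm[OF \<psi>] \<psi>o RD pl _ cl nim]) auto
  also have "\<dots> = (\<Sum>a\<in>{h x}. winding_number ?l a)"
  proof (rule sum.mono_neutral_right)
    have "finite {a\<in>cball 0 R. \<psi> a = \<phi> x}"
      using finite_preimage[OF pointed_lh_local_imm[OF \<psi>] _ RD] by simp
    then show "finite ?A" by (rule rev_finite_subset) auto
    show "{h x} \<subseteq> ?A" using xA by blast
    show "\<forall>a\<in>?A - {h x}. winding_number ?l a = 0" using A w by blast
  qed
  also have "\<dots> = winding_number ?l (h x)" by simp
  finally have "winding_number ?l (h x) = winding_number (\<lambda>t. \<psi> (?l t)) (\<phi> x)" by (rule sym)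
  also have "\<dots> = winding_number (\<lambda>t. \<psi> (?l t) - \<phi> x) 0" by (rule winding_number_offset)
  also have "(\<lambda>t. \<psi> (?l t) - \<phi> x) = (\<lambda>t. \<phi> (circ x \<rho> t) - \<phi> x)" using eq[OF cD] by simp
  also have "winding_number \<dots> 0 = 1" by (rule \<rho>(4))
  finally have w1: "winding_number ?l (h x) = 1" .
  have "h x \<notin> path_image ?l"
  proof
    assume "h x \<in> path_image ?l"
    then obtain t where "h x = ?l t" by (auto simp: path_image_def)
    then show False using inj_onD[OF hinj _ x cD[of t]] cm(2)[of t] by auto
  qed
  then obtain q where q: "path q" "pathfinish q - pathstart q = 2 * of_real pi * \<i> * winding_number ?l (h x)"
    "\<And>t. t \<in> {0..1} \<Longrightarrow> ?l t = h x + exp (q t)"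
    using winding_number_as_continuous_log[OF pl] by blast
  show "\<exists>r>0. cball x r \<subseteq> Dsk \<and> inj_on h (cball x r) \<and>
      (\<exists>\<theta>. continuous_on {0..1} \<theta> \<and>
           (\<forall>t\<in>{0..1::real}. exp (\<theta> t) = h (x + of_real r * cis (2 * pi * t)) - h x) \<and>
           \<theta> 1 = \<theta> 0 + 2 * of_real pi * \<i>)"
  proof (intro exI[of _ \<rho>] conjI exI[of _ q] ballI)
    show "exp (q t) = h (x + of_real \<rho> * cis (2 * pi * t)) - h x" if "t \<in> {0..1}" for t
      using q(3)[OF that] by (simp add: circ_def)
    show "q 1 = q 0 + 2 * of_real pi * \<i>" using q(2) w1 by (simp add: pathfinish_def pathstart_def algebra_simps)
    show "inj_on h (cball x \<rho>)" using inj_on_subset[OF hinj \<rho>(2)] .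
    show "continuous_on {0..1} q" using q(1) by (simp add: path_def)
    show "\<rho> > 0" "cball x \<rho> \<subseteq> Dsk" using \<rho>(1,2) .
  qed
qed

section \<open>Propagation of disks into an enclosed region\<close>

text \<open>The complement of \<open>W\<close> inside a large disk is covered by finitely many small disks missing \<open>H\<close>;
  joining these to infinity by paths missing \<open>H\<close> gives a connected set to be removed from the plane.\<close>
lemma simply_connected_nbhd:
  fixes H W :: "complex set"
  assumes H: "compact H" "connected H" "H \<noteq> {}" "connected (- H)" and W: "open W" "H \<subseteq> W"
  obtains U where "open U" "H \<subseteq> U" "U \<subseteq> W" "connected U" "U homeomorphic ball (0::complex) 1"
proof -
  obtain R where R: "R > 0" "H \<subseteq> ball 0 R" using bounded_subset_ballD[OF compact_imp_bounded[OF H(1)]] by blast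
  define T where "T = cball 0 R - W"
  have T: "compact T" unfolding T_def using W(1) by (intro compact_diff) auto
  have oH: "open (- H)" using H(1) compact_imp_closed by blast
  have "\<exists>e>0. cball p e \<subseteq> - H" if "p \<in> T" for p
    using that W(2) oH open_contains_cball[of "-H"] by (auto simp: T_def)
  then obtain e where e: "\<And>p. p \<in> T \<Longrightarrow> e p > 0" "\<And>p. p \<in> T \<Longrightarrow> cball p (e p) \<subseteq> - H" by metis
  have "T \<subseteq> (\<Union>p\<in>T. ball p (e p))" using e(1) by force
  then obtain F where F: "F \<subseteq> T" "finite F" "T \<subseteq> (\<Union>p\<in>F. ball p (e p))"
    using compactE_image[OF T, of T "\<lambda>p. ball p (e p)"] by auto
  define q0 where "q0 = complex_of_real R"
  have q0: "q0 \<in> - ball 0 R" "q0 \<in> - H" using R by (auto simp: q0_def)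
  have pc: "path_connected (- H)" using connected_open_path_connected[OF oH H(4)] .
  have "\<exists>\<gamma>. path \<gamma> \<and> path_image \<gamma> \<subseteq> - H \<and> pathstart \<gamma> = p \<and> pathfinish \<gamma> = q0" if "p \<in> F" for p
    using pc that F(1) W(2) q0 by (auto simp: path_connected_def T_def)
  then obtain \<gamma> where \<gamma>: "\<And>p. p \<in> F \<Longrightarrow> path (\<gamma> p)" "\<And>p. p \<in> F \<Longrightarrow> path_image (\<gamma> p) \<subseteq> - H"
    "\<And>p. p \<in> F \<Longrightarrow> pathstart (\<gamma> p) = p" "\<And>p. p \<in> F \<Longrightarrow> pathfinish (\<gamma> p) = q0" by metis
  define A where "A p = (cball p (e p) \<union> path_image (\<gamma> p)) \<union> (- ball 0 R)" for p
  define L where "L = (\<Union>p\<in>F. A p) \<union> (- ball 0 R)"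
  have cb: "connected (- ball (0::complex) R)" by (rule connected_complement_bounded_convex) auto
  have A: "connected (A p)" "q0 \<in> A p" "closed (A p)" "A p \<inter> H = {}" if p: "p \<in> F" for p
  proof -
    have pT: "p \<in> T" using p F by auto
    have "p \<in> cball p (e p) \<inter> path_image (\<gamma> p)" using e(1)[OF pT] \<gamma>(3)[OF p] pathstart_in_path_image[of "\<gamma> p"] by simp
    then have "cball p (e p) \<inter> path_image (\<gamma> p) \<noteq> {}" by blast
    then have "connected (cball p (e p) \<union> path_image (\<gamma> p))"
      by (intro connected_Un connected_path_image \<gamma>(1) p) auto
    moreover have "q0 \<in> path_image (\<gamma> p)" using \<gamma>(4)[OF p] pathfinish_in_path_image by metis
    ultimately show "connected (A p)" unfolding A_def using q0 cb by (intro connected_Un[of "_ \<union> _"]) auto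
    show "q0 \<in> A p" using q0 by (simp add: A_def)
    show "closed (A p)" unfolding A_def using \<gamma>(1)[OF p] by (intro closed_Un) (auto simp: closed_path_image)
    show "A p \<inter> H = {}" unfolding A_def using e(2)[OF pT] \<gamma>(2)[OF p] R(2) by auto
  qed
  have cL: "connected L"
  proof -
    have "connected (\<Union>(insert (- ball 0 R) (A ` F)))"
      by (rule connected_Union) (use cb A q0 in auto)
    then show ?thesis by (simp add: L_def Un_commute)
  qed
  have clL: "closed L" unfolding L_def using F(2) A(3) by (intro closed_Un closed_UN) auto
  have HL: "H \<subseteq> - L" using A(4) R(2) by (auto simp: L_def)
  have LW: "- L \<subseteq> W"
  proof
    fix x assume x: "x \<in> - L"
    then have "x \<in> ball 0 R" "\<And>p. p \<in> F \<Longrightarrow> x \<notin> A p" by (auto simp: L_def)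
    then have "x \<notin> T" using F(3) by (fastforce simp: A_def)
    then show "x \<in> W" using \<open>x \<in> ball 0 R\<close> by (auto simp: T_def)
  qed
  obtain h0 where h0: "h0 \<in> H" using H(3) by blast
  \<comment> \<open>A component of the complement of a connected set has connected complement. Being
    bounded and open, \<open>U\<close> is then simply connected, hence a disk.\<close>
  define U where "U = connected_component_set (- L) h0"
  have UL: "U \<subseteq> - L" unfolding U_def by (rule connected_component_subset)
  have HU: "H \<subseteq> U" unfolding U_def by (rule connected_component_maximal[OF h0 H(2) HL])
  have oU: "open U" unfolding U_def using clL by (intro open_connected_component) auto
  have "U \<in> components (- L)" unfolding U_def using h0 HL by (intro componentsI) auto
  then have cU: "connected (- U)" using component_complement_connected[OF cL] by blast
  have "bounded U" by (rule bounded_subset[of "ball 0 R"]) (use UL in \<open>auto simp: L_def\<close>)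
  then have "inside U = {}" using inside_bounded_complement_connected_empty cU by blast
  moreover have conU: "connected U" unfolding U_def by simp
  ultimately have "simply_connected U" using simply_connected_eq_empty_inside[OF oU] by simp
  then have "U homeomorphic ball (0::complex) 1"
    using simply_connected_eq_homeomorphic_to_disc[OF oU] HU h0 by blast
  then show ?thesis using that oU HU UL LW conU by blast
qed

text \<open>An open set in the image of a small piece of \<open>K\<close> would pull back, within a
  ball of injectivity, to an open subset of \<open>K\<close>; finitely many closed pieces without
  interior have a union without interior. This allows the points of a net to be placed off a
  developed curve.\<close>

lemma interior_image_local_imm:
  assumes f: "local_imm S f" and K: "compact K" "K \<subseteq> S" "interior K = {}"
  shows "interior (f ` K) = {}"
proof -
  have cf: "continuous_on S f" using f by (simp add: local_imm_def)
  have "\<exists>e>0. ball x e \<subseteq> S \<and> inj_on f (ball x e)" if "x \<in> K" for x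
    using f K(2) that by (auto simp: local_imm_def)
  then obtain e where e: "\<And>x. x \<in> K \<Longrightarrow> e x > 0" "\<And>x. x \<in> K \<Longrightarrow> ball x (e x) \<subseteq> S"
    "\<And>x. x \<in> K \<Longrightarrow> inj_on f (ball x (e x))" by metis
  have "K \<subseteq> (\<Union>x\<in>K. ball x (e x / 2))" using e(1) by force
  then obtain F where F: "F \<subseteq> K" "finite F" "K \<subseteq> (\<Union>x\<in>F. ball x (e x / 2))"
    using compactE_image[OF K(1), of K "\<lambda>x. ball x (e x / 2)"] by auto
  define P where "P x = f ` (K \<inter> cball x (e x / 2))" for x
  have cP: "closed (P x)" for x unfolding P_def
    by (intro compact_imp_closed compact_continuous_image continuous_on_subset[OF cf] compact_Int_closed K(1)) (use K in auto)
  have iP: "interior (P x) = {}" if x: "x \<in> K" for x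
  proof (rule ccontr)
    assume ne: "interior (P x) \<noteq> {}"
    let ?V = "ball x (e x) \<inter> f -` interior (P x)"
    have "open ?V"
      by (rule continuous_open_preimage[OF continuous_on_subset[OF cf e(2)[OF x]]]) auto
    moreover have "?V \<subseteq> K"
    proof
      fix v assume v: "v \<in> ?V"
      then have "f v \<in> P x" using interior_subset by blast
      then obtain k where k: "k \<in> K" "k \<in> cball x (e x / 2)" "f v = f k" by (auto simp: P_def)
      then have "k \<in> ball x (e x)" using e(1)[OF x] by auto
      then show "v \<in> K" using inj_onD[OF e(3)[OF x] k(3)] v k(1) by auto
    qed
    moreover have "?V \<noteq> {}"
    proof -
      obtain w where w: "w \<in> interior (P x)" using ne by blast
      then have "w \<in> P x" using interior_subset by blast
      then obtain k where "k \<in> cball x (e x / 2)" "w = f k" by (auto simp: P_def)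
      then have "k \<in> ?V" using w e(1)[OF x] by auto
      then show ?thesis by blast
    qed
    ultimately show False using K(3) interior_maximal by blast
  qed
  have "finite G \<Longrightarrow> G \<subseteq> K \<Longrightarrow> closed (\<Union>x\<in>G. P x) \<and> interior (\<Union>x\<in>G. P x) = {}" for G
  proof (induction G rule: finite_induct)
    case (insert x G)
    then show ?case using interior_closed_Un_empty_interior[of "P x" "\<Union>x\<in>G. P x"] cP iP by (simp add: closed_Un)
  qed auto
  then have "interior (\<Union>x\<in>F. P x) = {}" using F by blast
  moreover have "f ` K \<subseteq> (\<Union>x\<in>F. P x)"
  proof
    fix w assume "w \<in> f ` K"
    then obtain k where k: "k \<in> K" "w = f k" by blast
    then obtain x where "x \<in> F" "k \<in> ball x (e x / 2)" using F(3) by auto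
    then show "w \<in> (\<Union>x\<in>F. P x)" using k unfolding P_def by fastforce
  qed
  ultimately show ?thesis using interior_mono by blast
qed

text \<open>The lift is cut at \<open>v\<close> and continued by the section at \<open>p v\<close>.
  The point \<open>v\<close> may lie well before \<open>u\<close>, which permits going back to a
  place where a large disk is known.\<close>

lemma segment_lift_extend:
  fixes z0 w :: complex
  defines "c \<equiv> \<lambda>t. z0 + of_real t * (w - z0)"
  assumes p: "continuous_on {0..u} p" "p \<in> {0..u} \<rightarrow> S" "p 0 = d" "\<And>t. t \<in> {0..u} \<Longrightarrow> f (p t) = c t"
    and v: "0 \<le> v" "v \<le> u" "thick S f (p v) r" and b: "v \<le> b" "(b - v) * cmod (w - z0) < r"
  shows "\<exists>p. continuous_on {0..b} p \<and> p \<in> {0..b} \<rightarrow> S \<and> p 0 = d \<and> (\<forall>t\<in>{0..b}. f (p t) = c t)"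
proof -
  obtain g where g: "is_sec S f (p v) r g" using v by (auto simp: thick_def)
  have fv: "f (p v) = c v" using p(4) v by simp
  have cb: "c t \<in> ball (f (p v)) r" if "t \<in> {v..b}" for t
  proof -
    have "dist (c v) (c t) = cmod (of_real (t - v) * (w - z0))"
      by (simp add: c_def dist_norm algebra_simps norm_minus_commute)
    also have "\<dots> = (t - v) * cmod (w - z0)" using that by (simp only: norm_mult norm_of_real) auto
    also have "\<dots> \<le> (b - v) * cmod (w - z0)" using that by (intro mult_right_mono) auto
    finally show ?thesis using b(2) fv by simp
  qed
  have cc: "continuous_on X c" for X unfolding c_def by (intro continuous_intros)
  let ?q = "\<lambda>t. if t \<le> v then p t else g (c t)"
  have "continuous_on ({0..v} \<union> {v..b}) ?q"
  proof (rule continuous_on_If)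
    show "continuous_on {0..v} p" using p(1) v by (auto intro: continuous_on_subset)
    show "continuous_on {v..b} (\<lambda>t. g (c t))"
      by (rule continuous_on_compose2[OF _ cc]) (use g cb in \<open>auto simp: is_sec_def\<close>)
    show "p t = g (c t)" if "t \<in> {v..b}" "t \<le> v" for t
      using that g fv by (auto simp: is_sec_def)
    show "p t = g (c t)" if "t \<in> {0..v}" "\<not> t \<le> v" for t using that by simp
  qed auto
  moreover have "{0..v} \<union> {v..b} = {0..b}" using v b by auto
  moreover have "?q \<in> {0..b} \<rightarrow> S" using p(2) g cb v unfolding is_sec_def by (auto simp: Pi_iff)
  moreover have "f (?q t) = c t" if "t \<in> {0..b}" for t
    using that p(4)[of t] g cb[of t] v by (auto simp: is_sec_def)
  moreover have "?q 0 = d" using p(3) v by simp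
  ultimately show ?thesis by (intro exI[of _ ?q]) auto
qed

text \<open>The endpoints of the lifted radii define the section. For continuity at \<open>w\<close>
  the lift of the whole radius to \<open>w\<close> is perturbed to all nearby radii at once, and
  uniqueness identifies the result with the lifts chosen there.\<close>

lemma thick_from_segments:
  assumes f: "local_imm S f" and d: "d \<in> S" and r: "r > 0"
    and seg: "\<And>w. w \<in> ball (f d) r \<Longrightarrow> \<exists>p. continuous_on {0..1} p \<and> p \<in> {0..1} \<rightarrow> S \<and> p 0 = d \<and>
       (\<forall>t\<in>{0..1::real}. f (p t) = f d + of_real t * (w - f d))"
  shows "thick S f d r"
proof -
  let ?B = "ball (f d) r"
  obtain P where P: "\<And>w. w \<in> ?B \<Longrightarrow> continuous_on {0..1} (P w)" "\<And>w. w \<in> ?B \<Longrightarrow> P w \<in> {0..1} \<rightarrow> S"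
    "\<And>w. w \<in> ?B \<Longrightarrow> P w 0 = d" "\<And>w t. w \<in> ?B \<Longrightarrow> t \<in> {0..1::real} \<Longrightarrow> f (P w t) = f d + of_real t * (w - f d)"
    using seg by metis
  have P1: "P w 1 \<in> S \<and> f (P w 1) = w" if "w \<in> ?B" for w
    using P(2)[OF that] P(4)[OF that, of 1] by auto
  have "isCont (\<lambda>w. P w 1) w" if w: "w \<in> ?B" for w
  proof -
    have "compact (P w ` {0..1})" using P(1)[OF w] by (intro compact_continuous_image) auto
    moreover have "P w ` {0..1} \<subseteq> S" using P(2)[OF w] by auto
    ultimately obtain s where s: "s > 0" "\<And>x. x \<in> P w ` {0..1} \<Longrightarrow> thick S f x s"
      using compact_thick[OF f] by blast
    let ?X = "{0..1::real} \<times> (ball w s \<inter> ?B)"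
    let ?u = "\<lambda>(t, w'). f d + of_real t * (w' - f d)"
    obtain q where q: "continuous_on ?X q" "q \<in> ?X \<rightarrow> S" "\<And>x. x \<in> ?X \<Longrightarrow> f (q x) = ?u x"
      "\<And>x. x \<in> ?X \<Longrightarrow> ?u x = f (P w (fst x)) \<Longrightarrow> q x = P w (fst x)"
    proof (rule lift_perturb[OF f, of ?X "\<lambda>x. P w (fst x)" s ?u])
      show "continuous_on ?X (\<lambda>x. P w (fst x))"
        by (rule continuous_on_compose2[OF P(1)[OF w]]) (auto intro!: continuous_intros)
      show "(\<lambda>x. P w (fst x)) \<in> ?X \<rightarrow> S" using P(2)[OF w] by auto
      show "continuous_on ?X ?u" unfolding case_prod_unfold by (intro continuous_intros)
      fix x assume x: "x \<in> ?X"
      then show "thick S f (P w (fst x)) s" using s(2) by auto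
      obtain t w' where tw: "x = (t, w')" "t \<in> {0..1}" "dist w w' < s" using x by auto
      have "f (P w t) - (f d + of_real t * (w' - f d)) = of_real t * (w - w')"
        using P(4)[OF w tw(2)] by (simp add: algebra_simps)
      then have "dist (f (P w t)) (?u x) = t * dist w w'" using tw(1,2) by (simp add: dist_norm norm_mult)
      also have "\<dots> \<le> 1 * dist w w'" using tw(2) by (intro mult_right_mono) auto
      finally show "dist (f (P w (fst x))) (?u x) < s" using tw by simp
    qed blast
    have eq: "q (1, w') = P w' 1" if w': "w' \<in> ball w s \<inter> ?B" for w'
    proof (rule lift_unique[OF f, where X="{0..1::real}" and p="\<lambda>t. q (t, w')" and q="P w'" and x=1 and ?x0.0=0])
      show "continuous_on {0..1} (\<lambda>t. q (t, w'))"
        by (rule continuous_on_compose2[OF q(1)]) (use w' in \<open>auto intro!: continuous_intros\<close>)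
      show "(\<lambda>t. q (t, w')) \<in> {0..1} \<rightarrow> S" using q(2) w' by auto
      show "f (q (t, w')) = f (P w' t)" if "t \<in> {0..1}" for t
        using q(3)[of "(t, w')"] P(4)[of w' t] w' that by auto
      show "q (0, w') = P w' 0" using q(4)[of "(0, w')"] P(3) w w' by auto
      show "continuous_on {0..1} (P w')" "P w' \<in> {0..1} \<rightarrow> S" using P w' by auto
    qed auto
    have "continuous_on (ball w s \<inter> ?B) (\<lambda>w'. q (1, w'))"
      by (rule continuous_on_compose2[OF q(1)]) (auto intro!: continuous_intros)
    then have "continuous_on (ball w s \<inter> ?B) (\<lambda>w'. P w' 1)" by (rule continuous_on_eq) (rule eq)
    moreover have "open (ball w s \<inter> ?B)" by auto
    ultimately show ?thesis using w s(1) by (simp add: continuous_on_eq_continuous_at)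
  qed
  then have c: "continuous_on ?B (\<lambda>w. P w 1)" by (simp add: continuous_on_eq_continuous_at)
  have "P (f d) 1 = d"
  proof (rule lift_unique[OF f, where X="{0..1::real}" and p="P (f d)" and q="\<lambda>_. d" and x=1 and ?x0.0=0])
    show "f (P (f d) t) = f d" if "t \<in> {0..1}" for t using P(4)[of "f d" t] r that by simp
  qed (use P[of "f d"] r d in auto)
  then have "is_sec S f d r (\<lambda>w. P w 1)" unfolding is_sec_def using c P1 by auto
  then show ?thesis by (auto simp: thick_def)
qed

text \<open>A segment starting in \<open>D\<close> either stays in \<open>D\<close>, where it can be lifted by steps of a fixed length,
  or reaches the frontier, where a whole disk is available.\<close>
lemma thick_from_frontier:
  assumes f: "local_imm S f" and D: "compact D" "D \<subseteq> S"
    and fr: "\<And>x. x \<in> frontier D \<Longrightarrow> thick S f x \<epsilon>" and e: "\<epsilon> > 0" and d: "d \<in> D"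
  shows "thick S f d \<epsilon>"
proof (rule thick_from_segments[OF f _ e])
  show "d \<in> S" using d D by auto
  fix w assume w: "w \<in> ball (f d) \<epsilon>"
  obtain r where r: "r > 0" "\<And>x. x \<in> D \<Longrightarrow> thick S f x r" using compact_thick[OF f D] by blast
  define c where "c t = f d + of_real t * (w - f d)" for t :: real
  define T where "T u \<longleftrightarrow> (\<exists>p. continuous_on {0..u} p \<and> p \<in> {0..u} \<rightarrow> S \<and> p 0 = d \<and> (\<forall>t\<in>{0..u}. f (p t) = c t))" for u
  have wn: "cmod (w - f d) < \<epsilon>" using w by (simp add: dist_norm norm_minus_commute)
  \<comment> \<open>The segment is shorter than \<open>\<epsilon>\<close>, so a step of parameter
    length \<open>s\<close> covers less than \<open>r / 2\<close>, within the uniform radius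
    \<open>r\<close>.\<close>
  define s where "s = r / (2 * \<epsilon>)"
  have s: "s > 0" using r e by (simp add: s_def)
  have step: "T 1 \<or> T (min 1 (u + s))" if u: "0 \<le> u" "u \<le> 1" "T u" for u
  proof -
    obtain p where p: "continuous_on {0..u} p" "p \<in> {0..u} \<rightarrow> S" "p 0 = d" "\<And>t. t \<in> {0..u} \<Longrightarrow> f (p t) = c t"
      using u(3) unfolding T_def by blast
    show ?thesis
    proof (cases "\<exists>v\<in>{0..u}. p v \<in> frontier D")
      case True
      then obtain v where v: "0 \<le> v" "v \<le> u" "thick S f (p v) \<epsilon>" using fr by auto
      have "(1 - v) * cmod (w - f d) \<le> 1 * cmod (w - f d)" using v by (intro mult_right_mono) auto
      then have "T 1" unfolding T_def c_def
        using segment_lift_extend[OF p(1-3) p(4)[unfolded c_def] v, of 1] v u wn by auto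
      then show ?thesis by blast
    next
      case False
      have "p ` {0..u} \<inter> - D = {}"
      proof (rule ccontr)
        assume "p ` {0..u} \<inter> - D \<noteq> {}"
        moreover have "d \<in> p ` {0..u} \<inter> D" using p(3) u d by force
        moreover have "connected (p ` {0..u})" using p(1) by (intro connected_continuous_image) auto
        ultimately have "p ` {0..u} \<inter> frontier D \<noteq> {}" by (intro connected_Int_frontier) auto
        then show False using False by auto
      qed
      moreover have "p u \<in> p ` {0..u}" using u by auto
      ultimately have "p u \<in> D" by blast
      then have v: "0 \<le> u" "u \<le> u" "thick S f (p u) r" using r u by auto
      have "(min 1 (u + s) - u) * cmod (w - f d) \<le> s * cmod (w - f d)" by (intro mult_right_mono) auto
      also have "\<dots> \<le> s * \<epsilon>" using wn s by (intro mult_left_mono) auto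
      also have "\<dots> < r" using r e by (simp add: s_def)
      finally have "T (min 1 (u + s))" unfolding T_def c_def
        using segment_lift_extend[OF p(1-3) p(4)[unfolded c_def] v, of "min 1 (u + s)"] u s by auto
      then show ?thesis by blast
    qed
  qed
  have "T 1 \<or> T (min 1 (real n * s))" for n
  proof (induction n)
    case 0
    have "T 0" unfolding T_def using d D by (intro exI[of _ "\<lambda>_. d"]) (auto simp: c_def)
    then show ?case by simp
  next
    case (Suc n)
    show ?case
    proof (cases "T 1")
      case False
      then have "T (min 1 (real n * s))" using Suc by blast
      then have "T (min 1 (min 1 (real n * s) + s))" using step[of "min 1 (real n * s)"] False s by auto
      moreover have "min 1 (min 1 (real n * s) + s) = min 1 (real (Suc n) * s)" using s by (auto simp: algebra_simps min_def)
      ultimately show ?thesis by simp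
    qed simp
  qed
  moreover obtain n where "real n * s > 1" using s reals_Archimedean3 by blast
  then have "min 1 (real n * s) = 1" by simp
  ultimately have "T 1" by metis
  then show "\<exists>p. continuous_on {0..1} p \<and> p \<in> {0..1} \<rightarrow> S \<and> p 0 = d \<and>
       (\<forall>t\<in>{0..1::real}. f (p t) = f d + of_real t * (w - f d))"
    unfolding T_def c_def .
qed

text \<open>A Jordan curve winds about all enclosed points once and with the same sign. The sign is
  not known, so the count is the modulus of the winding number of the image curve.\<close>

lemma card_preimages_inside:
  assumes \<psi>: "pointed_lh \<psi>" and l: "simple_path l" "pathfinish l = pathstart l" "path_image l \<subseteq> Dsk"
    and z: "z \<notin> \<psi> ` path_image l"
  shows "finite {a \<in> inside (path_image l). \<psi> a = z}"
    and "real (card {a \<in> inside (path_image l). \<psi> a = z}) = cmod (winding_number (\<lambda>t. \<psi> (l t)) z)"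
proof -
  have pl: "path l" using l(1) by (simp add: simple_path_def)
  obtain R where R: "0 < R" "R < 1" "path_image l \<subseteq> ball 0 R"
    using compact_subset_ball_shrink[OF compact_path_image[OF pl] l(3)] by auto
  have inR: "inside (path_image l) \<subseteq> ball 0 R"
  proof -
    have "- ball 0 R \<subseteq> outside (path_image l)" using outside_subset_convex[OF _ R(3)] by simp
    then show ?thesis using inside_Un_outside[of "path_image l"] inside_Int_outside[of "path_image l"] by blast
  qed
  have RD: "cball 0 R \<subseteq> Dsk" using R by auto
  let ?A = "{a\<in>ball 0 R. \<psi> a = z}" and ?I = "{a \<in> inside (path_image l). \<psi> a = z}"
  have "finite {a\<in>cball 0 R. \<psi> a = z}" using finite_preimage[OF pointed_lh_local_imm[OF \<psi>] _ RD] by simp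
  then have fA: "finite ?A" by (rule rev_finite_subset) auto
  have IA: "?I \<subseteq> ?A" using inR by blast
  then show "finite ?I" using fA finite_subset by blast
  have "winding_number (\<lambda>t. \<psi> (l t)) z = (\<Sum>a\<in>?A. winding_number l a)"
    using \<psi> R by (intro argument_principle[OF pointed_lh_local_imm[OF \<psi>] _ RD pl _ l(2) z]) (auto simp: pointed_lh_def)
  also have "\<dots> = (\<Sum>a\<in>?I. winding_number l a)"
  proof (rule sum.mono_neutral_right[OF fA IA], rule ballI)
    fix a assume a: "a \<in> ?A - ?I"
    then have "a \<notin> path_image l" using z by auto
    then have "a \<in> outside (path_image l)" using a inside_Un_outside[of "path_image l"] by blast
    then show "winding_number l a = 0" using winding_number_zero_in_outside[OF pl l(2)] by blast
  qed
  finally have s: "winding_number (\<lambda>t. \<psi> (l t)) z = (\<Sum>a\<in>?I. winding_number l a)" .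
  show "real (card ?I) = cmod (winding_number (\<lambda>t. \<psi> (l t)) z)"
  proof (rule simple_closed_path_winding_number_inside[OF l(1)])
    assume "\<And>z. z \<in> inside (path_image l) \<Longrightarrow> winding_number l z = 1"
    then have "(\<Sum>a\<in>?I. winding_number l a) = (\<Sum>a\<in>?I. 1)" by (intro sum.cong) auto
    then show ?thesis using s by simp
  next
    assume "\<And>z. z \<in> inside (path_image l) \<Longrightarrow> winding_number l z = -1"
    then have "(\<Sum>a\<in>?I. winding_number l a) = (\<Sum>a\<in>?I. -1)" by (intro sum.cong) auto
    then show ?thesis using s by simp
  qed
qed

text \<open>A maximum principle: around an interior point of \<open>D\<close> the image contains a
  whole disk, hence values of larger modulus.\<close>

lemma norm_bound_from_frontier:
  assumes f: "local_imm S f" and D: "compact D" "D \<subseteq> S"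
    and M: "\<And>x. x \<in> frontier D \<Longrightarrow> cmod (f x) \<le> M" and d: "d \<in> D"
  shows "cmod (f d) \<le> M"
proof -
  have cf: "continuous_on D f" using f D by (auto simp: local_imm_def intro: continuous_on_subset)
  obtain c where c: "c \<in> D" "\<And>y. y \<in> D \<Longrightarrow> cmod (f y) \<le> cmod (f c)"
    using continuous_attains_sup[OF D(1), of "\<lambda>x. cmod (f x)"] d cf by (auto intro: continuous_on_norm)
  have "c \<in> frontier D"
  proof (rule ccontr)
    assume "c \<notin> frontier D"
    then have ci: "c \<in> interior D" using c(1) closure_subset by (auto simp: frontier_def)
    have "local_imm (interior D) f"
      using local_imm_subset[OF f] D(2) interior_subset by (metis open_interior order_trans)
    then obtain r where r: "r > 0" "thick (interior D) f c r" using local_thick ci by blast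
    then obtain g where g: "is_sec (interior D) f c r g" by (auto simp: thick_def)
    \<comment> \<open>The outward direction at \<open>f c\<close>; at the origin every direction is
      outward and 1 is taken.\<close>
    define u where "u = (if f c = 0 then 1 else sgn (f c))"
    define w where "w = f c + of_real (r/2) * u"
    have nu: "cmod u = 1" by (simp add: u_def norm_sgn)
    have "cmod (of_real (r/2) * u) = r/2" unfolding norm_mult nu norm_of_real using r(1) by simp
    then have wb: "w \<in> ball (f c) r" using r(1) by (simp add: w_def dist_norm)
    have "w = of_real (cmod (f c) + r/2) * u"
      by (simp add: w_def u_def sgn_eq algebra_simps)
    then have "cmod w = \<bar>cmod (f c) + r/2\<bar>" by (simp only: norm_mult nu norm_of_real mult_1_right)
    then have "cmod w = cmod (f c) + r/2" using r(1) by simp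
    moreover have "g w \<in> interior D" "f (g w) = w" using g wb by (auto simp: is_sec_def)
    then have "g w \<in> D" "f (g w) = w" using interior_subset by auto
    ultimately show False using c(2)[of "g w"] r(1) by simp
  qed
  then show ?thesis using c(2)[OF d] M[of c] by simp
qed

text \<open>Nearby points of \<open>K\<close> lie on the same sheet. The segment from
  \<open>p\<close> to \<open>p'\<close> stays in the convex set \<open>K\<close>, its image stays in
  the disk because \<open>\<eta> \<le> \<epsilon>\<close>, and it is lifted both by the identity and
  by \<open>g\<close> after \<open>f\<close>; so one \<open>\<delta>\<close> works for every
  section.\<close>

lemma sec_uniform:
  assumes f: "local_imm S f" and K: "compact K" "convex K" "K \<subseteq> S" and e: "0 < \<eta>" "\<eta> \<le> \<epsilon>"
  obtains \<delta> where "\<delta> > 0" "\<And>p p'. p \<in> K \<Longrightarrow> p' \<in> K \<Longrightarrow> dist p p' < \<delta> \<Longrightarrow> dist (f p) (f p') < \<eta>"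
    "\<And>p p' g. p \<in> K \<Longrightarrow> p' \<in> K \<Longrightarrow> dist p p' < \<delta> \<Longrightarrow> is_sec S f p \<epsilon> g \<Longrightarrow> g (f p') = p'"
proof -
  have cf: "continuous_on K f" using f K by (auto simp: local_imm_def intro: continuous_on_subset)
  obtain \<delta> where \<delta>: "\<delta> > 0" "\<And>p p'. p \<in> K \<Longrightarrow> p' \<in> K \<Longrightarrow> dist p' p < \<delta> \<Longrightarrow> dist (f p') (f p) < \<eta>"
    using compact_uniformly_continuous[OF cf K(1)] e(1) unfolding uniformly_continuous_on_def by metis
  show ?thesis
  proof (rule that[OF \<delta>(1)])
    show "dist (f p) (f p') < \<eta>" if "p \<in> K" "p' \<in> K" "dist p p' < \<delta>" for p p' using \<delta>(2) that by blast
    fix p p' g assume pp: "p \<in> K" "p' \<in> K" "dist p p' < \<delta>" and g: "is_sec S f p \<epsilon> g"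
    let ?X = "closed_segment p p'"
    have XK: "?X \<subseteq> K" using closed_segment_subset K(2) pp by blast
    have fX: "f q \<in> ball (f p) \<epsilon>" if "q \<in> ?X" for q
    proof -
      have "dist p q < \<delta>" using that pp(3) by (meson dist_in_closed_segment le_less_trans dist_commute_lessI dist_commute)
      then show ?thesis using \<delta>(2)[of q p] XK that pp e by force
    qed
    show "g (f p') = p'"
    proof (rule lift_unique[OF f, where X="?X" and p="\<lambda>q. g (f q)" and q="\<lambda>q. q" and x=p' and ?x0.0=p])
      show "continuous_on ?X (\<lambda>q. g (f q))"
        by (rule continuous_on_compose2[of "ball (f p) \<epsilon>" g])
          (use g fX continuous_on_subset[OF cf XK] in \<open>auto simp: is_sec_def\<close>)
      show "(\<lambda>q. g (f q)) \<in> ?X \<rightarrow> S" "g (f p) = p" using g fX by (auto simp: is_sec_def)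
      show "f (g (f q)) = f q" if "q \<in> ?X" for q using g fX[OF that] by (auto simp: is_sec_def)
      show "(\<lambda>q. q) \<in> ?X \<rightarrow> S" using XK K(3) by auto
    qed auto
  qed
qed

lemma sec_immersion:
  assumes i: "immersion \<phi> T \<psi> \<iota>" and p: "p \<in> T" and g: "is_sec T \<phi> p r g"
  shows "is_sec Dsk \<psi> (\<iota> p) r (\<lambda>w. \<iota> (g w))"
proof -
  have e: "\<psi> (\<iota> p) = \<phi> p" using i p by (simp add: immersion_def)
  have "continuous_on (ball (\<phi> p) r) (\<lambda>w. \<iota> (g w))"
    by (rule continuous_on_compose2[of T \<iota>]) (use i g in \<open>auto simp: immersion_def is_sec_def\<close>)
  moreover have "\<iota> (g w) \<in> Dsk \<and> \<psi> (\<iota> (g w)) = w" if "w \<in> ball (\<phi> p) r" for w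
  proof -
    have "g w \<in> T" "\<phi> (g w) = w" using g that by (auto simp: is_sec_def)
    moreover have "\<iota> ` T \<subseteq> Dsk" "\<forall>x\<in>T. \<psi> (\<iota> x) = \<phi> x" using i by (simp_all add: immersion_def)
    ultimately show ?thesis by auto
  qed
  moreover have "g (\<phi> p) = p" using g by (simp add: is_sec_def)
  then have "\<iota> (g (\<phi> p)) = \<iota> p" by (rule arg_cong)
  ultimately show ?thesis unfolding is_sec_def e by (intro conjI ballI funcsetI) auto
qed

section \<open>Systems of round disks and their overlaps\<close>

definition charts :: "(complex \<Rightarrow> complex) \<Rightarrow> 'i set \<Rightarrow> ('i \<Rightarrow> complex) \<Rightarrow> real \<Rightarrow> ('i \<Rightarrow> complex) \<Rightarrow> ('i \<Rightarrow> complex \<Rightarrow> complex) \<Rightarrow> bool" where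
  "charts \<psi> J lab r C G \<longleftrightarrow> (\<forall>i\<in>J. C i \<in> Dsk \<and> \<psi> (C i) = lab i \<and> is_sec Dsk \<psi> (C i) r (G i))"

definition chart_img :: "('i \<Rightarrow> complex) \<Rightarrow> real \<Rightarrow> ('i \<Rightarrow> complex \<Rightarrow> complex) \<Rightarrow> 'i \<Rightarrow> complex set" where
  "chart_img lab r G i = G i ` ball (lab i) (r/2)"

text \<open>The edges of the nerve of the covering. With index set, labels and radius fixed, this
  finite relation is the only information about a surface that enters the comparison below.\<close>

definition overlaps :: "'i set \<Rightarrow> ('i \<Rightarrow> complex) \<Rightarrow> real \<Rightarrow> ('i \<Rightarrow> complex \<Rightarrow> complex) \<Rightarrow> ('i \<times> 'i) set" where
  "overlaps J lab r G = {(i, j) \<in> J \<times> J. chart_img lab r G i \<inter> chart_img lab r G j \<noteq> {}}"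

lemma open_sec_image:
  assumes g: "is_sec S f x r g" and s: "s \<le> r"
  shows "open (g ` ball (f x) s)"
proof (rule invariance_of_domain)
  show "continuous_on (ball (f x) s) g" using g s by (auto simp: is_sec_def intro: continuous_on_subset)
  show "inj_on g (ball (f x) s)"
    by (rule inj_on_inverseI[of _ f]) (use g s in \<open>auto simp: is_sec_def\<close>)
qed auto

text \<open>Two sections whose images meet agree over the whole intersection of their planar disks,
  so the charts are glued in the same way in both surfaces and the chartwise maps
  \<open>G i (\<psi>0 u)\<close> fit together. The same argument in the other direction gives
  injectivity.\<close>

lemma overlaps_embedding:
  assumes f0: "local_imm Dsk \<psi>0" and f: "local_imm Dsk \<psi>" and r: "r > 0"
    and c0: "charts \<psi>0 J lab r C0 G0" and c: "charts \<psi> J lab r C G"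
    and ov: "overlaps J lab r G0 = overlaps J lab r G"
  defines "W \<equiv> \<Union>i\<in>J. chart_img lab r G0 i"
  obtains m where "continuous_on W m" "m \<in> W \<rightarrow> Dsk" "inj_on m W" "\<forall>u\<in>W. \<psi> (m u) = \<psi>0 u"
    "\<forall>i\<in>J. m (C0 i) = C i"
proof -
  have sec0: "is_sec Dsk \<psi>0 (C0 i) r (G0 i)" "\<psi>0 (C0 i) = lab i" if "i \<in> J" for i using c0 that by (auto simp: charts_def)
  have sec: "is_sec Dsk \<psi> (C i) r (G i)" "\<psi> (C i) = lab i" if "i \<in> J" for i using c that by (auto simp: charts_def)
  have half: "w \<in> ball (lab i) r" if "w \<in> ball (lab i) (r/2)" for w i using that r by auto
  have im0: "\<psi>0 u \<in> ball (lab i) (r/2)" "G0 i (\<psi>0 u) = u" if "i \<in> J" "u \<in> chart_img lab r G0 i" for i u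
    using that sec0[OF that(1)] half unfolding chart_img_def is_sec_def by auto
  have im: "\<psi> u \<in> ball (lab i) (r/2)" "G i (\<psi> u) = u" if "i \<in> J" "u \<in> chart_img lab r G i" for i u
    using that sec[OF that(1)] half unfolding chart_img_def is_sec_def by auto
  have agree: "G i w = G j w" if iJ: "i \<in> J" and jJ: "j \<in> J" and ij: "(i,j) \<in> overlaps J lab r G" and w: "w \<in> ball (lab i) (r/2)" "w \<in> ball (lab j) (r/2)" for i j w
  proof -
    obtain v where v: "v \<in> chart_img lab r G i" "v \<in> chart_img lab r G j" using ij by (auto simp: overlaps_def)
    show ?thesis
      using sec_agree[OF f sec(1)[OF iJ] sec(1)[OF jJ], of "\<psi> v" w]
        im[OF iJ v(1)] im[OF jJ v(2)] w half sec(2)[OF iJ] sec(2)[OF jJ] by auto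
  qed
  have agree0: "G0 i w = G0 j w" if iJ: "i \<in> J" and jJ: "j \<in> J" and ij: "(i,j) \<in> overlaps J lab r G" and w: "w \<in> ball (lab i) (r/2)" "w \<in> ball (lab j) (r/2)" for i j w
  proof -
    have "(i, j) \<in> overlaps J lab r G0" using ij ov by simp
    then obtain v where v: "v \<in> chart_img lab r G0 i" "v \<in> chart_img lab r G0 j" by (auto simp: overlaps_def)
    show ?thesis
      using sec_agree[OF f0 sec0(1)[OF iJ] sec0(1)[OF jJ], of "\<psi>0 v" w]
        im0[OF iJ v(1)] im0[OF jJ v(2)] w half sec0(2)[OF iJ] sec0(2)[OF jJ] by auto
  qed
  define k where "k u = (SOME i. i \<in> J \<and> u \<in> chart_img lab r G0 i)" for u
  have k: "k u \<in> J" "u \<in> chart_img lab r G0 (k u)" if "u \<in> W" for u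
    using someI_ex[of "\<lambda>i. i \<in> J \<and> u \<in> chart_img lab r G0 i"] that by (auto simp: k_def W_def)
  define m where "m u = G (k u) (\<psi>0 u)" for u
  have m: "m u = G i (\<psi>0 u)" if i: "i \<in> J" "u \<in> chart_img lab r G0 i" for i u
  proof -
    have "u \<in> W" using i by (auto simp: W_def)
    note ku = k[OF this]
    have "(k u, i) \<in> overlaps J lab r G" unfolding ov[symmetric] using ku i by (auto simp: overlaps_def)
    then show ?thesis unfolding m_def using agree[OF ku(1) i(1)] im0(1)[OF ku] im0(1)[OF i] by blast
  qed
  have mim: "m u \<in> chart_img lab r G i" if i: "i \<in> J" "u \<in> chart_img lab r G0 i" for i u
    using m[OF i] im0(1)[OF i] by (auto simp: chart_img_def)
  have pm: "\<psi> (m u) = \<psi>0 u" if u: "u \<in> W" for u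
    using sec[OF k(1)[OF u]] half[OF im0(1)[OF k[OF u]]] unfolding m_def is_sec_def by auto
  show ?thesis
  proof (rule that)
    have c\<psi>0: "continuous_on Dsk \<psi>0" using f0 by (simp add: local_imm_def)
    have sub: "chart_img lab r G0 i \<subseteq> Dsk" if "i \<in> J" for i
      using sec0[OF that] half unfolding chart_img_def is_sec_def by auto
    show "continuous_on W m" unfolding W_def
    proof (rule continuous_on_open_UN)
      show "open (chart_img lab r G0 i)" if "i \<in> J" for i
        using open_sec_image[OF sec0(1)[OF that], of "r/2"] sec0(2)[OF that] r by (simp add: chart_img_def)
      show "continuous_on (chart_img lab r G0 i) m" if i: "i \<in> J" for i
      proof (rule continuous_on_eq)
        show "continuous_on (chart_img lab r G0 i) (\<lambda>u. G i (\<psi>0 u))"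
          by (rule continuous_on_compose2[of "ball (lab i) r"])
            (use sec[OF i] half im0(1)[OF i] continuous_on_subset[OF c\<psi>0 sub[OF i]] in \<open>auto simp: is_sec_def\<close>)
      qed (use m[OF i] in auto)
    qed
    show "m \<in> W \<rightarrow> Dsk"
      using sec k half im0(1) unfolding m_def is_sec_def by (auto simp: Pi_iff)
    show "inj_on m W"
    proof (rule inj_onI)
      fix u v assume uv: "u \<in> W" "v \<in> W" "m u = m v"
      note ku = k[OF uv(1)] and kv = k[OF uv(2)]
      have e: "\<psi>0 u = \<psi>0 v" using pm uv by metis
      have "(k u, k v) \<in> overlaps J lab r G" using mim[OF ku] mim[OF kv] uv(3) ku(1) kv(1) by (auto simp: overlaps_def)
      then have "G0 (k u) (\<psi>0 u) = G0 (k v) (\<psi>0 u)"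
        using agree0[OF ku(1) kv(1)] im0(1)[OF ku] im0(1)[OF kv] e by simp
      then show "u = v" unfolding im0(2)[OF ku] unfolding e im0(2)[OF kv] .
    qed
    show "\<forall>u\<in>W. \<psi> (m u) = \<psi>0 u" by (intro ballI pm)
    show "\<forall>i\<in>J. m (C0 i) = C i"
    proof
      fix i assume i: "i \<in> J"
      have G0i: "G0 i (\<psi>0 (C0 i)) = C0 i" using sec0(1)[OF i] unfolding is_sec_def by (elim conjE)
      have "lab i \<in> ball (lab i) (r/2)" using r by simp
      then have "G0 i (lab i) \<in> chart_img lab r G0 i" unfolding chart_img_def by (rule imageI)
      then have "C0 i \<in> chart_img lab r G0 i" by (simp only: G0i[unfolded sec0(2)[OF i]])
      then have "m (C0 i) = G i (\<psi>0 (C0 i))" by (rule m[OF i])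
      also have "\<dots> = G i (\<psi> (C i))" unfolding sec0(2)[OF i] sec(2)[OF i] by (rule refl)
      also have "\<dots> = C i" using sec(1)[OF i] unfolding is_sec_def by (elim conjE)
      finally show "m (C0 i) = C i" .
    qed
  qed
qed

text \<open>Equal images at \<open>x\<close> and at the inner point \<open>z\<close> would make the
  sheets there coincide. A point \<open>y\<close> of the open disk close to \<open>x\<close> then
  has a partner \<open>h (\<phi> y)\<close> close to \<open>z\<close>, also in the open disk, with
  the same image under \<open>\<iota>\<close>.\<close>

lemma boundary_injective:
  assumes f: "local_imm (ball 0 t1) \<phi>" and \<psi>: "local_imm Dsk \<psi>" and i: "immersion \<phi> (ball 0 t1) \<psi> \<iota>"
    and e: "\<epsilon> > 0" "thick (ball 0 t1) \<phi> x \<epsilon>" "thick (ball 0 t1) \<phi> z \<epsilon>"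
    and inj: "inj_on \<iota> (ball 0 (norm x))" and xz: "norm x < t1" "norm z < norm x"
  shows "\<iota> x \<noteq> \<iota> z"
proof
  assume eq: "\<iota> x = \<iota> z"
  let ?S = "ball (0::complex) t1"
  obtain g where g: "is_sec ?S \<phi> x \<epsilon> g" using e by (auto simp: thick_def)
  obtain h where h: "is_sec ?S \<phi> z \<epsilon> h" using e by (auto simp: thick_def)
  have xS: "x \<in> ?S" "z \<in> ?S" using xz by auto
  have \<phi>eq: "\<phi> x = \<phi> z" using i xS eq unfolding immersion_def by metis
  have \<psi>x: "\<psi> (\<iota> x) = \<phi> x" "\<psi> (\<iota> z) = \<phi> z" using i xS by (auto simp: immersion_def)
  have s1: "is_sec Dsk \<psi> (\<iota> x) \<epsilon> (\<lambda>w. \<iota> (g w))" by (rule sec_immersion[OF i xS(1) g])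
  have s2: "is_sec Dsk \<psi> (\<iota> z) \<epsilon> (\<lambda>w. \<iota> (h w))" by (rule sec_immersion[OF i xS(2) h])
  have gx: "g (\<phi> x) = x" "h (\<phi> x) = z" using g h \<phi>eq by (auto simp: is_sec_def)
  have ag: "\<iota> (g w) = \<iota> (h w)" if "w \<in> ball (\<phi> x) \<epsilon>" for w
    using sec_agree[OF \<psi> s1 s2, of "\<phi> x" w] that gx eq e(1) \<psi>x \<phi>eq by auto
  obtain d where d: "d > 0" "\<And>y. y \<in> ball x d \<Longrightarrow> y \<in> ?S \<and> \<phi> y \<in> ball (\<phi> x) \<epsilon> \<and> g (\<phi> y) = y"
    using sec_near[OF f xS(1) e(1) g] by blast
  have c\<phi>: "continuous_on ?S \<phi>" using f by (simp add: local_imm_def)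
  have ck: "continuous_on (ball x d) (\<lambda>y. h (\<phi> y))"
  proof (rule continuous_on_compose2[of "ball (\<phi> x) \<epsilon>" h])
    show "continuous_on (ball x d) \<phi>" by (rule continuous_on_subset[OF c\<phi>]) (use d in auto)
  qed (use h d \<phi>eq in \<open>auto simp: is_sec_def\<close>)
  let ?V = "ball x d \<inter> (\<lambda>y. (norm (h (\<phi> y)), h (\<phi> y) - y)) -` ({..<norm x} \<times> (- {0}))"
  have "open ?V"
    by (rule continuous_open_preimage) (auto intro!: continuous_intros ck open_Times)
  moreover have "x \<in> ?V" using d(1) gx xz(2) by auto
  ultimately obtain r where r: "r > 0" "ball x r \<subseteq> ?V" using open_contains_ball by blast
  have nx: "norm x > 0" using xz(2) norm_ge_zero[of z] by linarith
  then have "x \<in> closure (ball 0 (norm x))" by simp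
  then obtain y where y: "y \<in> ball 0 (norm x)" "dist y x < r" using r(1) closure_approachable by blast
  then have yV: "y \<in> ?V" using r(2) by (auto simp: dist_commute)
  then have "\<iota> y = \<iota> (h (\<phi> y))" using ag[of "\<phi> y"] d(2)[of y] by auto
  moreover have "h (\<phi> y) \<in> ball 0 (norm x)" "h (\<phi> y) \<noteq> y" using yV by auto
  ultimately show False using inj_onD[OF inj] y(1) by metis
qed

section \<open>Jordan curves created by identifications\<close>

text \<open>The pair \<open>x\<close>, \<open>y\<close> is fixed while the surface
  \<open>\<psi>\<close> in which it is identified varies. All constants, in particular
  \<open>\<epsilon>\<close>, belong to \<open>\<phi>\<close>; this is what makes the later choices
  finite.\<close>

locale pinch =
  fixes \<phi> :: "complex \<Rightarrow> complex" and t0 t1 \<epsilon> :: real and x y :: complex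
  assumes lh: "pointed_lh \<phi>" and t: "t0 < t1" "t1 < 1" and eps: "\<epsilon> > 0"
    and thick_t0: "\<And>p. p \<in> cball 0 t0 \<Longrightarrow> thick (ball 0 t1) \<phi> p \<epsilon>"
    and xt0: "norm x \<le> t0" and yx: "norm y = norm x" and ne: "x \<noteq> y" and \<phi>xy: "\<phi> x = \<phi> y"
begin

text \<open>Both radii as one path from \<open>y\<close> through 0 to \<open>x\<close>, whose image
  closes up once \<open>x\<close> and \<open>y\<close> are identified.\<close>

definition \<gamma> :: "real \<Rightarrow> complex" where
  "\<gamma> s = (if s \<le> 1/2 then of_real (1 - 2 * s) * y else of_real (2 * s - 1) * x)"

definition pinches :: "(complex \<Rightarrow> complex) \<Rightarrow> (complex \<Rightarrow> complex) \<Rightarrow> bool" where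
  "pinches \<psi> \<iota> \<longleftrightarrow> pointed_lh \<psi> \<and> immersion \<phi> (ball 0 t1) \<psi> \<iota> \<and> \<iota> x = \<iota> y \<and> inj_on \<iota> (ball 0 (norm x))"

definition filled :: "(complex \<Rightarrow> complex) \<Rightarrow> complex set" where
  "filled \<iota> = - outside (\<iota> ` path_image \<gamma>)"

lemma x_pos: "norm x > 0"
  using ne yx by (cases "x = 0") auto

lemma imm: "local_imm Dsk \<phi>" "local_imm (ball 0 t1) \<phi>"
proof -
  show "local_imm Dsk \<phi>" using pointed_lh_local_imm[OF lh] .
  then show "local_imm (ball 0 t1) \<phi>" using t by (rule_tac local_imm_subset) (auto intro: less_trans)
qed

lemma norm_\<gamma>: "norm (\<gamma> s) = \<bar>1 - 2 * s\<bar> * norm x"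
proof -
  have "cmod (of_real (1 - 2 * s) * y) = \<bar>1 - 2 * s\<bar> * norm x" "cmod (of_real (2 * s - 1) * x) = \<bar>2 * s - 1\<bar> * norm x"
    by (simp_all only: norm_mult norm_of_real yx)
  then show ?thesis unfolding \<gamma>_def by (auto simp: abs_minus_commute)
qed

lemma \<gamma>_ends: "\<gamma> 0 = y" "\<gamma> 1 = x" "\<gamma> (1/2) = 0"
  by (simp_all add: \<gamma>_def)

lemma path_\<gamma>: "path \<gamma>"
proof -
  have "continuous_on ({0..1/2} \<union> {1/2..1}) \<gamma>" unfolding \<gamma>_def
  proof (rule continuous_on_If)
    fix s :: real
    show "of_real (1 - 2 * s) * y = of_real (2 * s - 1) * x" if "s \<in> {1/2..1}" "s \<le> 1/2"
    proof -
      have "1 - 2 * s = 0" "2 * s - 1 = 0" using that by auto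
      then show ?thesis by (simp only: of_real_0 mult_zero_left)
    qed
    show "of_real (1 - 2 * s) * y = of_real (2 * s - 1) * x" if "s \<in> {0..1/2}" "\<not> s \<le> 1/2" using that by simp
  qed (auto intro!: continuous_intros)
  moreover have "{0..1/2} \<union> {1/2..1} = {0..1::real}" by auto
  ultimately show ?thesis by (simp add: path_def)
qed

lemma \<gamma>_cball: "s \<in> {0..1} \<Longrightarrow> \<gamma> s \<in> cball 0 (norm x)"
  using mult_right_mono[of "\<bar>1 - 2 * s\<bar>" 1 "norm x"] by (auto simp: norm_\<gamma> abs_le_iff)

lemma \<gamma>_image: "path_image \<gamma> \<subseteq> cball 0 (norm x)" "path_image \<gamma> \<subseteq> cball 0 t0" "path_image \<gamma> \<subseteq> ball 0 t1"
  "0 \<in> path_image \<gamma>" "x \<in> path_image \<gamma>" "y \<in> path_image \<gamma>"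
proof -
  show *: "path_image \<gamma> \<subseteq> cball 0 (norm x)" using \<gamma>_cball by (auto simp: path_image_def)
  then show "path_image \<gamma> \<subseteq> cball 0 t0" using xt0 by fastforce
  then show "path_image \<gamma> \<subseteq> ball 0 t1" using t by force
  have "\<gamma> (1/2) \<in> path_image \<gamma>" "\<gamma> 1 \<in> path_image \<gamma>" "\<gamma> 0 \<in> path_image \<gamma>" unfolding path_image_def by (intro imageI; simp)+
  then show "0 \<in> path_image \<gamma>" "x \<in> path_image \<gamma>" "y \<in> path_image \<gamma>" by (simp_all only: \<gamma>_ends)
qed

lemma \<gamma>_inj:
  assumes "\<gamma> s = \<gamma> s'" "s \<le> s'"
  shows "s = s'"
proof -
  have n: "\<bar>1 - 2 * s\<bar> = \<bar>1 - 2 * s'\<bar>" using arg_cong[OF assms(1), of norm] x_pos by (simp add: norm_\<gamma>)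
  show ?thesis
  proof (cases "s \<le> 1/2 \<and> s' > 1/2")
    case True
    then have ee: "1 - 2 * s = 2 * s' - 1" "2 * s' - 1 \<noteq> 0" using n by auto
    have "of_real (1 - 2 * s) * y = of_real (2 * s' - 1) * x" using assms(1) True by (simp add: \<gamma>_def)
    then have "of_real (2 * s' - 1) * y = of_real (2 * s' - 1) * x" unfolding ee(1) .
    then have "y = x" using ee(2) by (simp only: mult_cancel_left of_real_eq_0_iff simp_thms)
    then show ?thesis using ne by simp
  next
    case False
    then show ?thesis using n assms(2) by auto
  qed
qed

lemma interior_\<gamma>: "interior (path_image \<gamma>) = {}"
proof -
  have "path_image \<gamma> \<subseteq> closed_segment 0 y \<union> closed_segment 0 x"
  proof
    fix p assume "p \<in> path_image \<gamma>"
    then obtain s where s: "s \<in> {0..1}" "p = \<gamma> s" by (auto simp: path_image_def)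
    show "p \<in> closed_segment 0 y \<union> closed_segment 0 x"
    proof (cases "s \<le> 1/2")
      case True
      then have "p = (1 - 2 * s) *\<^sub>R y" using s by (simp add: \<gamma>_def scaleR_conv_of_real)
      then have "p \<in> closed_segment 0 y" using True s unfolding closed_segment_def
        by (intro CollectI exI[of _ "1 - 2 * s"]) auto
      then show ?thesis by blast
    next
      case False
      then have "p = (2 * s - 1) *\<^sub>R x" using s by (simp add: \<gamma>_def scaleR_conv_of_real)
      then have "p \<in> closed_segment 0 x" using False s unfolding closed_segment_def
        by (intro CollectI exI[of _ "2 * s - 1"]) auto
      then show ?thesis by blast
    qed
  qed
  moreover have "interior (closed_segment 0 y \<union> closed_segment 0 x) = {}"
    by (subst interior_closed_Un_empty_interior) (auto simp: interior_closed_segment_ge2)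
  ultimately show ?thesis using interior_mono by blast
qed

context
  fixes \<psi> \<iota> assumes pin: "pinches \<psi> \<iota>"
begin

lemma pin_simps: "pointed_lh \<psi>" "local_imm Dsk \<psi>" "immersion \<phi> (ball 0 t1) \<psi> \<iota>" "\<iota> x = \<iota> y" "inj_on \<iota> (ball 0 (norm x))"
  using pin pointed_lh_local_imm by (auto simp: pinches_def)

lemma \<iota>_facts: "continuous_on (ball 0 t1) \<iota>" "\<And>p. p \<in> ball 0 t1 \<Longrightarrow> \<iota> p \<in> Dsk" "\<iota> 0 = 0"
   "\<And>p. p \<in> ball 0 t1 \<Longrightarrow> \<psi> (\<iota> p) = \<phi> p"
  using pin_simps(3) unfolding immersion_def by (simp_all add: image_subset_iff)

lemma loop_image: "path_image (\<lambda>s. \<iota> (\<gamma> s)) = \<iota> ` path_image \<gamma>"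
  by (auto simp: path_image_def)

text \<open>Inner points of \<open>\<gamma>\<close> have modulus below \<open>norm x\<close>, where
  \<open>\<iota>\<close> is injective, and \<open>boundary_injective\<close> keeps them apart from
  the common image of the ends.\<close>

lemma loop: "simple_path (\<lambda>s. \<iota> (\<gamma> s))" "pathfinish (\<lambda>s. \<iota> (\<gamma> s)) = pathstart (\<lambda>s. \<iota> (\<gamma> s))"
proof -
  have pl: "path (\<lambda>s. \<iota> (\<gamma> s))" unfolding path_def
    by (rule continuous_on_compose2[OF \<iota>_facts(1)]) (use path_\<gamma> \<gamma>_image(3) in \<open>auto simp: path_def path_image_def\<close>)
  have xt1: "norm x < t1" using xt0 t by simp
  have thk: "thick (ball 0 t1) \<phi> p \<epsilon>" if "norm p \<le> norm x" for p
    using thick_t0[of p] that xt0 by auto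
  have nx: "\<iota> x \<noteq> \<iota> z" if "norm z < norm x" for z
    by (rule boundary_injective[OF imm(2) pin_simps(2,3) eps]) (use that pin_simps thk xt1 in auto)
  have int: "norm (\<gamma> s) < norm x" if "0 < s" "s < 1" for s
    using that x_pos mult_strict_right_mono[of "\<bar>1 - 2 * s\<bar>" 1 "norm x"] by (auto simp: norm_\<gamma> abs_less_iff)
  show "simple_path (\<lambda>s. \<iota> (\<gamma> s))"
  proof (rule simple_pathI[OF pl])
    fix s s' :: real assume s: "0 \<le> s" "s < s'" "s' \<le> 1" and eq: "\<iota> (\<gamma> s) = \<iota> (\<gamma> s')"
    have end0: "\<iota> (\<gamma> 0) = \<iota> x" "\<iota> (\<gamma> 1) = \<iota> x" using \<gamma>_ends pin_simps(4) by auto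
    show "s = 0 \<and> s' = 1"
    proof (rule ccontr)
      assume n: "\<not> (s = 0 \<and> s' = 1)"
      consider "s = 0" "0 < s'" "s' < 1" | "0 < s" "s < 1" "s' = 1" | "0 < s" "s < 1" "0 < s'" "s' < 1"
        using s n by fastforce
      then show False
      proof cases
        case 1
        then show False using nx[OF int[of s']] end0 eq by simp
      next
        case 2
        then show False using nx[OF int[of s]] end0 eq by simp
      next
        case 3
        then have "\<gamma> s = \<gamma> s'" using inj_onD[OF pin_simps(5) eq] int by simp
        then show False using \<gamma>_inj s by fastforce
      qed
    qed
  qed
  show "pathfinish (\<lambda>s. \<iota> (\<gamma> s)) = pathstart (\<lambda>s. \<iota> (\<gamma> s))"
    using \<gamma>_ends pin_simps(4) by (simp add: pathfinish_def pathstart_def)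
qed

lemma filled_eq: "filled \<iota> = \<iota> ` path_image \<gamma> \<union> inside (\<iota> ` path_image \<gamma>)"
  unfolding filled_def using union_with_inside by metis

lemma compact_loop: "compact (\<iota> ` path_image \<gamma>)" "connected (\<iota> ` path_image \<gamma>)" "\<iota> ` path_image \<gamma> \<subseteq> Dsk"
proof -
  have "path (\<lambda>s. \<iota> (\<gamma> s))" using loop(1) by (simp add: simple_path_def)
  then show "compact (\<iota> ` path_image \<gamma>)" "connected (\<iota> ` path_image \<gamma>)"
    unfolding loop_image[symmetric] by (rule compact_path_image, rule connected_path_image)
  show "\<iota> ` path_image \<gamma> \<subseteq> Dsk" using \<iota>_facts(2) \<gamma>_image(3) by blast
qed

lemma filled: "compact (filled \<iota>)" "connected (filled \<iota>)" "connected (- filled \<iota>)" "filled \<iota> \<subseteq> Dsk"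
   "frontier (filled \<iota>) \<subseteq> \<iota> ` path_image \<gamma>" "0 \<in> filled \<iota>"
proof -
  let ?X = "\<iota> ` path_image \<gamma>"
  have cl: "closed ?X" and bd: "bounded ?X" using compact_loop(1) by (auto simp: compact_imp_closed compact_imp_bounded)
  have "- Dsk \<subseteq> outside ?X" by (rule outside_subset_convex) (use compact_loop in auto)
  then show D: "filled \<iota> \<subseteq> Dsk" by (auto simp: filled_def)
  have "closed (filled \<iota>)" unfolding filled_def using open_outside[OF cl] by (simp add: closed_Compl)
  then show "compact (filled \<iota>)" using D bounded_subset[of Dsk] by (auto simp: compact_eq_bounded_closed)
  show "connected (filled \<iota>)" unfolding filled_eq using connected_with_inside[OF cl compact_loop(2)] .
  show "connected (- filled \<iota>)" unfolding filled_def using connected_outside[OF bd] by simp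
  show "frontier (filled \<iota>) \<subseteq> ?X" unfolding filled_def frontier_complement by (rule frontier_outside_subset[OF cl])
  have "\<iota> 0 \<in> ?X" using \<gamma>_image(4) by blast
  then show "0 \<in> filled \<iota>" using \<iota>_facts(3) by (simp add: filled_eq)
qed

lemma loop_thick:
  assumes "p \<in> cball 0 t0"
  shows "thick Dsk \<psi> (\<iota> p) \<epsilon>"
proof -
  obtain g where g: "is_sec (ball 0 t1) \<phi> p \<epsilon> g" using thick_t0[OF assms] by (auto simp: thick_def)
  have "p \<in> ball 0 t1" using assms t by auto
  then show ?thesis using sec_immersion[OF pin_simps(3) _ g] by (auto simp: thick_def)
qed

text \<open>The frontier of the filled region lies on the curve, to which the disks of
  \<open>\<phi>\<close> are carried by \<open>\<iota>\<close>; hence the radius is independent of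
  \<open>\<psi>\<close>.\<close>

lemma filled_thick: "d \<in> filled \<iota> \<Longrightarrow> thick Dsk \<psi> d \<epsilon>"
proof (erule thick_from_frontier[OF pin_simps(2) filled(1,4) _ eps, rotated])
  fix q assume "q \<in> frontier (filled \<iota>)"
  then obtain p where p: "p \<in> path_image \<gamma>" "q = \<iota> p" using filled(5) by blast
  then have "p \<in> cball 0 t0" using \<gamma>_image(2) by blast
  then show "thick Dsk \<psi> q \<epsilon>" unfolding p(2) by (rule loop_thick)
qed

lemma filled_bound:
  assumes "\<And>p. p \<in> path_image \<gamma> \<Longrightarrow> cmod (\<phi> p) \<le> M" "d \<in> filled \<iota>"
  shows "cmod (\<psi> d) \<le> M"
proof (rule norm_bound_from_frontier[OF pin_simps(2) filled(1,4) _ assms(2)])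
  fix q assume "q \<in> frontier (filled \<iota>)"
  then obtain p where p: "p \<in> path_image \<gamma>" "q = \<iota> p" using filled(5) by blast
  then have "\<psi> q = \<phi> p" using \<iota>_facts(4) \<gamma>_image(3) by blast
  then show "cmod (\<psi> q) \<le> M" using assms(1)[OF p(1)] by simp
qed

text \<open>An immersion of a neighbourhood of the filled loop would restrict to the inclusion along \<open>\<gamma>\<close>,
  but \<open>x \<noteq> y\<close> are identified in the loop.\<close>
lemma obstruction_disk:
  assumes W: "open W" "filled \<iota> \<subseteq> W" "W \<subseteq> Dsk"
  obtains U where "odisk U" "U \<subseteq> W" "filled \<iota> \<subseteq> U" "\<nexists>e. immersion \<psi> U \<phi> e"
proof -
  have ne': "filled \<iota> \<noteq> {}" using filled(6) by blast
  obtain U where U: "open U" "filled \<iota> \<subseteq> U" "U \<subseteq> W" "connected U" "U homeomorphic ball (0::complex) 1"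
    using simply_connected_nbhd[OF filled(1,2) ne' filled(3) W(1,2)] .
  have "odisk U" unfolding odisk_def PC_def
    using U W(3) filled(6) connected_open_path_connected[OF U(1,4)] by blast
  moreover have "\<nexists>e. immersion \<psi> U \<phi> e"
  proof
    assume "\<exists>e. immersion \<psi> U \<phi> e"
    then obtain e where e: "continuous_on U e" "e ` U \<subseteq> Dsk" "e 0 = 0" "\<And>u. u \<in> U \<Longrightarrow> \<phi> (e u) = \<psi> u"
      by (auto simp: immersion_def)
    have \<iota>U: "\<iota> p \<in> U" if "p \<in> path_image \<gamma>" for p
      using that U(2) unfolding filled_eq by blast
    have id: "e (\<iota> p) = p" if p: "p \<in> path_image \<gamma>" for p
    proof (rule lift_unique[OF imm(1), where X="path_image \<gamma>" and p="\<lambda>p. e (\<iota> p)" and q="\<lambda>p. p" and ?x0.0=0])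
      show "connected (path_image \<gamma>)" using path_\<gamma> by (rule connected_path_image)
      show "continuous_on (path_image \<gamma>) (\<lambda>p. e (\<iota> p))"
        by (rule continuous_on_compose2[OF e(1) continuous_on_subset[OF \<iota>_facts(1) \<gamma>_image(3)]]) (use \<iota>U in blast)
      show "(\<lambda>p. e (\<iota> p)) \<in> path_image \<gamma> \<rightarrow> Dsk" using e(2) \<iota>U by blast
      show "(\<lambda>p. p) \<in> path_image \<gamma> \<rightarrow> Dsk" using \<gamma>_image(3) t by force
      show "\<phi> (e (\<iota> q)) = \<phi> q" if "q \<in> path_image \<gamma>" for q
        using e(4)[OF \<iota>U[OF that]] \<iota>_facts(4)[of q] \<gamma>_image(3) that by auto
    qed (use \<gamma>_image(4) e(3) \<iota>_facts(3) p in auto)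
    show False using id[OF \<gamma>_image(5)] id[OF \<gamma>_image(6)] pin_simps(4) ne by simp
  qed
  ultimately show ?thesis using that U by blast
qed

end

text \<open>Winding numbers are complex-valued; off the closed curve the modulus is a natural
  number, which \<open>nat\<close> and the floor merely extract. The indices \<open>(z, j)\<close>
  number the enclosed points over \<open>z\<close> without referring to any particular
  surface.\<close>

definition nodes :: "complex set \<Rightarrow> complex set \<Rightarrow> (complex + complex \<times> nat) set" where
  "nodes N Z = Inl ` N \<union> Inr ` (SIGMA z:Z. {..<nat \<lfloor>cmod (winding_number (\<lambda>s. \<phi> (\<gamma> s)) z)\<rfloor>})"

definition lab :: "complex + complex \<times> nat \<Rightarrow> complex" where
  "lab = case_sum \<phi> fst"

text \<open>The nodes are a finite net on the loop and the points in its interior over a finite net \<open>Z\<close>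
  of the plane; the number of the latter only depends on \<open>\<phi>\<close>, by the argument principle.\<close>
lemma exists_charts:
  assumes pin: "pinches \<psi> \<iota>"
    and Z: "Z \<inter> \<phi> ` path_image \<gamma> = {}" "\<And>w. cmod w \<le> M \<Longrightarrow> \<exists>z\<in>Z. dist w z < \<epsilon>/4"
    and M: "\<And>p. p \<in> path_image \<gamma> \<Longrightarrow> cmod (\<phi> p) \<le> M"
    and N: "N \<subseteq> path_image \<gamma>"
      "\<And>p. p \<in> path_image \<gamma> \<Longrightarrow> \<exists>p'\<in>N. dist (\<phi> p') (\<phi> p) < \<epsilon>/8 \<and> (\<forall>g. is_sec (ball 0 t1) \<phi> p' \<epsilon> g \<longrightarrow> g (\<phi> p) = p)"
  obtains C G where "charts \<psi> (nodes N Z) lab \<epsilon> C G" "\<forall>p\<in>N. C (Inl p) = \<iota> p"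
    "filled \<iota> \<subseteq> (\<Union>i\<in>nodes N Z. chart_img lab \<epsilon> G i)"
proof -
  note ps = pin_simps[OF pin] and io = \<iota>_facts[OF pin] and fl = filled[OF pin]
  let ?X = "\<iota> ` path_image \<gamma>"
  let ?A = "\<lambda>z. {a \<in> inside ?X. \<psi> a = z}"
  let ?m = "\<lambda>z. nat \<lfloor>cmod (winding_number (\<lambda>s. \<phi> (\<gamma> s)) z)\<rfloor>"
  have \<psi>\<phi>: "\<psi> (\<iota> (\<gamma> s)) = \<phi> (\<gamma> s)" if "s \<in> {0..1}" for s
  proof -
    have "\<gamma> s \<in> ball 0 t1" using \<gamma>_image(3) that unfolding path_image_def by blast
    then show ?thesis by (rule io(4))
  qed
  have "\<exists>f. bij_betw f {..<?m z} (?A z)" if z: "z \<in> Z" for z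
  proof -
    have zn: "z \<notin> \<psi> ` path_image (\<lambda>s. \<iota> (\<gamma> s))"
    proof
      assume "z \<in> \<psi> ` path_image (\<lambda>s. \<iota> (\<gamma> s))"
      then obtain s where s: "s \<in> {0..1}" "z = \<psi> (\<iota> (\<gamma> s))" by (auto simp: path_image_def)
      then have "z \<in> \<phi> ` path_image \<gamma>" using \<psi>\<phi>[OF s(1)] by (auto simp: path_image_def)
      then show False using Z(1) z by blast
    qed
    have sub: "path_image (\<lambda>s. \<iota> (\<gamma> s)) \<subseteq> Dsk" unfolding loop_image[OF pin] by (rule compact_loop(3)[OF pin])
    have w: "winding_number (\<lambda>s. \<psi> (\<iota> (\<gamma> s))) z = winding_number (\<lambda>s. \<phi> (\<gamma> s)) z"
      by (rule winding_number_cong) (use \<psi>\<phi> in auto)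
    have fin: "finite (?A z)" and "real (card (?A z)) = cmod (winding_number (\<lambda>s. \<phi> (\<gamma> s)) z)"
      using card_preimages_inside[OF ps(1) loop[OF pin] sub zn] unfolding loop_image[OF pin] w by auto
    then have "card (?A z) = ?m z" by (metis floor_of_nat nat_int)
    then show ?thesis using ex_bij_betw_nat_finite[OF fin] by (simp add: atLeast0LessThan)
  qed
  then obtain E where E: "\<And>z. z \<in> Z \<Longrightarrow> bij_betw (E z) {..<?m z} (?A z)" by metis
  define C where "C = case_sum \<iota> (\<lambda>(z, j). E z j)"
  have CD: "C i \<in> filled \<iota> \<and> \<psi> (C i) = lab i" if i: "i \<in> nodes N Z" for i
  proof (cases i)
    case (Inl p)
    then have "p \<in> path_image \<gamma>" using i N(1) by (auto simp: nodes_def)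
    then show ?thesis using Inl io(4)[of p] \<gamma>_image(3) by (auto simp: C_def lab_def filled_eq[OF pin])
  next
    case (Inr q)
    obtain z j where q: "q = (z, j)" by fastforce
    then have "z \<in> Z" "j < ?m z" using i Inr by (auto simp: nodes_def)
    then have "E z j \<in> ?A z" using E bij_betwE by fastforce
    then show ?thesis using Inr q by (auto simp: C_def lab_def filled_eq[OF pin])
  qed
  have "\<exists>g. is_sec Dsk \<psi> (C i) \<epsilon> g" if "i \<in> nodes N Z" for i
    using filled_thick[OF pin] CD[OF that] by (auto simp: thick_def)
  then obtain G where G: "\<And>i. i \<in> nodes N Z \<Longrightarrow> is_sec Dsk \<psi> (C i) \<epsilon> (G i)" by metis
  have cov: "\<exists>i\<in>nodes N Z. d \<in> chart_img lab \<epsilon> G i" if d: "d \<in> filled \<iota>" for d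
  proof -
    have "cmod (\<psi> d) \<le> M" using filled_bound[OF pin M d] .
    then obtain z where z: "z \<in> Z" "dist (\<psi> d) z < \<epsilon>/4" using Z(2) by blast
    obtain g where g: "is_sec Dsk \<psi> d \<epsilon> g" using filled_thick[OF pin d] by (auto simp: thick_def)
    have gd: "g (\<psi> d) = d" "\<And>w. w \<in> ball (\<psi> d) \<epsilon> \<Longrightarrow> \<psi> (g w) = w" using g by (auto simp: is_sec_def)
    have inchart: "d \<in> chart_img lab \<epsilon> G i"
      if i: "i \<in> nodes N Z" and v: "v \<in> ball (\<psi> d) \<epsilon>" "v \<in> ball (lab i) \<epsilon>" "g v = G i v"
        and dl: "dist (lab i) (\<psi> d) < \<epsilon>/2" for i v
    proof -
      have "G i (\<psi> d) = d"
        using sec_agree[OF ps(2) g G[OF i], of v "\<psi> d"] v dl eps CD[OF i] gd(1) by auto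
      moreover have "G i (\<psi> d) \<in> chart_img lab \<epsilon> G i" unfolding chart_img_def using dl by (intro imageI) simp
      ultimately show ?thesis by simp
    qed
    \<comment> \<open>Either the point over the nearby net point \<open>z\<close> is enclosed, hence
      one of the numbered nodes, or the small disk around \<open>d\<close> meets the curve and a
      node of \<open>N\<close> is close.\<close>
    show ?thesis
    proof (cases "g z \<in> inside ?X")
      case True
      have zb: "z \<in> ball (\<psi> d) \<epsilon>" using z eps by auto
      then have "g z \<in> ?A z" using True gd(2) by simp
      then have "g z \<in> E z ` {..<?m z}" unfolding bij_betw_imp_surj_on[OF E[OF z(1)]] .
      then obtain j where j: "j < ?m z" "E z j = g z" by auto
      let ?i = "Inr (z, j)"
      have i: "?i \<in> nodes N Z" using z j by (auto simp: nodes_def)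
      have Ci: "C ?i = g z" "lab ?i = z" using j(2) by (simp_all add: C_def lab_def)
      have "G ?i (\<psi> (C ?i)) = C ?i" using G[OF i] unfolding is_sec_def by (elim conjE)
      then have "G ?i z = g z" unfolding Ci(1) gd(2)[OF zb] .
      then have "d \<in> chart_img lab \<epsilon> G ?i"
        using inchart[OF i zb] z eps by (auto simp: lab_def dist_commute)
      then show ?thesis using i by blast
    next
      case False
      let ?B = "g ` ball (\<psi> d) (\<epsilon>/4)"
      have Bsub: "ball (\<psi> d) (\<epsilon>/4) \<subseteq> ball (\<psi> d) \<epsilon>" using eps by auto
      have "continuous_on (ball (\<psi> d) (\<epsilon>/4)) g" using g Bsub unfolding is_sec_def by (blast intro: continuous_on_subset)
      then have cB: "connected ?B" by (intro connected_continuous_image) auto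
      have "g (\<psi> d) \<in> ?B" using eps by (intro imageI) simp
      then have dB: "d \<in> ?B" unfolding gd(1) .
      have zB: "g z \<in> ?B" using z by auto
      have "?B \<inter> ?X \<noteq> {}"
      proof (cases "d \<in> ?X")
        case True
        then show ?thesis using dB by blast
      next
        case nX: False
        then have "d \<in> inside ?X" using d by (simp add: filled_eq[OF pin])
        then have "?B \<inter> inside ?X \<noteq> {}" "?B - inside ?X \<noteq> {}" using dB zB False by blast+
        then have "?B \<inter> frontier (inside ?X) \<noteq> {}" using connected_Int_frontier[OF cB] by blast
        moreover have "frontier (inside ?X) \<subseteq> ?X"
          using frontier_inside_subset compact_imp_closed[OF compact_loop(1)[OF pin]] by blast
        ultimately show ?thesis by blast
      qed
      then obtain v p where v: "v \<in> ball (\<psi> d) (\<epsilon>/4)" and p: "p \<in> path_image \<gamma>" "g v = \<iota> p" by auto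
      have vb: "v \<in> ball (\<psi> d) \<epsilon>" using v Bsub by blast
      have pt1: "p \<in> ball 0 t1" using \<gamma>_image(3) p(1) by blast
      have v\<phi>: "v = \<phi> p" using gd(2)[OF vb] unfolding p(2) io(4)[OF pt1] by (rule sym)
      obtain p' where p': "p' \<in> N" "dist (\<phi> p') (\<phi> p) < \<epsilon>/8" "\<And>h. is_sec (ball 0 t1) \<phi> p' \<epsilon> h \<Longrightarrow> h (\<phi> p) = p"
        using N(2)[OF p(1)] by (elim bexE conjE) (rule that, assumption+, elim allE impE, assumption+)
      have p't: "p' \<in> cball 0 t0" "p' \<in> ball 0 t1" using p'(1) N(1) \<gamma>_image(2,3) by blast+
      obtain h where h: "is_sec (ball 0 t1) \<phi> p' \<epsilon> h" using thick_t0[OF p't(1)] by (auto simp: thick_def)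
      let ?i = "Inl p'"
      have i: "?i \<in> nodes N Z" using p'(1) by (simp add: nodes_def)
      have Ci: "C ?i = \<iota> p'" "lab ?i = \<phi> p'" by (simp_all add: C_def lab_def)
      have s: "is_sec Dsk \<psi> (C ?i) \<epsilon> (\<lambda>w. \<iota> (h w))" unfolding Ci(1) by (rule sec_immersion[OF ps(3) p't(2) h])
      have vi: "v \<in> ball (lab ?i) \<epsilon>" using p'(2) eps v\<phi> Ci(2) by auto
      have labC: "\<psi> (C ?i) = lab ?i" by (rule conjunct2[OF CD[OF i]])
      \<comment> \<open>\<open>G ?i\<close> was an arbitrary choice, but it passes through
        \<open>\<iota> p'\<close> just like the section pushed forward from \<open>\<phi>\<close>,
        whose value at \<open>v\<close> is known.\<close>
      have "G ?i v = \<iota> (h v)"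
      proof (rule sec_agree[OF ps(2) G[OF i] s, of "lab ?i"])
        have "G ?i (\<psi> (C ?i)) = C ?i" using G[OF i] unfolding is_sec_def by (elim conjE)
        moreover have "\<iota> (h (\<psi> (C ?i))) = C ?i" using s unfolding is_sec_def by (elim conjE)
        ultimately show "G ?i (lab ?i) = \<iota> (h (lab ?i))" unfolding labC by (rule trans[OF _ sym])
        show "lab ?i \<in> ball (\<psi> (C ?i)) \<epsilon>" unfolding labC using eps by simp
        then show "lab ?i \<in> ball (\<psi> (C ?i)) \<epsilon>" .
        show "v \<in> ball (\<psi> (C ?i)) \<epsilon>" unfolding labC by (rule vi)
        then show "v \<in> ball (\<psi> (C ?i)) \<epsilon>" .
      qed
      also have "\<dots> = g v" using p'(3)[OF h] unfolding v\<phi>[symmetric] p(2) by (rule arg_cong)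
      finally have "g v = G ?i v" by (rule sym)
      \<comment> \<open>The meshes were chosen for this sum: \<open>\<epsilon>/8\<close> for the net
        on the curve plus \<open>\<epsilon>/4\<close> for the disk around \<open>\<psi> d\<close>
        stays below the chart radius \<open>\<epsilon>/2\<close>.\<close>
      moreover have "dist (lab ?i) (\<psi> d) < \<epsilon>/2"
      proof -
        have "dist (\<phi> p') (\<psi> d) \<le> dist (\<phi> p') v + dist v (\<psi> d)" by (rule dist_triangle)
        moreover have "dist v (\<psi> d) < \<epsilon>/4" using v by (simp add: dist_commute)
        ultimately show ?thesis using p'(2) v\<phi> Ci(2) eps by simp
      qed
      ultimately have "d \<in> chart_img lab \<epsilon> G ?i" by (rule inchart[OF i vb vi])
      then show ?thesis using i by blast
    qed
  qed
  show ?thesis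
  proof (rule that)
    show "charts \<psi> (nodes N Z) lab \<epsilon> C G" unfolding charts_def
    proof (intro ballI conjI)
      fix i assume i: "i \<in> nodes N Z"
      show "C i \<in> Dsk" using conjunct1[OF CD[OF i]] fl(4) by (rule subsetD[rotated])
      show "\<psi> (C i) = lab i" by (rule conjunct2[OF CD[OF i]])
      show "is_sec Dsk \<psi> (C i) \<epsilon> (G i)" by (rule G[OF i])
    qed
    show "\<forall>p\<in>N. C (Inl p) = \<iota> p" by (simp add: C_def)
    show "filled \<iota> \<subseteq> (\<Union>i\<in>nodes N Z. chart_img lab \<epsilon> G i)" using cov by blast
  qed
qed

end

section \<open>Finitely many obstructions\<close>

text \<open>Each centre of an ordinary net of mesh \<open>e/2\<close> is moved by less than
  \<open>e/2\<close> to a point off \<open>X\<close>, which contains no disk.\<close>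

lemma finite_net_avoiding:
  assumes X: "interior X = {}" and e: "e > 0"
  obtains Z :: "complex set" where "finite Z" "Z \<inter> X = {}" "\<And>w. cmod w \<le> M \<Longrightarrow> \<exists>z\<in>Z. dist w z < e"
proof -
  have "cball 0 M \<subseteq> (\<Union>c\<in>cball 0 M. ball c (e/2))" using e by (force simp: dist_norm)
  then obtain F where F: "F \<subseteq> cball (0::complex) M" "finite F" "cball 0 M \<subseteq> (\<Union>c\<in>F. ball c (e/2))"
    using compactE_image[of "cball (0::complex) M" "cball 0 M" "\<lambda>c. ball c (e/2)"] by auto
  have "\<exists>z. z \<in> ball c (e/2) - X" for c :: complex
  proof (rule ccontr)
    assume "\<nexists>z. z \<in> ball c (e/2) - X"
    then have "ball c (e/2) \<subseteq> interior X" by (intro interior_maximal) auto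
    then show False using X e by (metis centre_in_ball empty_iff half_gt_zero subsetD)
  qed
  then obtain z where z: "\<And>c. z c \<in> ball c (e/2) - X" by metis
  show ?thesis
  proof (rule that[of "z ` F"])
    show "finite (z ` F)" using F(2) by simp
    show "z ` F \<inter> X = {}" using z by blast
    fix w :: complex assume "cmod w \<le> M"
    then have "w \<in> cball 0 M" by simp
    then obtain c where c: "c \<in> F" "dist c w < e/2" using F(3) by auto
    have "dist w (z c) \<le> dist w c + dist c (z c)" by (rule dist_triangle)
    also have "\<dots> < e/2 + e/2" using c(2) z[of c] by (intro add_strict_mono) (auto simp: dist_commute)
    finally show "\<exists>z\<in>z ` F. dist w z < e" using c(1) by auto
  qed
qed

context pinch
begin

text \<open>For every possible overlap relation one obstructing disk is kept, if there is any. A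
  pinching surface realises some relation \<open>E\<close>; the disk kept for \<open>E\<close> may
  come from another surface, but it embeds because the charts match.\<close>

lemma finite_obstructions:
  obtains \<U> where "finite \<U>"
    "\<And>\<psi> U. (\<psi>, U) \<in> \<U> \<Longrightarrow> pointed_lh \<psi> \<and> odisk U \<and> (\<nexists>e. immersion \<psi> U \<phi> e)"
    "\<And>\<psi> \<iota>. pinches \<psi> \<iota> \<Longrightarrow> \<exists>(\<psi>0, U)\<in>\<U>. \<exists>e. embedding \<psi>0 U \<psi> e"
proof -
  have c\<phi>: "continuous_on Dsk \<phi>" using imm by (simp add: local_imm_def)
  have \<gamma>D: "path_image \<gamma> \<subseteq> Dsk" using \<gamma>_image(3) t by force
  have cp: "compact (path_image \<gamma>)" using path_\<gamma> by (rule compact_path_image)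
  have "bounded (\<phi> ` path_image \<gamma>)"
    by (intro compact_imp_bounded compact_continuous_image continuous_on_subset[OF c\<phi>] \<gamma>D cp)
  then obtain M where M: "\<And>p. p \<in> path_image \<gamma> \<Longrightarrow> cmod (\<phi> p) \<le> M" by (auto simp: bounded_iff)
  have "interior (\<phi> ` path_image \<gamma>) = {}" by (rule interior_image_local_imm[OF imm(1) cp \<gamma>D interior_\<gamma>])
  then obtain Z where Z: "finite Z" "Z \<inter> \<phi> ` path_image \<gamma> = {}" "\<And>w. cmod w \<le> M \<Longrightarrow> \<exists>z\<in>Z. dist w z < \<epsilon>/4"
    using finite_net_avoiding[of "\<phi> ` path_image \<gamma>" "\<epsilon>/4"] eps by (metis zero_less_divide_iff zero_less_numeral)
  have sub: "cball 0 t0 \<subseteq> ball (0::complex) t1" using t by auto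
  have e8: "0 < \<epsilon>/8" "\<epsilon>/8 \<le> \<epsilon>" using eps by auto
  obtain \<delta> where \<delta>: "\<delta> > 0" "\<And>p p'. p \<in> cball 0 t0 \<Longrightarrow> p' \<in> cball 0 t0 \<Longrightarrow> dist p p' < \<delta> \<Longrightarrow> dist (\<phi> p) (\<phi> p') < \<epsilon>/8"
    "\<And>p p' g. p \<in> cball 0 t0 \<Longrightarrow> p' \<in> cball 0 t0 \<Longrightarrow> dist p p' < \<delta> \<Longrightarrow> is_sec (ball 0 t1) \<phi> p \<epsilon> g \<Longrightarrow> g (\<phi> p') = p'"
    by (rule sec_uniform[OF imm(2) compact_cball convex_cball sub e8]) blast
  have "path_image \<gamma> \<subseteq> (\<Union>p\<in>path_image \<gamma>. ball p \<delta>)" using \<delta>(1) by force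
  then obtain N' where N': "N' \<subseteq> path_image \<gamma>" "finite N'" "path_image \<gamma> \<subseteq> (\<Union>p\<in>N'. ball p \<delta>)"
    using compactE_image[OF cp, of "path_image \<gamma>" "\<lambda>p. ball p \<delta>"] by auto
  \<comment> \<open>The node 0 makes the map between matching chart systems preserve the
    basepoint.\<close>
  define N where "N = insert 0 N'"
  have N: "N \<subseteq> path_image \<gamma>" using N'(1) \<gamma>_image(4) by (auto simp: N_def)
  have N2: "\<exists>p'\<in>N. dist (\<phi> p') (\<phi> p) < \<epsilon>/8 \<and> (\<forall>g. is_sec (ball 0 t1) \<phi> p' \<epsilon> g \<longrightarrow> g (\<phi> p) = p)"
    if p: "p \<in> path_image \<gamma>" for p
  proof -
    obtain p' where p': "p' \<in> N'" "dist p' p < \<delta>" using N'(3) p by auto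
    have "p' \<in> cball 0 t0" "p \<in> cball 0 t0" using p p'(1) N'(1) \<gamma>_image(2) by blast+
    then show ?thesis using \<delta>(2,3) p' unfolding N_def by (intro bexI[of _ p']) auto
  qed
  define J where "J = nodes N Z"
  have fJ: "finite J" unfolding J_def nodes_def N_def using N'(2) Z(1) by auto
  have J0: "Inl 0 \<in> J" by (simp add: J_def nodes_def N_def)
  define Q where "Q E = (\<lambda>(\<psi>, U). pointed_lh \<psi> \<and> odisk U \<and> (\<nexists>e. immersion \<psi> U \<phi> e) \<and>
    (\<exists>C G. charts \<psi> J lab \<epsilon> C G \<and> overlaps J lab \<epsilon> G = E \<and> C (Inl 0) = 0 \<and> U \<subseteq> (\<Union>i\<in>J. chart_img lab \<epsilon> G i)))" for E
  define \<U> where "\<U> = (\<lambda>E. SOME c. Q E c) ` {E \<in> Pow (J \<times> J). \<exists>c. Q E c}"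
  have QU: "\<exists>E. Q E c" if "c \<in> \<U>" for c
    using that unfolding \<U>_def by (auto intro: someI_ex)
  show ?thesis
  proof (rule that)
    show "finite \<U>" unfolding \<U>_def using fJ by simp
    show "pointed_lh \<psi> \<and> odisk U \<and> (\<nexists>e. immersion \<psi> U \<phi> e)" if "(\<psi>, U) \<in> \<U>" for \<psi> U
      using QU[OF that] by (auto simp: Q_def)
    fix \<psi> \<iota> assume pin: "pinches \<psi> \<iota>"
    note ps = pin_simps[OF pin]
    obtain C G where CG: "charts \<psi> (nodes N Z) lab \<epsilon> C G" "\<forall>p\<in>N. C (Inl p) = \<iota> p"
      "filled \<iota> \<subseteq> (\<Union>i\<in>nodes N Z. chart_img lab \<epsilon> G i)"
      by (rule exists_charts[OF pin Z(2,3) M N N2]) (assumption | rule that)+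
    have ch: "charts \<psi> J lab \<epsilon> C G" using CG(1) by (simp add: J_def)
    have C0: "C (Inl 0) = 0" using bspec[OF CG(2), of 0] \<iota>_facts(3)[OF pin] by (simp add: N_def)
    define W where "W = (\<Union>i\<in>J. chart_img lab \<epsilon> G i)"
    have sec: "is_sec Dsk \<psi> (C i) \<epsilon> (G i)" "\<psi> (C i) = lab i" if "i \<in> J" for i using ch that by (auto simp: charts_def)
    have "open W" unfolding W_def
    proof (intro open_UN ballI)
      fix i assume i: "i \<in> J"
      show "open (chart_img lab \<epsilon> G i)"
        using open_sec_image[OF sec(1)[OF i], of "\<epsilon>/2"] eps by (simp add: chart_img_def sec(2)[OF i])
    qed
    moreover have "W \<subseteq> Dsk"
    proof
      fix u assume "u \<in> W"
      then obtain i w where i: "i \<in> J" "u = G i w" "w \<in> ball (lab i) (\<epsilon>/2)" by (auto simp: W_def chart_img_def)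
      then have "w \<in> ball (\<psi> (C i)) \<epsilon>" using sec(2)[OF i(1)] eps by auto
      then show "u \<in> Dsk" using sec(1)[OF i(1)] i(2) unfolding is_sec_def by blast
    qed
    moreover have "filled \<iota> \<subseteq> W" using CG(3) by (simp add: W_def J_def)
    ultimately obtain U where U: "odisk U" "U \<subseteq> W" "\<nexists>e. immersion \<psi> U \<phi> e"
      using obstruction_disk[OF pin] by metis
    define E where "E = overlaps J lab \<epsilon> G"
    have "Q E (\<psi>, U)" unfolding Q_def prod.case
    proof (intro conjI exI)
      show "charts \<psi> J lab \<epsilon> C G" "overlaps J lab \<epsilon> G = E" "C (Inl 0) = 0" using ch E_def C0 by auto
      show "U \<subseteq> (\<Union>i\<in>J. chart_img lab \<epsilon> G i)" using U(2) by (simp add: W_def)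
    qed (use ps U in auto)
    then have ex: "\<exists>c. Q E c" by blast
    define c where "c = (SOME c. Q E c)"
    have "E \<in> Pow (J \<times> J)" by (auto simp: E_def overlaps_def)
    then have cU: "c \<in> \<U>" unfolding \<U>_def c_def using ex by blast
    have Qc: "Q E c" unfolding c_def by (rule someI_ex[OF ex])
    obtain \<psi>0 U0 where c: "c = (\<psi>0, U0)" by fastforce
    then obtain C0 G0 where q: "pointed_lh \<psi>0" "charts \<psi>0 J lab \<epsilon> C0 G0" "overlaps J lab \<epsilon> G0 = E" "C0 (Inl 0) = 0"
      "U0 \<subseteq> (\<Union>i\<in>J. chart_img lab \<epsilon> G0 i)"
      using Qc unfolding Q_def by auto
    have ov: "overlaps J lab \<epsilon> G0 = overlaps J lab \<epsilon> G" using q(3) E_def by simp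
    obtain m where m: "continuous_on (\<Union>i\<in>J. chart_img lab \<epsilon> G0 i) m" "m \<in> (\<Union>i\<in>J. chart_img lab \<epsilon> G0 i) \<rightarrow> Dsk"
      "inj_on m (\<Union>i\<in>J. chart_img lab \<epsilon> G0 i)" "\<forall>u\<in>(\<Union>i\<in>J. chart_img lab \<epsilon> G0 i). \<psi> (m u) = \<psi>0 u"
      "\<forall>i\<in>J. m (C0 i) = C i"
      by (rule overlaps_embedding[OF pointed_lh_local_imm[OF q(1)] ps(2) eps q(2) ch ov]) (assumption | rule that)+
    have "embedding \<psi>0 U0 \<psi> m" unfolding embedding_def immersion_def
    proof (intro conjI ballI)
      show "continuous_on U0 m" "inj_on m U0" using m(1,3) q(5) continuous_on_subset inj_on_subset by blast+
      show "m ` U0 \<subseteq> Dsk" using m(2) q(5) by blast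
      show "m 0 = 0" using bspec[OF m(5) J0] unfolding q(4) C0 .
      show "\<psi> (m u) = \<psi>0 u" if "u \<in> U0" for u by (rule bspec[OF m(4) subsetD[OF q(5) that]])
    qed
    then show "\<exists>(\<psi>0, U)\<in>\<U>. \<exists>e. embedding \<psi>0 U \<psi> e" using cU c by blast
  qed
qed

end

text \<open>Equal images at \<open>p\<close> and \<open>q\<close> glue the sheets there, and so
  every two points of these sheets with a common image in the plane. What is assumed of
  \<open>p'\<close> and \<open>q'\<close> concerns \<open>\<phi>\<close> only, so they may be a pair
  found in another surface.\<close>

lemma coincidence_transfer:
  assumes \<psi>: "local_imm Dsk \<psi>" and i: "immersion \<phi> S \<psi> \<iota>"
    and S: "p \<in> S" "q \<in> S" and e: "\<epsilon> > 0" "thick S \<phi> p \<epsilon>" "thick S \<phi> q \<epsilon>"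
    and p': "\<And>g. is_sec S \<phi> p \<epsilon> g \<Longrightarrow> g (\<phi> p') = p'" "dist (\<phi> p) (\<phi> p') < \<epsilon>"
    and q': "\<And>g. is_sec S \<phi> q \<epsilon> g \<Longrightarrow> g (\<phi> q') = q'"
    and eq: "\<iota> p = \<iota> q" "\<phi> p' = \<phi> q'"
  shows "\<iota> p' = \<iota> q'"
proof -
  obtain g where g: "is_sec S \<phi> p \<epsilon> g" using e by (auto simp: thick_def)
  obtain h where h: "is_sec S \<phi> q \<epsilon> h" using e by (auto simp: thick_def)
  have s: "is_sec Dsk \<psi> (\<iota> p) \<epsilon> (\<lambda>w. \<iota> (g w))" by (rule sec_immersion[OF i S(1) g])
  have s': "is_sec Dsk \<psi> (\<iota> p) \<epsilon> (\<lambda>w. \<iota> (h w))" unfolding eq(1) by (rule sec_immersion[OF i S(2) h])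
  have \<psi>p: "\<psi> (\<iota> p) = \<phi> p" using i S by (simp add: immersion_def)
  have "\<iota> (g (\<psi> (\<iota> p))) = \<iota> p" using s unfolding is_sec_def by (elim conjE)
  moreover have "\<iota> (h (\<psi> (\<iota> p))) = \<iota> p" using s' unfolding is_sec_def by (elim conjE)
  ultimately have "\<iota> (g (\<psi> (\<iota> p))) = \<iota> (h (\<psi> (\<iota> p)))" by (rule trans[OF _ sym])
  then have "\<iota> (g (\<phi> p')) = \<iota> (h (\<phi> p'))"
    by (rule sec_agree[OF \<psi> s s', rotated 2]) (use e p'(2) \<psi>p in auto)
  then show ?thesis unfolding p'(1)[OF g] unfolding eq(2) q'[OF h] .
qed

text \<open>Among the pairs of points identified by \<open>\<iota>\<close>, one whose larger modulus is minimal.\<close>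
lemma minimal_coincidence:
  assumes f: "local_imm (ball 0 t1) \<phi>" and \<psi>: "local_imm Dsk \<psi>" and i: "immersion \<phi> (ball 0 t1) \<psi> \<iota>"
    and t: "t0 < t1" and e: "\<epsilon> > 0" "\<And>p. p \<in> cball 0 t0 \<Longrightarrow> thick (ball 0 t1) \<phi> p \<epsilon>"
    and \<delta>: "\<delta> > 0" "\<And>p q. p \<in> cball 0 t0 \<Longrightarrow> q \<in> cball 0 t0 \<Longrightarrow> dist p q < \<delta> \<Longrightarrow> \<phi> p = \<phi> q \<Longrightarrow> p = q"
    and ni: "\<not> inj_on \<iota> (cball 0 t0)"
  obtains x y where "norm x \<le> t0" "norm y = norm x" "x \<noteq> y" "\<iota> x = \<iota> y" "inj_on \<iota> (ball 0 (norm x))"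
proof -
  let ?K = "cball (0::complex) t0"
  have sub: "?K \<subseteq> ball 0 t1" using t by auto
  have \<phi>\<iota>: "\<phi> p = \<phi> q" if "p \<in> ?K" "q \<in> ?K" "\<iota> p = \<iota> q" for p q
  proof -
    have "p \<in> ball 0 t1" "q \<in> ball 0 t1" using that sub by blast+
    then have "\<psi> (\<iota> p) = \<phi> p" "\<psi> (\<iota> q) = \<phi> q" using i unfolding immersion_def by blast+
    then show ?thesis using that(3) by metis
  qed
  have c\<iota>: "continuous_on ?K \<iota>" using i sub by (auto simp: immersion_def intro: continuous_on_subset)
  \<comment> \<open>Identified points that differ are at least \<open>\<delta>\<close> apart; this
    closed condition replaces \<open>p \<noteq> q\<close> and makes the set of identified pairs
    compact.\<close>
  let ?C = "{z \<in> ?K \<times> ?K. \<iota> (fst z) - \<iota> (snd z) = 0} \<inter> {z. \<delta> \<le> dist (fst z) (snd z)}"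
  have c1: "continuous_on (?K \<times> ?K) (\<lambda>z. \<iota> (fst z) - \<iota> (snd z))"
    by (intro continuous_intros continuous_on_compose2[OF c\<iota>]) auto
  have "closed {z \<in> ?K \<times> ?K. \<iota> (fst z) - \<iota> (snd z) = 0}"
    by (rule continuous_closed_preimage_constant[OF c1]) (simp add: closed_Times)
  moreover have "closed {z::complex\<times>complex. \<delta> \<le> dist (fst z) (snd z)}"
    by (intro closed_Collect_le continuous_intros)
  ultimately have "closed ?C" by (rule closed_Int)
  moreover have "bounded ?C" by (rule bounded_subset[of "?K \<times> ?K"]) (auto intro: bounded_Times)
  ultimately have cC: "compact ?C" by (simp add: compact_eq_bounded_closed)
  have inC: "(p, q) \<in> ?C" if "p \<in> ?K" "q \<in> ?K" "p \<noteq> q" "\<iota> p = \<iota> q" for p q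
    using \<delta>(2)[OF that(1,2)] \<phi>\<iota>[OF that(1,2,4)] that by (auto simp: not_less[symmetric])
  obtain p q where pq: "p \<in> ?K" "q \<in> ?K" "p \<noteq> q" "\<iota> p = \<iota> q" using ni by (auto simp: inj_on_def)
  then have neC: "?C \<noteq> {}" using inC by blast
  have cm: "continuous_on ?C (\<lambda>z. max (norm (fst z)) (norm (snd z)))" by (intro continuous_intros)
  obtain z where z: "z \<in> ?C" "\<forall>z'\<in>?C. max (norm (fst z)) (norm (snd z)) \<le> max (norm (fst z')) (norm (snd z'))"
    using continuous_attains_inf[OF cC neC cm] by (elim bexE) (rule that)
  define T where "T = max (norm (fst z)) (norm (snd z))"
  have inj: "inj_on \<iota> (ball 0 T)"
  proof (rule inj_onI, rule ccontr)
    fix u v assume uv: "u \<in> ball 0 T" "v \<in> ball 0 T" "\<iota> u = \<iota> v" "u \<noteq> v"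
    have "T \<le> t0" using z(1) by (auto simp: T_def)
    then have "(u, v) \<in> ?C" using inC uv by auto
    then show False using bspec[OF z(2), of "(u, v)"] uv by (auto simp: T_def)
  qed
  \<comment> \<open>At a minimal pair both points lie on the bounding circle, as otherwise
    \<open>boundary_injective\<close> would apply to the outer one.\<close>
  have bi: "norm b = norm a" if ab: "norm a = T" "norm b \<le> T" "a \<in> ?K" "b \<in> ?K" "\<iota> a = \<iota> b" for a b
  proof (rule ccontr)
    assume "norm b \<noteq> norm a"
    then have "norm b < norm a" using ab by simp
    moreover have "norm a < t1" using ab t by auto
    ultimately have "\<iota> a \<noteq> \<iota> b"
      using boundary_injective[OF f \<psi> i e(1) e(2)[OF ab(3)] e(2)[OF ab(4)]] inj ab(1) by blast
    then show False using ab by simp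
  qed
  have zK: "fst z \<in> ?K" "snd z \<in> ?K" "\<iota> (fst z) = \<iota> (snd z)" "fst z \<noteq> snd z" using z(1) \<delta>(1) by auto
  show ?thesis
  proof (cases "norm (fst z) = T")
    case True
    have "norm (snd z) = norm (fst z)" by (rule bi) (use True zK T_def in auto)
    then show ?thesis using that[of "fst z" "snd z"] zK inj True by auto
  next
    case False
    then have T: "norm (snd z) = T" "norm (fst z) \<le> T" by (auto simp: T_def)
    have "norm (fst z) = norm (snd z)" by (rule bi) (use T zK in auto)
    then show ?thesis using that[of "snd z" "fst z"] zK inj T by auto
  qed
qed

text \<open>The first identified pair depends on the surface, but pairs in one ball of radius
  \<open>\<delta>/2\<close> are interchangeable: coincidences transfer in both directions, and
  minimality of each modulus then makes the moduli equal. So every surface with a pair in that ball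
  pinches one reference pair, and finitely many balls cover all pairs.\<close>

lemma immersions_injective_or_obstructed:
  assumes \<phi>: "pointed_lh \<phi>" and t: "t0 < t1" "t1 < 1"
  obtains \<U> where "finite \<U>"
    "\<And>\<psi> U. (\<psi>, U) \<in> \<U> \<Longrightarrow> pointed_lh \<psi> \<and> odisk U \<and> (\<nexists>e. immersion \<psi> U \<phi> e)"
    "\<And>\<psi> \<iota>. pointed_lh \<psi> \<Longrightarrow> immersion \<phi> (ball 0 t1) \<psi> \<iota> \<Longrightarrow>
       inj_on \<iota> (cball 0 t0) \<or> (\<exists>(\<psi>0, U)\<in>\<U>. \<exists>e. embedding \<psi>0 U \<psi> e)"
proof -
  let ?K = "cball (0::complex) t0" and ?S = "ball (0::complex) t1"
  have f: "local_imm ?S \<phi>" by (rule local_imm_subset[OF pointed_lh_local_imm[OF \<phi>]]) (use t in auto)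
  have sub: "?K \<subseteq> ?S" using t by auto
  obtain \<epsilon> where e: "\<epsilon> > 0" "\<And>p. p \<in> ?K \<Longrightarrow> thick ?S \<phi> p \<epsilon>" using compact_thick[OF f compact_cball sub] by blast
  obtain \<delta> where \<delta>: "\<delta> > 0" "\<And>p p'. p \<in> ?K \<Longrightarrow> p' \<in> ?K \<Longrightarrow> dist p p' < \<delta> \<Longrightarrow> dist (\<phi> p) (\<phi> p') < \<epsilon>"
    "\<And>p p' g. p \<in> ?K \<Longrightarrow> p' \<in> ?K \<Longrightarrow> dist p p' < \<delta> \<Longrightarrow> is_sec ?S \<phi> p \<epsilon> g \<Longrightarrow> g (\<phi> p') = p'"
    by (rule sec_uniform[OF f compact_cball convex_cball sub e(1) order_refl]) blast
  have loc: "p = q" if pq: "p \<in> ?K" "q \<in> ?K" "dist p q < \<delta>" "\<phi> p = \<phi> q" for p q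
  proof -
    obtain g where g: "is_sec ?S \<phi> p \<epsilon> g" using e(2)[OF pq(1)] by (auto simp: thick_def)
    have "g (\<phi> p) = p" using g unfolding is_sec_def by (elim conjE)
    then show ?thesis using \<delta>(3)[OF pq(1,2,3) g] pq(4) by metis
  qed
  define good where "good \<iota> x y \<longleftrightarrow> norm x \<le> t0 \<and> norm y = norm x \<and> x \<noteq> y \<and> \<iota> x = \<iota> y \<and> inj_on \<iota> (ball 0 (norm x))"
    for \<iota> :: "complex \<Rightarrow> complex" and x y :: complex
  define imm where "imm \<psi> \<iota> \<longleftrightarrow> pointed_lh \<psi> \<and> immersion \<phi> ?S \<psi> \<iota>" for \<psi> \<iota>
  have goodK: "x \<in> ?K" "y \<in> ?K" if "good \<iota> x y" for \<iota> x y using that by (auto simp: good_def)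
  have ex_good: "\<exists>x y. good \<iota> x y" if im: "imm \<psi> \<iota>" and ni: "\<not> inj_on \<iota> ?K" for \<psi> \<iota>
  proof -
    have a: "local_imm Dsk \<psi>" "immersion \<phi> ?S \<psi> \<iota>" using im pointed_lh_local_imm by (auto simp: imm_def)
    obtain x y where "norm x \<le> t0" "norm y = norm x" "x \<noteq> y" "\<iota> x = \<iota> y" "inj_on \<iota> (ball 0 (norm x))"
      by (rule minimal_coincidence[OF f a t(1) e \<delta>(1) loc ni]) (assumption | rule that)+
    then show ?thesis by (auto simp: good_def)
  qed
  have transfer: "\<iota> p' = \<iota> q'"
    if im: "imm \<psi> \<iota>" and K: "p \<in> ?K" "q \<in> ?K" "p' \<in> ?K" "q' \<in> ?K" and d: "dist p p' < \<delta>" "dist q q' < \<delta>"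
      and eq: "\<iota> p = \<iota> q" "\<phi> p' = \<phi> q'" for \<psi> \<iota> p q p' q'
  proof (rule coincidence_transfer[OF _ _ _ _ e(1) e(2)[OF K(1)] e(2)[OF K(2)] _ _ _ eq])
    show "local_imm Dsk \<psi>" "immersion \<phi> ?S \<psi> \<iota>" using im pointed_lh_local_imm by (auto simp: imm_def)
    show "p \<in> ?S" "q \<in> ?S" using K sub by blast+
    show "g (\<phi> p') = p'" if "is_sec ?S \<phi> p \<epsilon> g" for g by (rule \<delta>(3)[OF K(1,3) d(1) that])
    show "g (\<phi> q') = q'" if "is_sec ?S \<phi> q \<epsilon> g" for g by (rule \<delta>(3)[OF K(2,4) d(2) that])
    show "dist (\<phi> p) (\<phi> p') < \<epsilon>" by (rule \<delta>(2)[OF K(1,3) d(1)])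
  qed
  have \<phi>eq: "\<phi> x = \<phi> y" if im: "imm \<psi> \<iota>" and g: "good \<iota> x y" for \<psi> \<iota> x y
  proof -
    have "x \<in> ?S" "y \<in> ?S" using goodK[OF g] sub by blast+
    then have "\<psi> (\<iota> x) = \<phi> x" "\<psi> (\<iota> y) = \<phi> y" using im unfolding imm_def immersion_def by blast+
    then show ?thesis using g unfolding good_def by metis
  qed
  have cov: "?K \<times> ?K \<subseteq> (\<Union>c\<in>?K \<times> ?K. ball c (\<delta>/2))" using \<delta>(1) by force
  obtain F where F: "finite F" "?K \<times> ?K \<subseteq> (\<Union>c\<in>F. ball c (\<delta>/2))"
    by (rule compactE_image[OF compact_Times[OF compact_cball compact_cball] _ cov]) (rule open_ball that | assumption)+
  define P where "P c z \<longleftrightarrow> dist c z < \<delta>/2 \<and> (\<exists>\<psi> \<iota>. imm \<psi> \<iota> \<and> good \<iota> (fst z) (snd z))" for c z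
  define R where "R c \<U> \<longleftrightarrow> finite \<U> \<and> (\<forall>\<psi> U. (\<psi>, U) \<in> \<U> \<longrightarrow> pointed_lh \<psi> \<and> odisk U \<and> (\<nexists>e. immersion \<psi> U \<phi> e)) \<and>
     (\<forall>z \<psi> \<iota>. dist c z < \<delta>/2 \<longrightarrow> imm \<psi> \<iota> \<longrightarrow> good \<iota> (fst z) (snd z) \<longrightarrow> (\<exists>(\<psi>0, U)\<in>\<U>. \<exists>e. embedding \<psi>0 U \<psi> e))"
    for c \<U>
  have "\<exists>\<U>. R c \<U>" for c
  proof (cases "\<exists>z. P c z")
    case False
    then show ?thesis by (intro exI[of _ "{}"]) (auto simp: P_def R_def)
  next
    case True
    then obtain z0 \<psi>0 \<iota>0 where z0: "dist c z0 < \<delta>/2" "imm \<psi>0 \<iota>0" "good \<iota>0 (fst z0) (snd z0)" unfolding P_def by blast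
    obtain x y where xy: "z0 = (x, y)" by fastforce
    have g0: "good \<iota>0 x y" using z0(3) xy by simp
    interpret pinch \<phi> t0 t1 \<epsilon> x y
      by unfold_locales (use \<phi> t e g0 \<phi>eq[OF z0(2) g0] in \<open>auto simp: good_def\<close>)
    obtain \<U> where U: "finite \<U>"
      "\<And>\<psi> U. (\<psi>, U) \<in> \<U> \<Longrightarrow> pointed_lh \<psi> \<and> odisk U \<and> (\<nexists>e. immersion \<psi> U \<phi> e)"
      "\<And>\<psi> \<iota>. pinches \<psi> \<iota> \<Longrightarrow> \<exists>(\<psi>0, U)\<in>\<U>. \<exists>e. embedding \<psi>0 U \<psi> e"
      by (rule finite_obstructions) blast
    have "\<exists>(\<psi>0, U)\<in>\<U>. \<exists>e. embedding \<psi>0 U \<psi> e"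
      if z: "dist c z < \<delta>/2" and im: "imm \<psi> \<iota>" and g: "good \<iota> (fst z) (snd z)" for z \<psi> \<iota>
    proof -
      obtain x' y' where xy': "z = (x', y')" by fastforce
      have g': "good \<iota> x' y'" using g xy' by simp
      have "dist z z0 \<le> dist c z + dist c z0" by (metis dist_commute dist_triangle)
      then have "dist z z0 < \<delta>" using z z0(1) by simp
      then have d: "dist x' x < \<delta>" "dist y' y < \<delta>"
        using dist_fst_le[of z z0] dist_snd_le[of z z0] xy xy' by auto
      note K = goodK[OF g0] and K' = goodK[OF g']
      have i1: "\<iota> x = \<iota> y"
        using transfer[OF im K' K d _ \<phi>eq[OF z0(2) g0]] g' by (simp add: good_def)
      have d': "dist x x' < \<delta>" "dist y y' < \<delta>" using d by (simp_all add: dist_commute)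
      have i2: "\<iota>0 x' = \<iota>0 y'"
        using transfer[OF z0(2) K K' d' _ \<phi>eq[OF im g']] g0 by (simp add: good_def)
      have n: "norm x = norm x'"
      proof (rule antisym)
        show "norm x \<le> norm x'"
        proof (rule ccontr)
          assume "\<not> norm x \<le> norm x'"
          then have "x' \<in> ball 0 (norm x)" "y' \<in> ball 0 (norm x)" using g' by (auto simp: good_def)
          then have "x' = y'" using g0 i2 by (auto simp: good_def dest: inj_onD)
          then show False using g' by (simp add: good_def)
        qed
        show "norm x' \<le> norm x"
        proof (rule ccontr)
          assume "\<not> norm x' \<le> norm x"
          then have "x \<in> ball 0 (norm x')" "y \<in> ball 0 (norm x')" using g0 by (auto simp: good_def)
          then have "x = y" using g' i1 by (auto simp: good_def dest: inj_onD)
          then show False using g0 by (simp add: good_def)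
        qed
      qed
      have "pinches \<psi> \<iota>" unfolding pinches_def
        using im i1 g' n by (simp add: imm_def good_def)
      then show ?thesis by (rule U(3))
    qed
    then show ?thesis unfolding R_def using U(1,2) by (intro exI[of _ \<U>] conjI allI impI) simp_all
  qed
  then have "\<forall>c. \<exists>\<U>. R c \<U>" by (rule allI)
  then obtain V where RV: "\<forall>c. R c (V c)" by (rule choice[THEN exE])
  have V: "finite (V c)" "(\<psi>, U) \<in> V c \<Longrightarrow> pointed_lh \<psi> \<and> odisk U \<and> (\<nexists>e. immersion \<psi> U \<phi> e)"
    "dist c z < \<delta>/2 \<Longrightarrow> imm \<psi> \<iota> \<Longrightarrow> good \<iota> (fst z) (snd z) \<Longrightarrow> \<exists>(\<psi>0, U)\<in>V c. \<exists>e. embedding \<psi>0 U \<psi> e"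
    for c \<psi> U z \<iota>
    using spec[OF RV, of c] unfolding R_def by blast+
  show ?thesis
  proof (rule that[of "\<Union>c\<in>F. V c"])
    show "finite (\<Union>c\<in>F. V c)" using F(1) V(1) by blast
    show "pointed_lh \<psi> \<and> odisk U \<and> (\<nexists>e. immersion \<psi> U \<phi> e)" if "(\<psi>, U) \<in> (\<Union>c\<in>F. V c)" for \<psi> U
      using that V(2) by blast
    fix \<psi> \<iota> assume a: "pointed_lh \<psi>" "immersion \<phi> ?S \<psi> \<iota>"
    then have im: "imm \<psi> \<iota>" by (simp add: imm_def)
    show "inj_on \<iota> ?K \<or> (\<exists>(\<psi>0, U)\<in>(\<Union>c\<in>F. V c). \<exists>e. embedding \<psi>0 U \<psi> e)"
    proof (cases "inj_on \<iota> ?K")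
      case False
      then obtain x y where g: "good \<iota> x y" using ex_good[OF im] by blast
      then have "(x, y) \<in> ?K \<times> ?K" using goodK by blast
      then have "(x, y) \<in> (\<Union>c\<in>F. ball c (\<delta>/2))" by (rule subsetD[OF F(2)])
      then obtain c where c: "c \<in> F" "dist c (x, y) < \<delta>/2" by (auto simp only: UN_iff mem_ball)
      have "\<exists>(\<psi>0, U)\<in>V c. \<exists>e. embedding \<psi>0 U \<psi> e" using V(3)[OF c(2) im] g by simp
      then show ?thesis using c(1) by blast
    qed simp
  qed
qed

section \<open>Factoring immersions through a countable family\<close>

text \<open>It is enough to refine the generating sets, because finite intersections of the
  countable refining family form a base. A generating set equal to the whole space is treated apart:
  the empty intersection serves for it.\<close>

lemma second_countable_topology_generated_by:
  assumes cS: "countable \<S>" and oS: "\<And>s. s \<in> \<S> \<Longrightarrow> openin (topology_generated_by \<B>) s"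
    and sub: "\<And>b x. b \<in> \<B> \<Longrightarrow> x \<in> b \<Longrightarrow> b = \<Union>\<B> \<or> (\<exists>s\<in>\<S>. x \<in> s \<and> s \<subseteq> b)"
  shows "second_countable (topology_generated_by \<B>)"
proof -
  let ?T = "topology_generated_by \<B>"
  let ?f = "\<lambda>F. \<Union>\<B> \<inter> \<Inter>F"
  define \<A> where "\<A> = ?f ` {F. finite F \<and> F \<subseteq> \<S>}"
  have "countable \<A>" unfolding \<A>_def using countable_Collect_finite_subset[OF cS] by (rule countable_image)
  moreover have "openin ?T V" if V: "V \<in> \<A>" for V
  proof -
    obtain F where F: "finite F" "F \<subseteq> \<S>" "V = ?f F" using V by (auto simp: \<A>_def)
    have "openin ?T (?f F)" using F(1,2)
    proof (induction F rule: finite_induct)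
      case empty
      then show ?case using openin_topspace[of ?T] by simp
    next
      case (insert s F)
      then have "openin ?T s" "openin ?T (?f F)" using oS by simp_all
      then have "openin ?T (s \<inter> ?f F)" by (rule openin_Int)
      moreover have "s \<inter> ?f F = ?f (insert s F)" by auto
      ultimately show ?case by simp
    qed
    then show ?thesis using F(3) by simp
  qed
  moreover have "\<exists>V\<in>\<A>. x \<in> V \<and> V \<subseteq> U" if U: "generate_topology_on \<B> U" and x: "x \<in> U" for U x
    using U x
  proof (induction arbitrary: x)
    case (Int a b)
    then obtain V W where V: "V \<in> \<A>" "x \<in> V" "V \<subseteq> a" and W: "W \<in> \<A>" "x \<in> W" "W \<subseteq> b" by blast
    obtain F where F: "finite F" "F \<subseteq> \<S>" "V = ?f F" using V(1) by (auto simp: \<A>_def)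
    obtain G where G: "finite G" "G \<subseteq> \<S>" "W = ?f G" using W(1) by (auto simp: \<A>_def)
    have "?f (F \<union> G) \<in> \<A>" unfolding \<A>_def using F G by blast
    moreover have "?f (F \<union> G) = V \<inter> W" using F G by auto
    ultimately show ?case using V W by (metis IntI Int_mono)
  next
    case (UN K)
    then obtain k where k: "k \<in> K" "x \<in> k" by blast
    then obtain V where "V \<in> \<A>" "x \<in> V" "V \<subseteq> k" using UN.IH by blast
    then show ?case using k(1) by blast
  next
    case (Basis b)
    then have xB: "x \<in> \<Union>\<B>" by blast
    show ?case using sub[OF Basis]
    proof (elim disjE bexE conjE)
      assume 1: "b = \<Union>\<B>"
      have "?f {} \<in> \<A>" unfolding \<A>_def by blast
      then show ?thesis using 1 xB by (intro bexI[of _ "?f {}"]) auto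
    next
      fix s assume 2: "s \<in> \<S>" "x \<in> s" "s \<subseteq> b"
      have "?f {s} \<in> \<A>" unfolding \<A>_def using 2(1) by blast
      then show ?thesis using 2 xB by (intro bexI[of _ "?f {s}"]) auto
    qed
  qed auto
  ultimately show ?thesis unfolding second_countable_def openin_topology_generated_by_iff
    by (intro exI[of _ \<A>]) blast
qed

text \<open>An immersion with its image confined to \<open>S\<close>; keeping track of the target
  allows composition along nested disks.\<close>

definition into :: "(complex \<Rightarrow> complex) \<Rightarrow> complex set \<Rightarrow> (complex \<Rightarrow> complex) \<Rightarrow> complex set \<Rightarrow> (complex \<Rightarrow> complex) \<Rightarrow> bool" where
  "into f X c S \<iota> \<longleftrightarrow> continuous_on X \<iota> \<and> \<iota> ` X \<subseteq> S \<and> \<iota> 0 = 0 \<and> (\<forall>x\<in>X. c (\<iota> x) = f x)"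

lemma immersion_into: "immersion f X \<psi> \<iota> \<longleftrightarrow> into f X \<psi> Dsk \<iota>"
  by (simp add: immersion_def into_def)

lemma intoD:
  assumes "into f X c S \<iota>"
  shows "continuous_on X \<iota>" "\<And>x. x \<in> X \<Longrightarrow> \<iota> x \<in> S" "\<iota> 0 = 0" "\<And>x. x \<in> X \<Longrightarrow> c (\<iota> x) = f x"
  using assms unfolding into_def by (simp_all add: image_subset_iff)

lemma intoI:
  assumes "continuous_on X \<iota>" "\<And>x. x \<in> X \<Longrightarrow> \<iota> x \<in> S" "\<iota> 0 = 0" "\<And>x. x \<in> X \<Longrightarrow> c (\<iota> x) = f x"
  shows "into f X c S \<iota>"
  using assms unfolding into_def by (simp add: image_subset_iff)

lemma into_mono:
  assumes "into f X c S \<iota>" "Y \<subseteq> X" "S \<subseteq> T"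
  shows "into f Y c T \<iota>"
  using assms unfolding into_def by (blast intro: continuous_on_subset)

lemma into_compose:
  assumes a: "into f X c S \<iota>" and b: "into c Y d T \<kappa>" and s: "S \<subseteq> Y"
  shows "into f X d T (\<lambda>x. \<kappa> (\<iota> x))"
proof (rule intoI)
  show "continuous_on X (\<lambda>x. \<kappa> (\<iota> x))"
    by (rule continuous_on_compose2[OF intoD(1)[OF b] intoD(1)[OF a]]) (use a s in \<open>auto simp: into_def\<close>)
  show "\<kappa> (\<iota> x) \<in> T" if "x \<in> X" for x using intoD(2)[OF b] intoD(2)[OF a that] s by blast
  show "\<kappa> (\<iota> 0) = 0" by (simp add: intoD(3)[OF a] intoD(3)[OF b])
  show "d (\<kappa> (\<iota> x)) = f x" if "x \<in> X" for x
    using intoD(4)[OF b, of "\<iota> x"] intoD(2)[OF a that] intoD(4)[OF a that] s by auto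
qed

lemma into_unique:
  assumes c: "local_imm S c" and X: "connected X" "0 \<in> X" and a: "into f X c S \<iota>" and b: "into f X c S \<kappa>" and x: "x \<in> X"
  shows "\<iota> x = \<kappa> x"
proof (rule lift_unique[OF c X(1), where p=\<iota> and q=\<kappa> and x=x and ?x0.0=0])
  show "\<iota> \<in> X \<rightarrow> S" "\<kappa> \<in> X \<rightarrow> S" using intoD(2)[OF a] intoD(2)[OF b] by auto
  show "c (\<iota> y) = c (\<kappa> y)" if "y \<in> X" for y using intoD(4)[OF a that] intoD(4)[OF b that] by simp
  show "\<iota> 0 = \<kappa> 0" using intoD(3)[OF a] intoD(3)[OF b] by simp
qed (use intoD(1)[OF a] intoD(1)[OF b] X(2) x in auto)

lemma into_id: "X \<subseteq> S \<Longrightarrow> into f X f S (\<lambda>x. x)"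
  by (rule intoI) auto

text \<open>The composition is a pointed lift of \<open>f\<close> through itself, hence the
  inclusion by uniqueness, and a map with a left inverse is injective.\<close>

lemma into_retract_inj:
  assumes c: "local_imm S f" and X: "connected X" "0 \<in> X" "X \<subseteq> S" and a: "into f X c T \<iota>" and b: "into c Y f S \<kappa>" "T \<subseteq> Y"
  shows "inj_on \<iota> X"
proof (rule inj_on_inverseI[where g=\<kappa>])
  show "\<kappa> (\<iota> x) = x" if "x \<in> X" for x
    using into_unique[OF c X(1,2) into_compose[OF a b] into_id[OF X(3)] that] .
qed

lemma into_perturb:
  assumes c: "local_imm S c" and a: "continuous_on X p" "\<And>x. x \<in> X \<Longrightarrow> p x \<in> S" "p 0 = 0" "0 \<in> X"
    and t: "\<And>x. x \<in> X \<Longrightarrow> thick S c (p x) r"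
    and f: "continuous_on X f" "\<And>x. x \<in> X \<Longrightarrow> dist (c (p x)) (f x) < r" "f 0 = c 0"
  obtains q where "into f X c S q"
proof (rule lift_perturb[OF c a(1) _ t f(1,2)])
  show "p \<in> X \<rightarrow> S" using a(2) by auto
  fix q assume q: "continuous_on X q" "q \<in> X \<rightarrow> S" "\<And>x. x \<in> X \<Longrightarrow> c (q x) = f x" "\<And>x. x \<in> X \<Longrightarrow> f x = c (p x) \<Longrightarrow> q x = p x"
  have "into f X c S q"
  proof (rule intoI)
    show "q 0 = 0" using q(4)[OF a(4)] a(3) f(3) by simp
  qed (use q in auto)
  then show thesis by (rule that)
qed

definition lifts :: "(complex \<Rightarrow> complex) \<Rightarrow> complex set \<Rightarrow> (complex \<Rightarrow> complex) \<Rightarrow> bool" where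
  "lifts f X \<psi> \<longleftrightarrow> (\<exists>\<iota>. immersion f X \<psi> \<iota>)"

definition embeds :: "(complex \<Rightarrow> complex) \<Rightarrow> complex set \<Rightarrow> (complex \<Rightarrow> complex) \<Rightarrow> bool" where
  "embeds f X \<psi> \<longleftrightarrow> (\<exists>\<iota>. embedding f X \<psi> \<iota>)"

lemma lifts_compose: "into f X c S \<iota> \<Longrightarrow> S \<subseteq> Y \<Longrightarrow> lifts c Y \<psi> \<Longrightarrow> lifts f X \<psi>"
  unfolding lifts_def immersion_into using into_compose by blast

lemma embeds_compose:
  assumes a: "into f X c S \<iota>" "inj_on \<iota> X" and s: "S \<subseteq> Y" and e: "embeds c Y \<psi>"
  shows "embeds f X \<psi>"
proof -
  obtain \<kappa> where k: "into c Y \<psi> Dsk \<kappa>" "inj_on \<kappa> Y" using e by (auto simp: embeds_def embedding_def immersion_into)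
  have "\<iota> ` X \<subseteq> Y" using intoD(2)[OF a(1)] s by blast
  then have "inj_on (\<kappa> \<circ> \<iota>) X" using a(2) k(2) by (intro comp_inj_on) (auto intro: inj_on_subset)
  then have "embedding f X \<psi> (\<lambda>x. \<kappa> (\<iota> x))"
    unfolding embedding_def immersion_into using into_compose[OF a(1) k(1) s] by (simp add: o_def)
  then show ?thesis unfolding embeds_def by blast
qed

lemma embeds_subset: "embeds f X \<psi> \<Longrightarrow> Y \<subseteq> X \<Longrightarrow> embeds f Y \<psi>"
  using embeds_compose[of f Y f Y "\<lambda>x. x" X \<psi>] into_id[of Y Y f] by simp

text \<open>Pointed immersions are unique, so the given ones restrict to one another and patch
  together; \<open>\<rho> x\<close> is a radius strictly between \<open>norm x\<close> and
  1.\<close>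

lemma immersion_exhaustion:
  assumes \<psi>: "local_imm Dsk \<psi>" and I: "\<And>r. 0 < r \<Longrightarrow> r < 1 \<Longrightarrow> immersion f (ball 0 r) \<psi> (I r)"
  obtains \<iota> where "immersion f Dsk \<psi> \<iota>" "\<And>r x. 0 < r \<Longrightarrow> r < 1 \<Longrightarrow> x \<in> ball 0 r \<Longrightarrow> \<iota> x = I r x"
proof -
  define \<rho> where "\<rho> x = (1 + norm x) / 2" for x :: complex
  define \<iota> where "\<iota> x = I (\<rho> x) x" for x
  have \<rho>: "0 < \<rho> x" "\<rho> x < 1" "x \<in> ball 0 (\<rho> x)" if "x \<in> Dsk" for x
    using that norm_ge_zero[of x] by (auto simp: \<rho>_def field_simps add_pos_nonneg)
  have eq: "\<iota> x = I r x" if r: "0 < r" "r < 1" and x: "x \<in> ball 0 r" for r x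
  proof -
    have xD: "x \<in> Dsk" using x r by auto
    let ?m = "min r (\<rho> x)"
    have m: "0 < ?m" using r \<rho>[OF xD] by simp
    have 1: "into f (ball 0 ?m) \<psi> Dsk (I r)"
      by (rule into_mono[OF I[OF r, unfolded immersion_into]]) auto
    have 2: "into f (ball 0 ?m) \<psi> Dsk (I (\<rho> x))"
      by (rule into_mono[OF I[OF \<rho>(1,2)[OF xD], unfolded immersion_into]]) auto
    have "I (\<rho> x) x = I r x"
      by (rule into_unique[OF \<psi> _ _ 2 1]) (use m x \<rho>(3)[OF xD] in auto)
    then show ?thesis by (simp add: \<iota>_def)
  qed
  have "immersion f Dsk \<psi> \<iota>" unfolding immersion_into
  proof (rule intoI)
    have U: "Dsk = (\<Union>r\<in>{0<..<1}. ball 0 r)"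
    proof
      show "Dsk \<subseteq> (\<Union>r\<in>{0<..<1}. ball 0 r)" using \<rho> by (intro subsetI UN_I[of "\<rho> _"]) auto
      show "(\<Union>r\<in>{0<..<1}. ball 0 r) \<subseteq> Dsk" by auto
    qed
    show "continuous_on Dsk \<iota>" unfolding U
    proof (rule continuous_on_open_UN)
      fix r :: real assume r: "r \<in> {0<..<1}"
      then have "continuous_on (ball 0 r) (I r)" using I by (auto simp: immersion_def)
      then show "continuous_on (ball 0 r) \<iota>" by (rule continuous_on_eq) (use eq r in auto)
    qed auto
    have eI: "into f (ball 0 (\<rho> x)) \<psi> Dsk (I (\<rho> x))" if "x \<in> Dsk" for x
      using I[OF \<rho>(1,2)[OF that]] by (simp add: immersion_into)
    show "\<iota> x \<in> Dsk" "\<psi> (\<iota> x) = f x" if "x \<in> Dsk" for x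
      using intoD(2,4)[OF eI[OF that] \<rho>(3)[OF that]] by (simp_all add: \<iota>_def)
    show "\<iota> 0 = 0" using intoD(3)[OF eI[of 0]] by (simp add: \<iota>_def)
  qed
  then show ?thesis using that eq by blast
qed

text \<open>Compatible embeddings of all smaller balls would have an injective union, as any two
  points lie in a common ball. The smaller radius gives the room needed for approximation.\<close>

lemma not_embeds_ball:
  assumes \<psi>: "local_imm Dsk \<psi>" and n: "\<not> embeds f Dsk \<psi>"
  shows "\<exists>r. 0 < r \<and> r < 1 \<and> \<not> embeds f (ball 0 r) \<psi>"
proof (rule ccontr)
  assume a: "\<nexists>r. 0 < r \<and> r < 1 \<and> \<not> embeds f (ball 0 r) \<psi>"
  have "\<exists>i. immersion f (ball 0 r) \<psi> i \<and> inj_on i (ball 0 r)" if "0 < r" "r < 1" for r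
    using a that by (auto simp: embedding_def embeds_def)
  then obtain I where I: "\<And>r. 0 < r \<Longrightarrow> r < 1 \<Longrightarrow> immersion f (ball 0 r) \<psi> (I r)"
    "\<And>r. 0 < r \<Longrightarrow> r < 1 \<Longrightarrow> inj_on (I r) (ball 0 r)" by metis
  obtain \<iota> where \<iota>: "immersion f Dsk \<psi> \<iota>" "\<And>r x. 0 < r \<Longrightarrow> r < 1 \<Longrightarrow> x \<in> ball 0 r \<Longrightarrow> \<iota> x = I r x"
    using immersion_exhaustion[OF \<psi> I(1)] by metis
  have "inj_on \<iota> Dsk"
  proof (rule inj_onI)
    fix x y assume xy: "x \<in> Dsk" "y \<in> Dsk" "\<iota> x = \<iota> y"
    then obtain r where r: "max (norm x) (norm y) < r" "r < 1" using dense[of "max (norm x) (norm y)" 1] by auto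
    then have r0: "0 < r" using norm_ge_zero[of x] by linarith
    have b: "x \<in> ball 0 r" "y \<in> ball 0 r" using r by auto
    have "I r x = I r y" using \<iota>(2)[OF r0 r(2)] b xy(3) by metis
    then show "x = y" by (rule inj_onD[OF I(2)[OF r0 r(2)] _ b])
  qed
  then show False using n \<iota>(1) by (auto simp: embeds_def embedding_def)
qed

text \<open>Step functions with rational values on a grid form a countable family approximating
  every continuous function on \<open>K\<close>. They need not belong to \<open>\<F>\<close>, so
  \<open>\<D>\<close> collects one member of \<open>\<F>\<close> near each step function, for each
  tolerance, whenever there is one.\<close>

lemma countable_uniformly_dense:
  fixes \<F> :: "(complex \<Rightarrow> complex) set"
  assumes K: "compact K" and c: "\<And>f. f \<in> \<F> \<Longrightarrow> continuous_on K f"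
  obtains \<D> where "countable \<D>" "\<D> \<subseteq> \<F>" "\<And>f e. f \<in> \<F> \<Longrightarrow> e > 0 \<Longrightarrow> \<exists>d\<in>\<D>. \<forall>x\<in>K. dist (f x) (d x) < e"
proof -
  define cell :: "nat \<Rightarrow> complex \<Rightarrow> int \<times> int" where "cell n x = (\<lfloor>real n * Re x\<rfloor>, \<lfloor>real n * Im x\<rfloor>)" for n x
  define val :: "rat \<times> rat \<Rightarrow> complex" where "val = (\<lambda>(a, b). Complex (of_rat a) (of_rat b))"
  \<comment> \<open>A mesh and a finite list of cells with values encode a step function, which
    makes the family countable by its type; unlisted cells get the value 0.\<close>
  define step :: "nat \<times> ((int \<times> int) \<times> (rat \<times> rat)) list \<Rightarrow> complex \<Rightarrow> complex" where
    "step = (\<lambda>(n, L) x. case map_of L (cell n x) of None \<Rightarrow> 0 | Some q \<Rightarrow> val q)"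
  have val: "\<exists>q. dist w (val q) < e" if e: "e > 0" for w e
  proof -
    obtain a where a: "Re w - e/2 < of_rat a" "of_rat a < Re w + e/2" using of_rat_dense[of "Re w - e/2" "Re w + e/2"] e by auto
    obtain b where b: "Im w - e/2 < of_rat b" "of_rat b < Im w + e/2" using of_rat_dense[of "Im w - e/2" "Im w + e/2"] e by auto
    have "cmod (w - val (a, b)) \<le> \<bar>Re (w - val (a, b))\<bar> + \<bar>Im (w - val (a, b))\<bar>" by (rule cmod_le)
    also have "\<dots> < e/2 + e/2" using a b by (intro add_strict_mono) (simp_all add: val_def abs_if)
    finally show ?thesis by (intro exI[of _ "(a, b)"]) (simp add: dist_norm)
  qed
  have approx: "\<exists>p. \<forall>x\<in>K. dist (f x) (step p x) < e" if f: "f \<in> \<F>" and e: "e > 0" for f e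
  proof -
    have "\<exists>\<delta>>0. \<forall>x\<in>K. \<forall>y\<in>K. dist y x < \<delta> \<longrightarrow> dist (f y) (f x) < e/2"
      using compact_uniformly_continuous[OF c[OF f] K] half_gt_zero[OF e] unfolding uniformly_continuous_on_def by (elim allE impE)
    then obtain \<delta> where \<delta>: "\<delta> > 0" "\<And>x y. x \<in> K \<Longrightarrow> y \<in> K \<Longrightarrow> dist y x < \<delta> \<Longrightarrow> dist (f y) (f x) < e/2"
      by blast
    obtain n :: nat where n: "2 / \<delta> < real n" using reals_Archimedean2 by blast
    then have n0: "real n > 0" using \<delta>(1) by (meson divide_pos_pos less_trans zero_less_numeral)
    have near: "dist x y < \<delta>" if "cell n x = cell n y" for x y
    proof -
      have fl: "\<bar>real n * a - real n * b\<bar> < 1" if "\<lfloor>real n * a\<rfloor> = \<lfloor>real n * b\<rfloor>" for a b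
        using that by linarith
      have sc: "real n * \<bar>a - b\<bar> = \<bar>real n * a - real n * b\<bar>" for a b
        by (simp add: abs_mult flip: right_diff_distrib)
      have "real n * \<bar>Re x - Re y\<bar> < 1" "real n * \<bar>Im x - Im y\<bar> < 1"
        unfolding sc using that by (auto simp: cell_def intro!: fl)
      then have "\<bar>Re x - Re y\<bar> < 1 / real n" "\<bar>Im x - Im y\<bar> < 1 / real n" using n0 by (simp_all add: field_simps)
      then have "cmod (x - y) < 1 / real n + 1 / real n" using cmod_le[of "x - y"] by simp
      also have "\<dots> < \<delta>" using n n0 \<delta>(1) by (simp add: field_simps)
      finally show ?thesis by (simp add: dist_norm)
    qed
    obtain B where B: "\<And>x. x \<in> K \<Longrightarrow> norm x \<le> B" using compact_imp_bounded[OF K] by (auto simp: bounded_iff)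
    have "finite (cell n ` K)"
    proof (rule finite_subset)
      let ?N = "\<lceil>real n * B\<rceil> + 1"
      show "cell n ` K \<subseteq> {-?N..?N} \<times> {-?N..?N}"
      proof
        fix i assume "i \<in> cell n ` K"
        then obtain x where x: "x \<in> K" "i = cell n x" by blast
        have "\<bar>Re x\<bar> \<le> B" "\<bar>Im x\<bar> \<le> B" using B[OF x(1)] abs_Re_le_cmod[of x] abs_Im_le_cmod[of x] by auto
        then have "\<bar>real n * Re x\<bar> \<le> real n * B" "\<bar>real n * Im x\<bar> \<le> real n * B"
          using n0 by (simp_all add: abs_mult)
        then have "\<lfloor>real n * Re x\<rfloor> \<in> {-?N..?N}" "\<lfloor>real n * Im x\<rfloor> \<in> {-?N..?N}" by (simp_all add: abs_le_iff) linarith+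
        then show "i \<in> {-?N..?N} \<times> {-?N..?N}" using x(2) by (simp add: cell_def)
      qed
    qed simp
    then obtain js where js: "set js = cell n ` K" using finite_list by blast
    have "\<exists>q. \<forall>x\<in>K. cell n x = i \<longrightarrow> dist (f x) (val q) < e" if i: "i \<in> cell n ` K" for i
    proof -
      obtain y where y: "y \<in> K" "i = cell n y" using i by blast
      obtain q where q: "dist (f y) (val q) < e/2" using val e half_gt_zero by blast
      have "dist (f x) (val q) < e" if x: "x \<in> K" "cell n x = i" for x
      proof -
        have "dist (f x) (f y) < e/2" using \<delta>(2)[OF y(1) x(1)] near x(2) y(2) by simp
        then show ?thesis using q dist_triangle[of "f x" "val q" "f y"] by simp
      qed
      then show ?thesis by blast
    qed
    then obtain q where q: "\<And>i x. i \<in> cell n ` K \<Longrightarrow> x \<in> K \<Longrightarrow> cell n x = i \<Longrightarrow> dist (f x) (val (q i)) < e" by metis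
    show ?thesis
    proof (intro exI[of _ "(n, map (\<lambda>i. (i, q i)) js)"] ballI)
      fix x assume x: "x \<in> K"
      then have "step (n, map (\<lambda>i. (i, q i)) js) x = val (q (cell n x))"
        by (simp add: step_def map_of_map_restrict js)
      then show "dist (f x) (step (n, map (\<lambda>i. (i, q i)) js) x) < e" using q x by simp
    qed
  qed
  define near where "near p m f \<longleftrightarrow> f \<in> \<F> \<and> (\<forall>x\<in>K. dist (f x) (step p x) < 1 / real (Suc m))" for p m f
  define \<D> where "\<D> = (\<lambda>(p, m). SOME f. near p m f) ` {(p, m). \<exists>f. near p m f}"
  have N: "near p m (SOME f. near p m f)" if "\<exists>f. near p m f" for p m using that by (rule someI_ex)
  show ?thesis
  proof (rule that[of \<D>])
    show "countable \<D>" unfolding \<D>_def by (intro countable_image countableI_type)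
    show "\<D> \<subseteq> \<F>" using N by (auto simp: \<D>_def near_def)
    fix f and e :: real assume f: "f \<in> \<F>" and e: "e > 0"
    obtain m where m: "1 / real (Suc m) < e/2" using nat_approx_posE[OF half_gt_zero[OF e]] by metis
    obtain p where "\<forall>x\<in>K. dist (f x) (step p x) < 1 / real (Suc m)" using approx[OF f, of "1 / real (Suc m)"] by auto
    then have nf: "near p m f" using f by (simp add: near_def)
    define d where "d = (SOME f. near p m f)"
    have nd: "near p m d" unfolding d_def using nf by (rule someI[of "near p m"])
    have "(p, m) \<in> {(p, m). \<exists>f. near p m f}" using nf by blast
    then have "d \<in> \<D>" unfolding \<D>_def d_def by (rule rev_image_eqI) simp
    moreover have "dist (f x) (d x) < e" if "x \<in> K" for x
    proof -
      have "dist (f x) (step p x) < e/2" "dist (d x) (step p x) < e/2"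
        using nf nd m that unfolding near_def by fastforce+
      then show ?thesis using dist_triangle2[of "f x" "d x" "step p x"] by simp
    qed
    ultimately show "\<exists>d\<in>\<D>. \<forall>x\<in>K. dist (f x) (d x) < e" by blast
  qed
qed

section \<open>Isomorphism classes\<close>

lemma pointed_lhD:
  assumes "pointed_lh \<phi>"
  shows "continuous_on Dsk \<phi>" "\<phi> 0 = 0"
  using assms by (auto simp: pointed_lh_def)

text \<open>The homeomorphism preserves orientation automatically, because \<open>\<phi>\<close> and \<open>\<psi>\<close> do.\<close>
lemma iso_lh_iff:
  "iso_lh \<phi> \<psi> \<longleftrightarrow> pointed_lh \<phi> \<and> pointed_lh \<psi> \<and>
     (\<exists>h g. homeomorphism Dsk Dsk h g \<and> h 0 = 0 \<and> (\<forall>x\<in>Dsk. \<psi> x = \<phi> (g x)))"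
proof
  assume R: "pointed_lh \<phi> \<and> pointed_lh \<psi> \<and>
     (\<exists>h g. homeomorphism Dsk Dsk h g \<and> h 0 = 0 \<and> (\<forall>x\<in>Dsk. \<psi> x = \<phi> (g x)))"
  then obtain h g where h: "homeomorphism Dsk Dsk h g" "h 0 = 0" "\<forall>x\<in>Dsk. \<psi> x = \<phi> (g x)" by blast
  have "\<psi> (h x) = \<phi> x" if "x \<in> Dsk" for x
  proof -
    have "h x \<in> Dsk" "g (h x) = x" using h(1) that by (auto simp: homeomorphism_def)
    then show ?thesis using bspec[OF h(3), of "h x"] by simp
  qed
  then have "orient_pres Dsk h" using orient_pres_factor[OF _ _ h(1)] R by blast
  then show "iso_lh \<phi> \<psi>" using R h unfolding iso_lh_def disk_auto_def by blast
qed (auto simp: iso_lh_def disk_auto_def)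

lemma iso_pt_iff:
  "iso_pt (\<phi>, p) (\<psi>, q) \<longleftrightarrow> pointed_lh \<phi> \<and> pointed_lh \<psi> \<and> p \<in> Dsk \<and> q \<in> Dsk \<and>
     (\<exists>h g. homeomorphism Dsk Dsk h g \<and> h 0 = 0 \<and> (\<forall>x\<in>Dsk. \<psi> x = \<phi> (g x)) \<and> q = h p)"
proof
  assume R: "pointed_lh \<phi> \<and> pointed_lh \<psi> \<and> p \<in> Dsk \<and> q \<in> Dsk \<and>
     (\<exists>h g. homeomorphism Dsk Dsk h g \<and> h 0 = 0 \<and> (\<forall>x\<in>Dsk. \<psi> x = \<phi> (g x)) \<and> q = h p)"
  then obtain h g where h: "homeomorphism Dsk Dsk h g" "h 0 = 0" "\<forall>x\<in>Dsk. \<psi> x = \<phi> (g x)" "q = h p" by blast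
  have "\<psi> (h x) = \<phi> x" if "x \<in> Dsk" for x
  proof -
    have "h x \<in> Dsk" "g (h x) = x" using h(1) that by (auto simp: homeomorphism_def)
    then show ?thesis using bspec[OF h(3), of "h x"] by simp
  qed
  then have "orient_pres Dsk h" using orient_pres_factor[OF _ _ h(1)] R by blast
  then have "disk_auto h g" using h by (simp add: disk_auto_def)
  then show "iso_pt (\<phi>, p) (\<psi>, q)" using R h unfolding iso_pt_def fst_conv snd_conv
    by (intro conjI exI[of _ h] exI[of _ g]) simp_all
qed (auto simp: iso_pt_def disk_auto_def)

lemma iso_pt_refl: "pointed_lh \<phi> \<Longrightarrow> p \<in> Dsk \<Longrightarrow> iso_pt (\<phi>, p) (\<phi>, p)"
  unfolding iso_pt_iff by (intro conjI exI[of _ "\<lambda>x. x"]) (auto simp: homeomorphism_def)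

lemma iso_pt_sym: "iso_pt (\<phi>, p) (\<psi>, q) \<Longrightarrow> iso_pt (\<psi>, q) (\<phi>, p)"
  unfolding iso_pt_iff
proof (elim conjE exE, intro conjI)
  fix h g assume p: "p \<in> Dsk" and h: "homeomorphism Dsk Dsk h g" "h 0 = 0" "\<forall>x\<in>Dsk. \<psi> x = \<phi> (g x)" "q = h p"
  have gh: "g (h x) = x" "h x \<in> Dsk" if "x \<in> Dsk" for x using h(1) that by (auto simp: homeomorphism_def)
  show "\<exists>h g. homeomorphism Dsk Dsk h g \<and> h 0 = 0 \<and> (\<forall>x\<in>Dsk. \<phi> x = \<psi> (g x)) \<and> p = h q"
  proof (rule exI[of _ g], rule exI[of _ h], intro conjI ballI)
    show "homeomorphism Dsk Dsk g h" using h(1) homeomorphism_symD by blast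
    show "g 0 = 0" using gh(1)[of 0] h(2) by simp
    show "\<phi> x = \<psi> (h x)" if "x \<in> Dsk" for x using bspec[OF h(3) gh(2)[OF that]] gh(1)[OF that] by simp
    show "p = g q" using gh(1)[OF p] h(4) by simp
  qed
qed simp_all

lemma iso_pt_trans:
  assumes "iso_pt (\<phi>, p) (\<psi>, q)" "iso_pt (\<psi>, q) (\<xi>, r)"
  shows "iso_pt (\<phi>, p) (\<xi>, r)"
proof -
  obtain h g where h: "homeomorphism Dsk Dsk h g" "h 0 = 0" "\<forall>x\<in>Dsk. \<psi> x = \<phi> (g x)" "q = h p"
    using assms(1) unfolding iso_pt_iff by blast
  obtain h' g' where h': "homeomorphism Dsk Dsk h' g'" "h' 0 = 0" "\<forall>x\<in>Dsk. \<xi> x = \<psi> (g' x)" "r = h' q"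
    using assms(2) unfolding iso_pt_iff by blast
  have "homeomorphism Dsk Dsk (h' \<circ> h) (g \<circ> g')" using homeomorphism_compose[OF h(1) h'(1)] .
  moreover have "\<xi> x = \<phi> ((g \<circ> g') x)" if "x \<in> Dsk" for x
  proof -
    have "g' x \<in> Dsk" using h'(1) that by (auto simp: homeomorphism_def)
    then show ?thesis using bspec[OF h'(3) that] bspec[OF h(3)] by simp
  qed
  moreover have "(h' \<circ> h) 0 = 0" "r = (h' \<circ> h) p" using h(2,4) h'(2,4) by simp_all
  ultimately have "\<exists>h g. homeomorphism Dsk Dsk h g \<and> h 0 = 0 \<and> (\<forall>x\<in>Dsk. \<xi> x = \<phi> (g x)) \<and> r = h p" by blast
  then show ?thesis using assms unfolding iso_pt_iff by simp
qed

lemma iso_lh_iso_pt: "iso_lh \<phi> \<psi> \<longleftrightarrow> iso_pt (\<phi>, 0) (\<psi>, 0)"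
  unfolding iso_lh_iff iso_pt_iff by auto

lemma iso_lh_refl: "pointed_lh \<phi> \<Longrightarrow> iso_lh \<phi> \<phi>"
  by (simp add: iso_lh_iso_pt iso_pt_refl)

lemma iso_lh_sym: "iso_lh \<phi> \<psi> \<Longrightarrow> iso_lh \<psi> \<phi>"
  unfolding iso_lh_iso_pt by (rule iso_pt_sym)

lemma iso_lh_trans: "iso_lh \<phi> \<psi> \<Longrightarrow> iso_lh \<psi> \<xi> \<Longrightarrow> iso_lh \<phi> \<xi>"
  unfolding iso_lh_iso_pt by (rule iso_pt_trans)

definition surf :: "(complex \<Rightarrow> complex) \<Rightarrow> (complex \<Rightarrow> complex) set" where
  "surf \<phi> = {\<psi>. iso_lh \<phi> \<psi>}"

lemma surf_Mt: "pointed_lh \<phi> \<Longrightarrow> surf \<phi> \<in> Mt"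
  by (auto simp: surf_def Mt_def)

lemma Mt_cases:
  assumes "c \<in> Mt"
  obtains \<phi> where "pointed_lh \<phi>" "c = surf \<phi>"
  using assms by (auto simp: Mt_def surf_def)

lemma surf_eq: "iso_lh \<phi> \<psi> \<Longrightarrow> surf \<phi> = surf \<psi>"
  unfolding surf_def using iso_lh_trans iso_lh_sym by blast

lemma iso_lh_into:
  assumes "iso_lh \<phi> \<psi>"
  shows "\<exists>h. into \<phi> Dsk \<psi> Dsk h \<and> inj_on h Dsk"
proof -
  obtain h g where h: "homeomorphism Dsk Dsk h g" "h 0 = 0" "\<forall>x\<in>Dsk. \<psi> x = \<phi> (g x)"
    using assms unfolding iso_lh_iff by blast
  have gh: "g (h x) = x" "h x \<in> Dsk" if "x \<in> Dsk" for x using h(1) that by (auto simp: homeomorphism_def)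
  have "into \<phi> Dsk \<psi> Dsk h"
  proof (rule intoI)
    show "continuous_on Dsk h" using h(1) by (simp add: homeomorphism_def)
    show "\<psi> (h x) = \<phi> x" if "x \<in> Dsk" for x using bspec[OF h(3) gh(2)[OF that]] gh(1)[OF that] by simp
  qed (use gh h in auto)
  moreover have "inj_on h Dsk" by (rule inj_on_inverseI[where g=g]) (rule gh)
  ultimately show ?thesis by blast
qed

lemma into_post:
  assumes i: "into f X \<phi> Dsk \<iota>" and iso: "iso_lh \<phi> \<psi>"
  obtains h where "into f X \<psi> Dsk (\<lambda>x. h (\<iota> x))" "inj_on h Dsk" "into \<phi> Dsk \<psi> Dsk h"
  using iso_lh_into[OF iso] into_compose[OF i _ order_refl] by blast

lemma lifts_iso: "iso_lh \<phi> \<psi> \<Longrightarrow> lifts f X \<phi> \<longleftrightarrow> lifts f X \<psi>"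
  unfolding lifts_def immersion_into using into_post iso_lh_sym by metis

lemma embeds_iso_imp:
  assumes "iso_lh \<phi> \<psi>" "embeds f X \<phi>"
  shows "embeds f X \<psi>"
proof -
  obtain \<iota> where i: "into f X \<phi> Dsk \<iota>" "inj_on \<iota> X" using assms(2) by (auto simp: embeds_def embedding_def immersion_into)
  obtain h where h: "into f X \<psi> Dsk (\<lambda>x. h (\<iota> x))" "inj_on h Dsk" by (rule into_post[OF i(1) assms(1)])
  have "\<iota> ` X \<subseteq> Dsk" using intoD(2)[OF i(1)] by blast
  then have "inj_on (h \<circ> \<iota>) X" using i(2) h(2) by (intro comp_inj_on) (auto intro: inj_on_subset)
  then show ?thesis using h(1) unfolding embeds_def embedding_def immersion_into by (auto simp: o_def)
qed

lemma embeds_iso: "iso_lh \<phi> \<psi> \<Longrightarrow> embeds f X \<phi> \<longleftrightarrow> embeds f X \<psi>"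
  using embeds_iso_imp iso_lh_sym by blast

text \<open>Formed for arbitrary \<open>f\<close> and \<open>X\<close>, because the countable family
  consists of functions that need not be pointed local homeomorphisms.\<close>

definition Lset :: "(complex \<Rightarrow> complex) \<Rightarrow> complex set \<Rightarrow> (complex \<Rightarrow> complex) set set" where
  "Lset f X = {c \<in> Mt. \<exists>\<psi>\<in>c. lifts f X \<psi>}"

definition Nset :: "(complex \<Rightarrow> complex) \<Rightarrow> complex set \<Rightarrow> (complex \<Rightarrow> complex) set set" where
  "Nset f X = {c \<in> Mt. \<exists>\<psi>\<in>c. \<not> embeds f X \<psi>}"

lemma surf_Lset: "pointed_lh \<phi> \<Longrightarrow> surf \<phi> \<in> Lset f X \<longleftrightarrow> lifts f X \<phi>"
proof -
  assume \<phi>: "pointed_lh \<phi>"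
  have "(\<exists>\<psi>\<in>surf \<phi>. lifts f X \<psi>) \<longleftrightarrow> lifts f X \<phi>"
  proof
    assume "\<exists>\<psi>\<in>surf \<phi>. lifts f X \<psi>"
    then show "lifts f X \<phi>" using lifts_iso by (auto simp: surf_def)
  next
    assume a: "lifts f X \<phi>"
    have "\<phi> \<in> surf \<phi>" using iso_lh_refl[OF \<phi>] by (simp add: surf_def)
    with a show "\<exists>\<psi>\<in>surf \<phi>. lifts f X \<psi>" by (rule bexI)
  qed
  then show "surf \<phi> \<in> Lset f X \<longleftrightarrow> lifts f X \<phi>" using surf_Mt[OF \<phi>] by (simp add: Lset_def)
qed

lemma surf_Nset: "pointed_lh \<phi> \<Longrightarrow> surf \<phi> \<in> Nset f X \<longleftrightarrow> \<not> embeds f X \<phi>"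
proof -
  assume \<phi>: "pointed_lh \<phi>"
  have "(\<exists>\<psi>\<in>surf \<phi>. \<not> embeds f X \<psi>) \<longleftrightarrow> \<not> embeds f X \<phi>"
  proof
    assume "\<exists>\<psi>\<in>surf \<phi>. \<not> embeds f X \<psi>"
    then show "\<not> embeds f X \<phi>" using embeds_iso by (auto simp: surf_def)
  next
    assume a: "\<not> embeds f X \<phi>"
    have "\<phi> \<in> surf \<phi>" using iso_lh_refl[OF \<phi>] by (simp add: surf_def)
    with a show "\<exists>\<psi>\<in>surf \<phi>. \<not> embeds f X \<psi>" by (rule bexI)
  qed
  then show "surf \<phi> \<in> Nset f X \<longleftrightarrow> \<not> embeds f X \<phi>" using surf_Mt[OF \<phi>] by (simp add: Nset_def)
qed

lemma Lset_mono:
  assumes "\<And>\<psi>. pointed_lh \<psi> \<Longrightarrow> lifts f X \<psi> \<Longrightarrow> lifts g Y \<psi>"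
  shows "Lset f X \<subseteq> Lset g Y"
proof
  fix c assume "c \<in> Lset f X"
  moreover then obtain \<psi> where "pointed_lh \<psi>" "c = surf \<psi>" using Mt_cases by (auto simp: Lset_def)
  ultimately show "c \<in> Lset g Y" using surf_Lset assms by metis
qed

lemma Nset_mono:
  assumes "\<And>\<psi>. pointed_lh \<psi> \<Longrightarrow> embeds g Y \<psi> \<Longrightarrow> embeds f X \<psi>"
  shows "Nset f X \<subseteq> Nset g Y"
proof
  fix c assume "c \<in> Nset f X"
  moreover then obtain \<psi> where "pointed_lh \<psi>" "c = surf \<psi>" using Mt_cases by (auto simp: Nset_def)
  ultimately show "c \<in> Nset g Y" using surf_Nset assms by metis
qed

lemma Mt_subbasis_eq:
  "Mt_subbasis = {Lset \<phi> K | \<phi> K. pointed_lh \<phi> \<and> cdisk K} \<union> {Nset \<phi> U | \<phi> U. pointed_lh \<phi> \<and> odisk U}"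
  by (simp add: Mt_subbasis_def Lset_def Nset_def lifts_def embeds_def)

lemma topspace_Mt_top: "topspace Mt_top = Mt"
  unfolding Mt_top_def topology_generated_by_topspace Mt_subbasis_eq by (auto simp: Lset_def Nset_def)

lemma openin_Lset: "pointed_lh \<phi> \<Longrightarrow> cdisk K \<Longrightarrow> openin Mt_top (Lset \<phi> K)"
  unfolding Mt_top_def by (rule topology_generated_by_Basis) (auto simp: Mt_subbasis_eq)

lemma openin_Nset: "pointed_lh \<phi> \<Longrightarrow> odisk U \<Longrightarrow> openin Mt_top (Nset \<phi> U)"
  unfolding Mt_top_def by (rule topology_generated_by_Basis) (auto simp: Mt_subbasis_eq)

section \<open>Parametrised disks and their models\<close>

definition para :: "(complex \<Rightarrow> complex) \<Rightarrow> bool" where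
  "para k \<longleftrightarrow> continuous_on Dsk k \<and> inj_on k Dsk \<and> k ` Dsk \<subseteq> Dsk \<and> k 0 = 0"

text \<open>Pulling \<open>\<phi>\<close> back along a parametrised disk turns it into the unit
  disk, so that functions can be compared on one domain. As \<open>k\<close> may reverse
  orientation, a model is only known to be a local immersion.\<close>

definition models :: "(complex \<Rightarrow> complex) set" where
  "models = {(\<lambda>x. \<phi> (k x)) | \<phi> k. pointed_lh \<phi> \<and> para k}"

lemma paraD:
  assumes "para k"
  shows "continuous_on Dsk k" "inj_on k Dsk" "\<And>x. x \<in> Dsk \<Longrightarrow> k x \<in> Dsk" "k 0 = 0"
  using assms unfolding para_def by (simp_all add: image_subset_iff)

lemma para_id: "para (\<lambda>x. x)"
  by (auto simp: para_def)

lemma pointed_lh_models: "pointed_lh \<phi> \<Longrightarrow> \<phi> \<in> models"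
  unfolding models_def using para_id by (intro CollectI exI[of _ \<phi>] exI[of _ "\<lambda>x. x"]) simp

lemma para_open:
  assumes k: "para k" and X: "open X" "X \<subseteq> Dsk"
  shows "open (k ` X)"
  using paraD[OF k] X by (intro invariance_of_domain) (auto intro: continuous_on_subset inj_on_subset)

lemma para_homeomorphism:
  assumes k: "para k"
  obtains g where "homeomorphism Dsk (k ` Dsk) k g"
  using invariance_of_domain_homeomorphism[OF open_ball paraD(1)[OF k] _ paraD(2)[OF k]] by auto

lemma para_homeomorphic:
  assumes k: "para k" and X: "X \<subseteq> Dsk"
  shows "k ` X homeomorphic X"
proof -
  obtain g where g: "homeomorphism Dsk (k ` Dsk) k g" using para_homeomorphism[OF k] .
  then have "homeomorphism X (k ` X) k g" by (rule homeomorphism_of_subsets) (use X in auto)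
  then show ?thesis using homeomorphic_def homeomorphic_sym by metis
qed

lemma para_PC:
  assumes k: "para k" and X: "X \<subseteq> Dsk" "path_connected X" "0 \<in> X"
  shows "PC (k ` X)"
proof -
  have "path_connected (k ` X)"
    using X(2) continuous_on_subset[OF paraD(1)[OF k] X(1)] by (intro path_connected_continuous_image)
  moreover have "k 0 \<in> k ` X" using X(3) by (rule imageI)
  ultimately show ?thesis using paraD[OF k] X unfolding PC_def by auto
qed

lemma para_odisk:
  assumes k: "para k" and s: "0 < s" "s \<le> 1"
  shows "odisk (k ` ball 0 s)"
proof -
  have sub: "ball (0::complex) s \<subseteq> Dsk" using s by auto
  have "ball (0::complex) s homeomorphic Dsk" using s by (intro homeomorphic_balls) auto
  then show ?thesis unfolding odisk_def
    using para_PC[OF k sub] para_homeomorphic[OF k sub] s homeomorphic_trans by (auto simp: convex_imp_path_connected)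
qed

lemma para_cdisk:
  assumes k: "para k" and s: "0 < s" "s < 1"
  shows "cdisk (k ` cball 0 s)"
proof -
  have sub: "cball (0::complex) s \<subseteq> Dsk" using s by auto
  have "cball (0::complex) s homeomorphic cball (0::complex) 1" using s by (intro homeomorphic_balls) auto
  moreover have "0 \<in> interior (k ` cball 0 s)"
  proof (rule interiorI)
    show "open (k ` ball 0 s)" using s by (intro para_open[OF k]) auto
    have "k 0 \<in> k ` ball 0 s" using s by (intro imageI) simp
    then show "0 \<in> k ` ball 0 s" by (simp add: paraD(4)[OF k])
    show "k ` ball 0 s \<subseteq> k ` cball 0 s" by (intro image_mono) auto
  qed
  ultimately show ?thesis unfolding cdisk_def
    using para_PC[OF k sub] para_homeomorphic[OF k sub] s homeomorphic_trans by (auto simp: convex_imp_path_connected)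
qed

lemma para_into:
  assumes k: "para k" and X: "X \<subseteq> Dsk" and i: "into \<phi> (k ` X) \<psi> Dsk \<iota>"
  shows "into (\<lambda>x. \<phi> (k x)) X \<psi> Dsk (\<lambda>x. \<iota> (k x))"
proof (rule intoI)
  show "continuous_on X (\<lambda>x. \<iota> (k x))"
    by (rule continuous_on_compose2[OF intoD(1)[OF i] continuous_on_subset[OF paraD(1)[OF k] X]]) auto
qed (use intoD[OF i] paraD(4)[OF k] in auto)

lemma para_into_inverse:
  assumes k: "para k" and X: "X \<subseteq> Dsk" "0 \<in> X" and i: "into (\<lambda>x. \<phi> (k x)) X \<psi> Dsk \<iota>"
    and g: "homeomorphism Dsk (k ` Dsk) k g"
  shows "into \<phi> (k ` X) \<psi> Dsk (\<lambda>y. \<iota> (g y))"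
proof (rule intoI)
  have gk: "g (k x) = x" if "x \<in> X" for x using g X that by (auto simp: homeomorphism_def)
  show "continuous_on (k ` X) (\<lambda>y. \<iota> (g y))"
  proof (rule continuous_on_compose2[OF intoD(1)[OF i]])
    have "continuous_on (k ` Dsk) g" using g by (simp add: homeomorphism_def)
    then show "continuous_on (k ` X) g" by (rule continuous_on_subset) (use X in blast)
    show "g ` k ` X \<subseteq> X" using gk by auto
  qed
  show "\<iota> (g y) \<in> Dsk" "\<psi> (\<iota> (g y)) = \<phi> y" if "y \<in> k ` X" for y
    using intoD(2,4)[OF i] gk that by auto
  show "\<iota> (g 0) = 0" using gk[OF X(2)] paraD(4)[OF k] intoD(3)[OF i] by simp
qed

lemma lifts_para:
  assumes k: "para k" and X: "X \<subseteq> Dsk" "0 \<in> X"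
  shows "lifts \<phi> (k ` X) \<psi> \<longleftrightarrow> lifts (\<lambda>x. \<phi> (k x)) X \<psi>"
proof -
  obtain g where g: "homeomorphism Dsk (k ` Dsk) k g" using para_homeomorphism[OF k] .
  show ?thesis unfolding lifts_def immersion_into
    using para_into[OF k X(1)] para_into_inverse[OF k X _ g] by blast
qed

lemma embeds_para:
  assumes k: "para k" and X: "X \<subseteq> Dsk" "0 \<in> X"
  shows "embeds \<phi> (k ` X) \<psi> \<longleftrightarrow> embeds (\<lambda>x. \<phi> (k x)) X \<psi>"
proof -
  obtain g where g: "homeomorphism Dsk (k ` Dsk) k g" using para_homeomorphism[OF k] .
  have gk: "g (k x) = x" if "x \<in> X" for x using g X that by (auto simp: homeomorphism_def)
  have "inj_on (\<lambda>x. \<iota> (k x)) X" if "inj_on \<iota> (k ` X)" for \<iota> :: "complex \<Rightarrow> complex"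
    using comp_inj_on[OF inj_on_subset[OF paraD(2)[OF k] X(1)] that] by (simp add: o_def)
  moreover have "inj_on (\<lambda>y. \<iota> (g y)) (k ` X)" if "inj_on \<iota> X" for \<iota> :: "complex \<Rightarrow> complex"
    using that gk by (auto simp: inj_on_def)
  ultimately show ?thesis unfolding embeds_def embedding_def immersion_into
    using para_into[OF k X(1)] para_into_inverse[OF k X _ g] by blast
qed

lemma models_facts:
  assumes "c \<in> models"
  shows "local_imm Dsk c" "c 0 = 0"
proof -
  obtain \<phi> k where ck: "c = (\<lambda>x. \<phi> (k x))" "pointed_lh \<phi>" "para k" using assms by (auto simp: models_def)
  note k = paraD[OF ck(3)] and im = pointed_lh_local_imm[OF ck(2)]
  show "c 0 = 0" using ck k pointed_lhD(2)[OF ck(2)] by simp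
  show "local_imm Dsk c" unfolding local_imm_def
  proof (intro conjI ballI)
    show "continuous_on Dsk c" unfolding ck(1)
      by (rule continuous_on_compose2[OF pointed_lhD(1)[OF ck(2)] k(1)]) (use k(3) in auto)
    fix x assume x: "x \<in> Dsk"
    obtain e where e: "e > 0" "inj_on \<phi> (ball (k x) e)" using im k(3)[OF x] unfolding local_imm_def by blast
    have "open (Dsk \<inter> k -` ball (k x) e)" by (rule continuous_open_preimage[OF k(1)]) auto
    moreover have "x \<in> Dsk \<inter> k -` ball (k x) e" using x e(1) by simp
    ultimately obtain d where d: "d > 0" "ball x d \<subseteq> Dsk \<inter> k -` ball (k x) e" using open_contains_ball by blast
    have "inj_on (\<phi> \<circ> k) (ball x d)"
    proof (rule comp_inj_on)
      show "inj_on k (ball x d)" using inj_on_subset[OF k(2)] d(2) by blast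
      show "inj_on \<phi> (k ` ball x d)" using inj_on_subset[OF e(2)] d(2) by blast
    qed
    then show "\<exists>e>0. ball x e \<subseteq> Dsk \<and> inj_on c (ball x e)"
      using d unfolding ck(1) o_def by blast
  qed simp
qed

text \<open>Pushing balls forward by \<open>k\<close> leads back to subbasic sets given by a pointed
  local homeomorphism, whatever \<open>k\<close> does to the orientation.\<close>

lemma models_openin:
  assumes "c \<in> models" "0 < s" "s < 1"
  shows "openin Mt_top (Lset c (cball 0 s))" "openin Mt_top (Nset c (ball 0 s))"
proof -
  obtain \<phi> k where ck: "c = (\<lambda>x. \<phi> (k x))" "pointed_lh \<phi>" "para k" using assms(1) by (auto simp: models_def)
  have sub: "cball (0::complex) s \<subseteq> Dsk" "ball (0::complex) s \<subseteq> Dsk" and o: "(0::complex) \<in> cball 0 s" "(0::complex) \<in> ball 0 s"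
    using assms(2,3) by auto
  have "Lset c (cball 0 s) = Lset \<phi> (k ` cball 0 s)"
    unfolding Lset_def ck(1) using lifts_para[OF ck(3) sub(1) o(1)] by simp
  then show "openin Mt_top (Lset c (cball 0 s))" using openin_Lset[OF ck(2) para_cdisk[OF ck(3) assms(2,3)]] by simp
  have "Nset c (ball 0 s) = Nset \<phi> (k ` ball 0 s)"
    unfolding Nset_def ck(1) using embeds_para[OF ck(3) sub(2) o(2)] by simp
  then show "openin Mt_top (Nset c (ball 0 s))" using openin_Nset[OF ck(2) para_odisk[OF ck(3)]] assms by simp
qed

text \<open>A homeomorphism of the unit disk onto \<open>U\<close> need not fix 0; it is corrected
  by a holomorphic automorphism \<open>b\<close> that sends 0 to the preimage of 0.\<close>

lemma odisk_para:
  assumes "odisk U"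
  obtains k where "para k" "k ` Dsk = U"
proof -
  have U: "U \<subseteq> Dsk" "0 \<in> U" "U homeomorphic Dsk" using assms by (auto simp: odisk_def PC_def)
  then obtain f g where "homeomorphism Dsk U f g" using homeomorphic_sym homeomorphic_def by metis
  then have f: "continuous_on Dsk f" "f ` Dsk = U" "\<And>x. x \<in> Dsk \<Longrightarrow> g (f x) = x" "g 0 \<in> Dsk" "f (g 0) = 0"
    using U(2) by (auto simp: homeomorphism_def)
  obtain a b where ab: "a (g 0) = 0" "b holomorphic_on Dsk" "a ` Dsk \<subseteq> Dsk" "b ` Dsk \<subseteq> Dsk"
    "\<And>z. z \<in> Dsk \<Longrightarrow> a (b z) = z" "\<And>z. z \<in> Dsk \<Longrightarrow> b (a z) = z"
    using ball_biholomorphism_exists[OF f(4)] by metis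
  have bD: "b x \<in> Dsk" if "x \<in> Dsk" for x using ab(4) that by blast
  have "para (\<lambda>x. f (b x))" unfolding para_def
  proof (intro conjI)
    show "continuous_on Dsk (\<lambda>x. f (b x))"
      by (rule continuous_on_compose2[OF f(1) holomorphic_on_imp_continuous_on[OF ab(2)] ab(4)])
    show "inj_on (\<lambda>x. f (b x)) Dsk"
      by (rule inj_on_inverseI[where g="\<lambda>y. a (g y)"]) (simp only: f(3)[OF bD] ab(5))
    show "(\<lambda>x. f (b x)) ` Dsk \<subseteq> Dsk" using bD f(2) U(1) by blast
    show "f (b 0) = 0" using ab(6)[OF f(4)] ab(1) f(5) by simp
  qed
  moreover have "(\<lambda>x. f (b x)) ` Dsk = U"
  proof
    show "(\<lambda>x. f (b x)) ` Dsk \<subseteq> U" using bD f(2) by blast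
    show "U \<subseteq> (\<lambda>x. f (b x)) ` Dsk"
    proof
      fix u assume "u \<in> U"
      then obtain z where z: "z \<in> Dsk" "u = f z" using f(2) by blast
      have "a z \<in> Dsk" using ab(3) z(1) by blast
      moreover have "u = f (b (a z))" using z ab(6)[OF z(1)] by simp
      ultimately show "u \<in> (\<lambda>x. f (b x)) ` Dsk" by blast
    qed
  qed
  ultimately show ?thesis by (rule that)
qed

section \<open>The topology of the moduli space\<close>

text \<open>The radii serve a chain of approximate inclusions: \<open>\<phi>\<close> on
  \<open>t\<close> into \<open>c\<close> on \<open>s\<close>, back into \<open>\<phi>\<close> on
  \<open>t'\<close>, and again into \<open>c\<close> on \<open>s'\<close>; consecutive compositions
  yield injectivity. The bound \<open>min r \<eta>\<close> permits lifting both ways,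
  \<open>r\<close> through the branches of \<open>c\<close> and \<open>\<eta>\<close> through those
  of \<open>\<phi>\<close>. Rational radii keep the conditions countable.\<close>

definition dense_models :: "(complex \<Rightarrow> complex) set \<Rightarrow> bool" where
  "dense_models \<C> \<longleftrightarrow> countable \<C> \<and> \<C> \<subseteq> models \<and>
     (\<forall>\<phi>\<in>models. \<forall>t\<in>\<rat>. \<forall>s\<in>\<rat>. \<forall>t'\<in>\<rat>. \<forall>s'\<in>\<rat>. \<forall>\<eta>>0. t < s \<and> s < t' \<and> t' < s' \<and> s' < 1 \<longrightarrow>
       (\<exists>c\<in>\<C>. \<exists>r>0. (\<forall>x\<in>cball 0 t. thick (ball 0 s) c x r) \<and> (\<forall>x\<in>cball 0 t'. thick (ball 0 s') c x r) \<and>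
          (\<forall>x\<in>cball 0 s'. dist (\<phi> x) (c x) < min r \<eta>)))"

text \<open>The inverse branches of the approximating function must exist on disks whose radius exceeds the
  distance to the approximated one; so the models are split into countably many classes
  with a uniform radius \<open>1 / Suc n\<close>, and a dense sequence is taken in each of them.\<close>
lemma dense_models_exist: "\<exists>\<C>. dense_models \<C>"
proof -
  define fam where "fam = (\<lambda>(t, s, t', s', n). {c \<in> models.
    (\<forall>x\<in>cball 0 (of_rat t). thick (ball 0 (of_rat s)) c x (1 / real (Suc n))) \<and>
    (\<forall>x\<in>cball 0 (of_rat t'). thick (ball 0 (of_rat s')) c x (1 / real (Suc n)))})"
  define rad :: "rat \<times> rat \<times> rat \<times> rat \<times> nat \<Rightarrow> real" where "rad = (\<lambda>(t, s, t', s', n). of_rat s')"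
  have "\<exists>D. countable D \<and> D \<subseteq> fam \<tau> \<and> (rad \<tau> < 1 \<longrightarrow> (\<forall>f\<in>fam \<tau>. \<forall>e>0. \<exists>d\<in>D. \<forall>x\<in>cball 0 (rad \<tau>). dist (f x) (d x) < e))" for \<tau>
  proof (cases "rad \<tau> < 1")
    case True
    have sub: "cball 0 (rad \<tau>) \<subseteq> Dsk" using True by auto
    have "continuous_on (cball 0 (rad \<tau>)) f" if "f \<in> fam \<tau>" for f
    proof -
      have "f \<in> models" using that by (auto simp: fam_def split: prod.splits)
      then show ?thesis using models_facts(1) sub by (auto simp: local_imm_def intro: continuous_on_subset)
    qed
    then obtain D where "countable D" "D \<subseteq> fam \<tau>" "\<And>f e. f \<in> fam \<tau> \<Longrightarrow> e > 0 \<Longrightarrow> \<exists>d\<in>D. \<forall>x\<in>cball 0 (rad \<tau>). dist (f x) (d x) < e"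
      using countable_uniformly_dense[OF compact_cball, of "fam \<tau>" 0 "rad \<tau>"] by metis
    then show ?thesis by (intro exI[of _ D]) blast
  next
    case False
    then show ?thesis by (intro exI[of _ "{}"]) auto
  qed
  then have "\<forall>\<tau>. \<exists>D. countable D \<and> D \<subseteq> fam \<tau> \<and> (rad \<tau> < 1 \<longrightarrow> (\<forall>f\<in>fam \<tau>. \<forall>e>0. \<exists>d\<in>D. \<forall>x\<in>cball 0 (rad \<tau>). dist (f x) (d x) < e))"
    by (rule allI)
  then obtain D where D: "\<forall>\<tau>. countable (D \<tau>) \<and> D \<tau> \<subseteq> fam \<tau> \<and> (rad \<tau> < 1 \<longrightarrow> (\<forall>f\<in>fam \<tau>. \<forall>e>0. \<exists>d\<in>D \<tau>. \<forall>x\<in>cball 0 (rad \<tau>). dist (f x) (d x) < e))"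
    by (rule choice[THEN exE])
  have "dense_models (\<Union>\<tau>. D \<tau>)" unfolding dense_models_def
  proof (intro conjI ballI allI impI)
    show "countable (\<Union>\<tau>. D \<tau>)" using D by (intro countable_UN countableI_type) blast
    show "(\<Union>\<tau>. D \<tau>) \<subseteq> models"
    proof
      fix c assume "c \<in> (\<Union>\<tau>. D \<tau>)"
      then obtain \<tau> where "c \<in> fam \<tau>" using D by blast
      then show "c \<in> models" by (auto simp: fam_def split: prod.splits)
    qed
    fix \<phi> and t s t' s' \<eta> :: real
    assume \<phi>: "\<phi> \<in> models" and Q: "t \<in> \<rat>" "s \<in> \<rat>" "t' \<in> \<rat>" "s' \<in> \<rat>" and \<eta>: "0 < \<eta>"
      and lt: "t < s \<and> s < t' \<and> t' < s' \<and> s' < 1"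
    have im: "local_imm (ball 0 s) \<phi>" "local_imm (ball 0 s') \<phi>"
      by (rule local_imm_subset[OF models_facts(1)[OF \<phi>]]; use lt in auto)+
    have sub: "cball (0::complex) t \<subseteq> ball 0 s" "cball (0::complex) t' \<subseteq> ball 0 s'" using lt by auto
    obtain r1 where r1: "r1 > 0" "\<And>x. x \<in> cball 0 t \<Longrightarrow> thick (ball 0 s) \<phi> x r1"
      by (rule compact_thick[OF im(1) compact_cball sub(1)]) blast
    obtain r2 where r2: "r2 > 0" "\<And>x. x \<in> cball 0 t' \<Longrightarrow> thick (ball 0 s') \<phi> x r2"
      by (rule compact_thick[OF im(2) compact_cball sub(2)]) blast
    have "min r1 r2 > 0" using r1 r2 by simp
    then obtain n where n: "1 / real (Suc n) < min r1 r2" by (rule nat_approx_posE)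
    obtain a b a' b' where ab: "t = of_rat a" "s = of_rat b" "t' = of_rat a'" "s' = of_rat b'" using Q by (auto elim!: Rats_cases)
    let ?\<tau> = "(a, b, a', b', n)"
    have "\<phi> \<in> fam ?\<tau>" unfolding fam_def prod.case ab[symmetric]
    proof (intro CollectI conjI ballI \<phi>)
      show "thick (ball 0 s) \<phi> x (1 / real (Suc n))" if "x \<in> cball 0 t" for x
        by (rule thick_mono[OF r1(2)[OF that]]) (use n in auto)
      show "thick (ball 0 s') \<phi> x (1 / real (Suc n))" if "x \<in> cball 0 t'" for x
        by (rule thick_mono[OF r2(2)[OF that]]) (use n in auto)
    qed
    moreover have "rad ?\<tau> = s'" by (simp add: rad_def ab)
    moreover have "min (1 / real (Suc n)) \<eta> > 0" using \<eta> by simp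
    ultimately obtain c where c: "c \<in> D ?\<tau>" "\<forall>x\<in>cball 0 s'. dist (\<phi> x) (c x) < min (1 / real (Suc n)) \<eta>"
      using spec[OF D, of ?\<tau>] lt by metis
    then have "c \<in> fam ?\<tau>" using D by blast
    then have "\<forall>x\<in>cball 0 t. thick (ball 0 s) c x (1 / real (Suc n))" "\<forall>x\<in>cball 0 t'. thick (ball 0 s') c x (1 / real (Suc n))"
      unfolding fam_def ab by simp_all
    then show "\<exists>c\<in>\<Union>\<tau>. D \<tau>. \<exists>r>0. (\<forall>x\<in>cball 0 t. thick (ball 0 s) c x r) \<and> (\<forall>x\<in>cball 0 t'. thick (ball 0 s') c x r) \<and>
          (\<forall>x\<in>cball 0 s'. dist (\<phi> x) (c x) < min r \<eta>)"
      using c(2) UN_I[of ?\<tau> UNIV c D, OF UNIV_I c(1)] by (intro bexI[of _ c] exI[of _ "1 / real (Suc n)"]) auto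
  qed
  then show ?thesis by blast
qed

text \<open>\<open>\<iota>\<close> is already nearly a lift through \<open>c\<close>; it can be
  perturbed to an exact one when the branches of \<open>c\<close> have a radius exceeding the
  distance from \<open>\<phi>\<close>.\<close>

lemma into_near:
  assumes c: "c \<in> models" and \<phi>: "\<phi> \<in> models" and X: "0 \<in> X" and i: "into f X \<phi> Dsk \<iota>" and S: "open S" "S \<subseteq> Dsk"
    and near: "\<And>x. x \<in> X \<Longrightarrow> \<iota> x \<in> S \<and> thick S c (\<iota> x) r \<and> dist (\<phi> (\<iota> x)) (c (\<iota> x)) < r"
  obtains q where "into f X c S q"
proof (rule into_perturb[of S c X \<iota> r f])
  show "local_imm S c" by (rule local_imm_subset[OF models_facts(1)[OF c] S])
  have "continuous_on X (\<lambda>x. \<phi> (\<iota> x))"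
    by (rule continuous_on_compose2[of Dsk \<phi>])
      (use models_facts(1)[OF \<phi>] i in \<open>auto simp: local_imm_def into_def\<close>)
  then show "continuous_on X f" by (rule continuous_on_eq) (rule intoD(4)[OF i])
  show "f 0 = c 0" using intoD(3,4)[OF i] X models_facts(2)[OF c] models_facts(2)[OF \<phi>] by metis
  show "dist (c (\<iota> x)) (f x) < r" if "x \<in> X" for x
    using near[OF that] intoD(4)[OF i that] by (simp add: dist_commute)
qed (use intoD[OF i] X near that in auto)

lemma rationals_between:
  assumes "(r::real) < 1"
  obtains t s t' s' where "t \<in> \<rat>" "s \<in> \<rat>" "t' \<in> \<rat>" "s' \<in> \<rat>" "r < t" "t < s" "s < t'" "t' < s'" "s' < 1"
proof -
  obtain t where t: "t \<in> \<rat>" "r < t" "t < 1" using Rats_dense_in_real[OF assms] by blast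
  obtain s where s: "s \<in> \<rat>" "t < s" "s < 1" using Rats_dense_in_real[OF t(3)] by blast
  obtain t' where t': "t' \<in> \<rat>" "s < t'" "t' < 1" using Rats_dense_in_real[OF s(3)] by blast
  obtain s' where "s' \<in> \<rat>" "t' < s'" "s' < 1" using Rats_dense_in_real[OF t'(3)] by blast
  then show ?thesis using that t s t' by blast
qed

text \<open>The compact image leaves room for concentric radii. Perturbing \<open>\<iota>\<close>
  gives a map into \<open>c\<close>, and perturbing the inclusion of \<open>cball 0 s\<close> gives
  a map from \<open>c\<close> into \<open>\<psi>\<close>. The radius \<open>\<eta>\<close> of
  \<open>\<psi>\<close> is fixed before \<open>c\<close>, while \<open>\<rho>\<close> comes with
  \<open>c\<close>; the distance is below both.\<close>

lemma immersion_through_dense_model: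
  assumes \<C>: "dense_models \<C>" and \<psi>: "\<psi> \<in> models" and i: "into f K \<psi> Dsk \<iota>" and K: "compact K" "0 \<in> K"
  obtains c s q where "c \<in> \<C>" "s \<in> \<rat>" "0 < s" "s < 1" "into f K c (ball 0 s) q" "lifts c (cball 0 s) \<psi>"
proof -
  have "compact (\<iota> ` K)" using intoD(1)[OF i] K(1) by (rule compact_continuous_image)
  moreover have "\<iota> ` K \<subseteq> ball 0 1" using intoD(2)[OF i] by blast
  ultimately obtain r where r: "0 < r" "r < 1" "\<iota> ` K \<subseteq> ball 0 r" by (rule compact_subset_ball_shrink) simp
  obtain t s t' s' where Q: "t \<in> \<rat>" "s \<in> \<rat>" "t' \<in> \<rat>" "s' \<in> \<rat>" and lt: "r < t" "t < s" "s < t'" "t' < s'" "s' < 1"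
    using rationals_between[OF r(2)] .
  have im: "local_imm Dsk \<psi>" by (rule models_facts(1)[OF \<psi>])
  have sub: "cball (0::complex) s \<subseteq> Dsk" using lt by auto
  obtain \<eta> where \<eta>: "\<eta> > 0" "\<And>x. x \<in> cball 0 s \<Longrightarrow> thick Dsk \<psi> x \<eta>"
    by (rule compact_thick[OF im compact_cball sub]) blast
  obtain c \<rho> where c: "c \<in> \<C>" "\<rho> > 0" "\<forall>x\<in>cball 0 t. thick (ball 0 s) c x \<rho>"
    "\<forall>x\<in>cball 0 s'. dist (\<psi> x) (c x) < min \<rho> \<eta>"
    using \<C> \<psi> Q \<eta>(1) lt unfolding dense_models_def by metis
  have cm: "c \<in> models" using \<C> c(1) by (auto simp: dense_models_def)
  obtain q where q: "into f K c (ball 0 s) q"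
  proof (rule into_near[OF cm \<psi> K(2) i, of "ball 0 s" \<rho>])
    fix x assume "x \<in> K"
    then have "\<iota> x \<in> ball 0 r" using r(3) by blast
    then have "\<iota> x \<in> ball 0 s" "\<iota> x \<in> cball 0 t" "\<iota> x \<in> cball 0 s'" using lt by auto
    then show "\<iota> x \<in> ball 0 s \<and> thick (ball 0 s) c (\<iota> x) \<rho> \<and> dist (\<psi> (\<iota> x)) (c (\<iota> x)) < \<rho>"
      using c(3,4) by simp
  qed (use lt in auto)
  obtain j where "into c (cball 0 s) \<psi> Dsk j"
  proof (rule into_near[OF \<psi> cm, of "cball 0 s" c "\<lambda>x. x" Dsk \<eta>])
    show "into c (cball 0 s) c Dsk (\<lambda>x. x)" by (rule into_id[OF sub])
    fix x assume "x \<in> cball (0::complex) s"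
    then show "x \<in> Dsk \<and> thick Dsk \<psi> x \<eta> \<and> dist (c x) (\<psi> x) < \<eta>"
      using \<eta>(2) c(4) lt by (auto simp: dist_commute)
  qed (use lt r in auto)
  then have "lifts c (cball 0 s) \<psi>" by (auto simp: lifts_def immersion_into)
  then show ?thesis using that c(1) Q(2) q lt r(1) by simp
qed

text \<open>After shrinking the disk, \<open>c\<close> on \<open>ball 0 s\<close> is caught between
  two disks of \<open>f\<close>: the smaller does not embed in \<open>\<psi>\<close>, and the larger
  embeds wherever \<open>f\<close> does.\<close>

lemma obstruction_through_dense_model:
  assumes \<C>: "dense_models \<C>" and f: "f \<in> models" and \<psi>: "local_imm Dsk \<psi>" and n: "\<not> embeds f Dsk \<psi>"
  obtains c s where "c \<in> \<C>" "s \<in> \<rat>" "0 < s" "s < 1" "\<not> embeds c (ball 0 s) \<psi>"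
    "\<And>\<xi>. embeds f Dsk \<xi> \<Longrightarrow> embeds c (ball 0 s) \<xi>"
proof -
  obtain r where r: "0 < r" "r < 1" "\<not> embeds f (ball 0 r) \<psi>" using not_embeds_ball[OF \<psi> n] by blast
  obtain t s t' s' where Q: "t \<in> \<rat>" "s \<in> \<rat>" "t' \<in> \<rat>" "s' \<in> \<rat>" and lt: "r < t" "t < s" "s < t'" "t' < s'" "s' < 1"
    using rationals_between[OF r(2)] .
  have im: "local_imm Dsk f" by (rule models_facts(1)[OF f])
  have t'im: "local_imm (ball 0 t') f" by (rule local_imm_subset[OF im]) (use lt in auto)
  have sub: "cball (0::complex) s \<subseteq> ball 0 t'" using lt by auto
  obtain \<eta> where \<eta>: "\<eta> > 0" "\<And>x. x \<in> cball 0 s \<Longrightarrow> thick (ball 0 t') f x \<eta>"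
    by (rule compact_thick[OF t'im compact_cball sub]) blast
  obtain c \<rho> where c: "c \<in> \<C>" "\<rho> > 0" "\<forall>x\<in>cball 0 t. thick (ball 0 s) c x \<rho>" "\<forall>x\<in>cball 0 t'. thick (ball 0 s') c x \<rho>"
    "\<forall>x\<in>cball 0 s'. dist (f x) (c x) < min \<rho> \<eta>"
    using \<C> f Q \<eta>(1) lt unfolding dense_models_def by metis
  have cm: "c \<in> models" using \<C> c(1) by (auto simp: dense_models_def)
  have o: "open (ball (0::complex) s)" "open (ball (0::complex) t')" "open (ball (0::complex) s')" by simp_all
  have D: "ball (0::complex) s \<subseteq> Dsk" "ball (0::complex) t' \<subseteq> Dsk" "ball (0::complex) s' \<subseteq> Dsk"
    "ball (0::complex) t \<subseteq> Dsk" using lt by auto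
  have z: "(0::complex) \<in> ball 0 t" "(0::complex) \<in> ball 0 s" "(0::complex) \<in> ball 0 t'" using lt r by auto
  have dis: "dist (f x) (c x) < \<rho>" "dist (c x) (f x) < \<eta>" if "norm x \<le> s'" for x
    using bspec[OF c(5), of x] that by (simp_all add: dist_commute)
  obtain q1 where q1: "into f (ball 0 t) c (ball 0 s) q1"
  proof (rule into_near[OF cm f z(1) into_id[OF D(4)] o(1) D(1), of \<rho>])
    fix x assume "x \<in> ball (0::complex) t"
    then show "x \<in> ball 0 s \<and> thick (ball 0 s) c x \<rho> \<and> dist (f x) (c x) < \<rho>" using c(3) dis lt by auto
  qed
  obtain q2 where q2: "into c (ball 0 s) f (ball 0 t') q2"
  proof (rule into_near[OF f cm z(2) into_id[OF D(1)] o(2) D(2), of \<eta>])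
    fix x assume "x \<in> ball (0::complex) s"
    then show "x \<in> ball 0 t' \<and> thick (ball 0 t') f x \<eta> \<and> dist (c x) (f x) < \<eta>" using \<eta>(2) dis lt by auto
  qed
  obtain q3 where q3: "into f (ball 0 t') c (ball 0 s') q3"
  proof (rule into_near[OF cm f z(3) into_id[OF D(2)] o(3) D(3), of \<rho>])
    fix x assume "x \<in> ball (0::complex) t'"
    then show "x \<in> ball 0 s' \<and> thick (ball 0 s') c x \<rho> \<and> dist (f x) (c x) < \<rho>" using c(4) dis lt by auto
  qed
  \<comment> \<open>\<open>q2\<close> after \<open>q1\<close> and \<open>q3\<close> after
    \<open>q2\<close> are pointed lifts of a function through itself, hence inclusions;
    \<open>q3\<close> is constructed to make \<open>q2\<close> injective.\<close>
  have inj1: "inj_on q1 (ball 0 t)"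
    by (rule into_retract_inj[OF im _ z(1) D(4) q1 into_mono[OF q2 order_refl D(2)]]) simp_all
  have inj2: "inj_on q2 (ball 0 s)"
    by (rule into_retract_inj[OF models_facts(1)[OF cm] _ z(2) D(1) q2 into_mono[OF q3 order_refl D(3)]]) simp_all
  have "\<not> embeds c (ball 0 s) \<psi>"
  proof
    assume "embeds c (ball 0 s) \<psi>"
    then have "embeds f (ball 0 t) \<psi>" by (rule embeds_compose[OF q1 inj1 order_refl])
    then have "embeds f (ball 0 r) \<psi>" by (rule embeds_subset) (use lt in auto)
    then show False using r(3) by simp
  qed
  moreover have "embeds c (ball 0 s) \<xi>" if "embeds f Dsk \<xi>" for \<xi>
    by (rule embeds_compose[OF q2 inj2 D(2) that])
  ultimately show ?thesis using that c(1) Q(2) lt r(1) by simp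
qed

lemma second_countable_Mt_top: "second_countable Mt_top"
proof -
  obtain \<C> where \<C>: "dense_models \<C>" using dense_models_exist by blast
  then have cC: "countable \<C>" "\<C> \<subseteq> models" by (auto simp: dense_models_def)
  define I where "I = \<C> \<times> (\<rat> \<inter> {0<..<1::real})"
  define \<S> where "\<S> = (\<lambda>(c, s). Lset c (cball 0 s)) ` I \<union> (\<lambda>(c, s). Nset c (ball 0 s)) ` I"
  have "countable I" unfolding I_def using cC(1) countable_rat by (intro countable_SIGMA) (auto intro: countable_subset)
  then have "countable \<S>" unfolding \<S>_def by (intro countable_Un countable_image)
  moreover have "openin Mt_top u" if "u \<in> \<S>" for u
    using that cC(2) models_openin by (auto simp: \<S>_def I_def)
  moreover have "b = \<Union>(insert Mt Mt_subbasis) \<or> (\<exists>u\<in>\<S>. x \<in> u \<and> u \<subseteq> b)"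
    if b: "b \<in> insert Mt Mt_subbasis" and x: "x \<in> b" for b x
  proof -
    have "b = Mt \<or> (\<exists>\<phi> K. b = Lset \<phi> K \<and> pointed_lh \<phi> \<and> cdisk K) \<or> (\<exists>\<phi> U. b = Nset \<phi> U \<and> pointed_lh \<phi> \<and> odisk U)"
      using b unfolding Mt_subbasis_eq by blast
    then show ?thesis
    proof (elim disjE exE conjE)
      assume "b = Mt"
      moreover have "\<Union>(insert Mt Mt_subbasis) = Mt"
        using topspace_Mt_top unfolding Mt_top_def topology_generated_by_topspace .
      ultimately show ?thesis by simp
    next
      fix \<phi> K assume bl: "b = Lset \<phi> K" "pointed_lh \<phi>" "cdisk K"
      have "x \<in> Mt" using x bl(1) by (simp add: Lset_def)
      then obtain \<psi> where \<psi>: "pointed_lh \<psi>" "x = surf \<psi>" by (rule Mt_cases)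
      have "lifts \<phi> K \<psi>" using x \<psi> surf_Lset bl(1) by simp
      then obtain \<iota> where i: "into \<phi> K \<psi> Dsk \<iota>" by (auto simp: lifts_def immersion_into)
      have K: "compact K" "0 \<in> K"
        using bl(3) homeomorphic_compactness compact_cball unfolding cdisk_def PC_def by blast+
      obtain c s q where c: "c \<in> \<C>" "s \<in> \<rat>" "0 < s" "s < 1" "into \<phi> K c (ball 0 s) q" "lifts c (cball 0 s) \<psi>"
        by (rule immersion_through_dense_model[OF \<C> pointed_lh_models[OF \<psi>(1)] i K])
      have "Lset c (cball 0 s) \<subseteq> b" unfolding bl(1)
        by (rule Lset_mono, rule lifts_compose[OF c(5) ball_subset_cball])
      moreover have "x \<in> Lset c (cball 0 s)" using c(6) \<psi> surf_Lset by simp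
      moreover have "(c, s) \<in> I" using c by (simp add: I_def)
      then have "Lset c (cball 0 s) \<in> \<S>" unfolding \<S>_def by (intro UnI1 rev_image_eqI[of "(c, s)"]) simp_all
      ultimately show ?thesis by blast
    next
      fix \<phi> U assume bl: "b = Nset \<phi> U" "pointed_lh \<phi>" "odisk U"
      have "x \<in> Mt" using x bl(1) by (simp add: Nset_def)
      then obtain \<psi> where \<psi>: "pointed_lh \<psi>" "x = surf \<psi>" by (rule Mt_cases)
      obtain k where k: "para k" "k ` Dsk = U" using odisk_para[OF bl(3)] .
      let ?f = "\<lambda>x. \<phi> (k x)"
      have f: "?f \<in> models" using bl(2) k(1) unfolding models_def by blast
      have eq: "embeds \<phi> U \<xi> \<longleftrightarrow> embeds ?f Dsk \<xi>" for \<xi>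
        using embeds_para[OF k(1) order_refl, of \<phi> \<xi>] k(2) by simp
      have "\<not> embeds ?f Dsk \<psi>" using x \<psi> surf_Nset bl(1) eq by simp
      then obtain c s where c: "c \<in> \<C>" "s \<in> \<rat>" "0 < s" "s < 1" "\<not> embeds c (ball 0 s) \<psi>"
        and cx: "\<And>\<xi>. embeds ?f Dsk \<xi> \<Longrightarrow> embeds c (ball 0 s) \<xi>"
        using obstruction_through_dense_model[OF \<C> f pointed_lh_local_imm[OF \<psi>(1)]] by metis
      have "Nset c (ball 0 s) \<subseteq> b" unfolding bl(1)
        by (rule Nset_mono) (simp add: eq cx)
      moreover have "x \<in> Nset c (ball 0 s)" using c(5) \<psi> surf_Nset by simp
      moreover have "(c, s) \<in> I" using c by (simp add: I_def)
      then have "Nset c (ball 0 s) \<in> \<S>" unfolding \<S>_def by (intro UnI2 rev_image_eqI[of "(c, s)"]) simp_all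
      ultimately show ?thesis by blast
    qed
  qed
  ultimately show ?thesis unfolding Mt_top_def by (rule second_countable_topology_generated_by)
qed

section \<open>Separation of points in the moduli space\<close>

lemma openin_embeds_nhd:
  assumes \<phi>: "pointed_lh \<phi>" and t: "0 < t" "t < 1"
  obtains W where "openin Mt_top W" "surf \<phi> \<in> W"
    "\<And>\<psi>. pointed_lh \<psi> \<Longrightarrow> surf \<psi> \<in> W \<Longrightarrow> embeds \<phi> (cball 0 t) \<psi>"
proof -
  define t1 where "t1 = (1 + t) / 2"
  have t1: "t < t1" "t1 < 1" "0 < t1" using t by (auto simp: t1_def)
  obtain \<U> where U: "finite \<U>"
    "\<And>\<psi> U. (\<psi>, U) \<in> \<U> \<Longrightarrow> pointed_lh \<psi> \<and> odisk U \<and> (\<nexists>e. immersion \<psi> U \<phi> e)"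
    "\<And>\<psi> \<iota>. pointed_lh \<psi> \<Longrightarrow> immersion \<phi> (ball 0 t1) \<psi> \<iota> \<Longrightarrow>
       inj_on \<iota> (cball 0 t) \<or> (\<exists>(\<psi>0, U)\<in>\<U>. \<exists>e. embedding \<psi>0 U \<psi> e)"
    by (rule immersions_injective_or_obstructed[OF \<phi> t1(1,2)]) blast
  \<comment> \<open>Immersing the larger disk is an open condition, and excluding the finitely many
    obstructions makes the immersion injective on \<open>cball 0 t\<close>. No obstruction immerses
    in \<open>\<phi>\<close>, so \<open>surf \<phi>\<close> lies in \<open>W\<close>.\<close>
  define W where "W = Lset \<phi> (cball 0 t1) \<inter> \<Inter>((\<lambda>(\<psi>0, U). Nset \<psi>0 U) ` \<U>)"
  have oL: "openin Mt_top (Lset \<phi> (cball 0 t1))" using models_openin(1)[OF pointed_lh_models[OF \<phi>] t1(3,2)] .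
  have mem: "surf \<psi> \<in> W \<longleftrightarrow> lifts \<phi> (cball 0 t1) \<psi> \<and> (\<forall>(\<psi>0, U)\<in>\<U>. \<not> embeds \<psi>0 U \<psi>)" if "pointed_lh \<psi>" for \<psi>
    using surf_Lset[OF that] surf_Nset[OF that] by (auto simp: W_def)
  show ?thesis
  proof (rule that)
    show "openin Mt_top W"
    proof (cases "\<U> = {}")
      case False
      have "openin Mt_top (\<Inter>((\<lambda>(\<psi>0, U). Nset \<psi>0 U) ` \<U>))"
        using U(1,2) False openin_Nset by (intro openin_Inter) auto
      then show ?thesis unfolding W_def using oL by (intro openin_Int)
    qed (use oL in \<open>simp add: W_def\<close>)
    have "cball (0::complex) t1 \<subseteq> Dsk" using t1 by auto
    then have "lifts \<phi> (cball 0 t1) \<phi>" unfolding lifts_def immersion_into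
      by (intro exI[of _ "\<lambda>x. x"] into_id)
    moreover have "\<not> embeds \<psi>0 U \<phi>" if "(\<psi>0, U) \<in> \<U>" for \<psi>0 U
      using U(2)[OF that] by (auto simp: embeds_def embedding_def)
    ultimately show "surf \<phi> \<in> W" using mem[OF \<phi>] by blast
    fix \<psi> assume \<psi>: "pointed_lh \<psi>" "surf \<psi> \<in> W"
    then obtain \<iota> where i: "into \<phi> (cball 0 t1) \<psi> Dsk \<iota>" using mem by (auto simp: lifts_def immersion_into)
    have "immersion \<phi> (ball 0 t1) \<psi> \<iota>" unfolding immersion_into by (rule into_mono[OF i]) auto
    then have "inj_on \<iota> (cball 0 t) \<or> (\<exists>(\<psi>0, U)\<in>\<U>. \<exists>e. embedding \<psi>0 U \<psi> e)" by (rule U(3)[OF \<psi>(1)])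
    moreover have "\<forall>(\<psi>0, U)\<in>\<U>. \<not> embeds \<psi>0 U \<psi>" using mem[OF \<psi>(1)] \<psi>(2) by blast
    ultimately have "inj_on \<iota> (cball 0 t)" unfolding embeds_def by blast
    moreover have "into \<phi> (cball 0 t) \<psi> Dsk \<iota>" by (rule into_mono[OF i]) (use t1 in auto)
    ultimately show "embeds \<phi> (cball 0 t) \<psi>" by (auto simp: embeds_def embedding_def immersion_into)
  qed
qed

text \<open>Exhaustion gives immersions of all of \<open>Dsk\<close> in both directions, and
  uniqueness makes them inverse to each other.\<close>

lemma iso_lh_from_lifts:
  assumes \<phi>: "pointed_lh \<phi>" and \<psi>: "pointed_lh \<psi>"
    and l: "\<And>r. 0 < r \<Longrightarrow> r < 1 \<Longrightarrow> lifts \<phi> (ball 0 r) \<psi>" "\<And>r. 0 < r \<Longrightarrow> r < 1 \<Longrightarrow> lifts \<psi> (ball 0 r) \<phi>"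
  shows "iso_lh \<phi> \<psi>"
proof -
  note im = pointed_lh_local_imm[OF \<phi>] pointed_lh_local_imm[OF \<psi>]
  obtain h where h: "into \<phi> Dsk \<psi> Dsk h"
  proof -
    have "\<forall>r. \<exists>i. 0 < r \<longrightarrow> r < 1 \<longrightarrow> immersion \<phi> (ball 0 r) \<psi> i" using l(1) by (auto simp: lifts_def)
    then obtain I where "\<forall>r. 0 < r \<longrightarrow> r < 1 \<longrightarrow> immersion \<phi> (ball 0 r) \<psi> (I r)" by (rule choice[THEN exE])
    then show ?thesis using immersion_exhaustion[OF im(2), of \<phi> I] that unfolding immersion_into by metis
  qed
  obtain g where g: "into \<psi> Dsk \<phi> Dsk g"
  proof -
    have "\<forall>r. \<exists>i. 0 < r \<longrightarrow> r < 1 \<longrightarrow> immersion \<psi> (ball 0 r) \<phi> i" using l(2) by (auto simp: lifts_def)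
    then obtain I where "\<forall>r. 0 < r \<longrightarrow> r < 1 \<longrightarrow> immersion \<psi> (ball 0 r) \<phi> (I r)" by (rule choice[THEN exE])
    then show ?thesis using immersion_exhaustion[OF im(1), of \<psi> I] that unfolding immersion_into by metis
  qed
  have con: "connected Dsk" "(0::complex) \<in> Dsk" by auto
  have gh: "g (h x) = x" if "x \<in> Dsk" for x
    using into_unique[OF im(1) con into_compose[OF h g order_refl] into_id[OF order_refl] that] .
  have hg: "h (g x) = x" if "x \<in> Dsk" for x
    using into_unique[OF im(2) con into_compose[OF g h order_refl] into_id[OF order_refl] that] .
  have "homeomorphism Dsk Dsk h g"
    by (rule homeomorphismI) (use h g gh hg in \<open>auto simp: into_def\<close>)
  moreover have "\<forall>x\<in>Dsk. \<psi> x = \<phi> (g x)" using intoD(4)[OF g] by simp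
  ultimately show ?thesis unfolding iso_lh_iff using \<phi> \<psi> intoD(3)[OF h] by blast
qed

text \<open>Embedding of \<open>cball 0 r\<close> holds in a whole neighbourhood of
  \<open>\<phi>\<close>, while non-embedding of \<open>ball 0 r\<close> is an open condition that
  holds at \<open>\<psi>\<close>.\<close>

lemma separate_not_lifting:
  assumes \<phi>: "pointed_lh \<phi>" and \<psi>: "pointed_lh \<psi>" and r: "0 < r" "r < 1" and n: "\<not> lifts \<phi> (ball 0 r) \<psi>"
  shows "\<exists>U V. openin Mt_top U \<and> openin Mt_top V \<and> surf \<phi> \<in> U \<and> surf \<psi> \<in> V \<and> disjnt U V"
proof -
  obtain W where W: "openin Mt_top W" "surf \<phi> \<in> W" "\<And>\<xi>. pointed_lh \<xi> \<Longrightarrow> surf \<xi> \<in> W \<Longrightarrow> embeds \<phi> (cball 0 r) \<xi>"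
    by (rule openin_embeds_nhd[OF \<phi> r]) blast
  have "\<not> embeds \<phi> (ball 0 r) \<psi>" using n by (auto simp: embeds_def lifts_def embedding_def)
  then have "surf \<psi> \<in> Nset \<phi> (ball 0 r)" using surf_Nset[OF \<psi>] by simp
  moreover have "openin Mt_top (Nset \<phi> (ball 0 r))" using models_openin(2)[OF pointed_lh_models[OF \<phi>] r] .
  moreover have "disjnt W (Nset \<phi> (ball 0 r))" unfolding disjnt_iff
  proof (intro allI notI, elim conjE)
    fix c assume c: "c \<in> W" "c \<in> Nset \<phi> (ball 0 r)"
    then have "c \<in> Mt" by (simp add: Nset_def)
    then obtain \<xi> where x: "pointed_lh \<xi>" "c = surf \<xi>" by (rule Mt_cases)
    have "embeds \<phi> (ball 0 r) \<xi>" by (rule embeds_subset[OF W(3)[OF x(1)]]) (use c x in auto)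
    then show False using c(2) surf_Nset[OF x(1)] x(2) by simp
  qed
  ultimately show ?thesis using W by blast
qed

lemma Hausdorff_Mt_top: "Hausdorff_space Mt_top"
  unfolding Hausdorff_space_def topspace_Mt_top
proof (intro allI impI, elim conjE)
  fix a b assume "a \<in> Mt" "b \<in> Mt" and ne: "a \<noteq> b"
  then obtain \<phi> \<psi> where \<phi>: "pointed_lh \<phi>" "a = surf \<phi>" and \<psi>: "pointed_lh \<psi>" "b = surf \<psi>" using Mt_cases by metis
  have "\<not> iso_lh \<phi> \<psi>" using ne surf_eq \<phi>(2) \<psi>(2) by blast
  then obtain r where r: "0 < r" "r < 1" "\<not> lifts \<phi> (ball 0 r) \<psi> \<or> \<not> lifts \<psi> (ball 0 r) \<phi>"
    using iso_lh_from_lifts[OF \<phi>(1) \<psi>(1)] by blast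
  then show "\<exists>U V. openin Mt_top U \<and> openin Mt_top V \<and> a \<in> U \<and> b \<in> V \<and> disjnt U V"
  proof (elim disjE)
    assume "\<not> lifts \<phi> (ball 0 r) \<psi>"
    then show ?thesis using separate_not_lifting[OF \<phi>(1) \<psi>(1) r(1,2)] \<phi>(2) \<psi>(2) by simp
  next
    assume "\<not> lifts \<psi> (ball 0 r) \<phi>"
    then obtain U V where "openin Mt_top U" "openin Mt_top V" "surf \<psi> \<in> U" "surf \<phi> \<in> V" "disjnt U V"
      using separate_not_lifting[OF \<psi>(1) \<phi>(1) r(1,2)] by blast
    then show ?thesis using \<phi>(2) \<psi>(2) by (intro exI[of _ V] exI[of _ U]) (simp add: disjnt_sym)
  qed
qed

section \<open>The topology of the space of pointed surfaces\<close>

definition pt :: "(complex \<Rightarrow> complex) \<Rightarrow> complex \<Rightarrow> ((complex \<Rightarrow> complex) \<times> complex) set" where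
  "pt \<phi> p = {b. iso_pt (\<phi>, p) b}"

definition hits :: "(complex \<Rightarrow> complex) \<Rightarrow> complex set \<Rightarrow> complex set \<Rightarrow> (complex \<Rightarrow> complex) \<Rightarrow> complex \<Rightarrow> bool" where
  "hits f K U \<psi> y \<longleftrightarrow> (\<exists>\<iota>. into f K \<psi> Dsk \<iota> \<and> y \<in> \<iota> ` U)"

lemma pt_Et: "pointed_lh \<phi> \<Longrightarrow> p \<in> Dsk \<Longrightarrow> pt \<phi> p \<in> Et"
  unfolding Et_def pt_def by (intro CollectI exI[of _ "(\<phi>, p)"]) simp

lemma Et_cases:
  assumes "e \<in> Et"
  obtains \<phi> p where "pointed_lh \<phi>" "p \<in> Dsk" "e = pt \<phi> p"
  using assms by (auto simp: Et_def pt_def)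

lemma pt_eq:
  assumes i: "iso_pt (\<phi>, p) (\<psi>, q)"
  shows "pt \<phi> p = pt \<psi> q"
proof -
  have "iso_pt (\<phi>, p) b \<longleftrightarrow> iso_pt (\<psi>, q) b" for b
    using iso_pt_trans[OF i, of "fst b" "snd b"] iso_pt_trans[OF iso_pt_sym[OF i], of "fst b" "snd b"] by auto
  then show ?thesis unfolding pt_def by (intro Collect_cong)
qed

lemma iso_pt_into:
  assumes "iso_pt (\<phi>, p) (\<psi>, q)"
  obtains h where "into \<phi> Dsk \<psi> Dsk h" "h p = q"
proof -
  obtain h g where h: "homeomorphism Dsk Dsk h g" "h 0 = 0" "\<forall>x\<in>Dsk. \<psi> x = \<phi> (g x)" "q = h p"
    using assms unfolding iso_pt_iff by blast
  have gh: "g (h x) = x" "h x \<in> Dsk" if "x \<in> Dsk" for x using h(1) that by (auto simp: homeomorphism_def)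
  have "into \<phi> Dsk \<psi> Dsk h"
  proof (rule intoI)
    show "continuous_on Dsk h" using h(1) by (simp add: homeomorphism_def)
    show "\<psi> (h x) = \<phi> x" if "x \<in> Dsk" for x using bspec[OF h(3) gh(2)[OF that]] gh(1)[OF that] by simp
  qed (use gh h in auto)
  then show ?thesis using that h(4) by blast
qed

lemma iso_pt_iso_lh: "iso_pt (\<phi>, p) (\<psi>, q) \<Longrightarrow> iso_lh \<phi> \<psi>"
  unfolding iso_pt_iff iso_lh_iff by blast

lemma hits_iso:
  assumes iso: "iso_pt (\<phi>, p) (\<psi>, q)" and U: "U \<subseteq> K" and h: "hits f K U \<phi> p"
  shows "hits f K U \<psi> q"
proof -
  obtain \<iota> u where i: "into f K \<phi> Dsk \<iota>" "u \<in> U" "p = \<iota> u" using h by (auto simp: hits_def)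
  obtain k where k: "into \<phi> Dsk \<psi> Dsk k" "k p = q" using iso_pt_into[OF iso] .
  have "into f K \<psi> Dsk (\<lambda>x. k (\<iota> x))" by (rule into_compose[OF i(1) k(1) order_refl])
  moreover have "q = k (\<iota> u)" using k(2) i(3) by simp
  ultimately show ?thesis unfolding hits_def using i(2) by blast
qed

lemma Et_plus_iff: "e \<in> Et_plus f K U \<longleftrightarrow> e \<in> Et \<and> (\<exists>\<psi> y. (\<psi>, y) \<in> e \<and> hits f K U \<psi> y)"
  unfolding Et_plus_def hits_def immersion_into by auto

lemma pt_Et_plus:
  assumes \<phi>: "pointed_lh \<phi>" "p \<in> Dsk" and U: "U \<subseteq> K"
  shows "pt \<phi> p \<in> Et_plus f K U \<longleftrightarrow> hits f K U \<phi> p"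
proof
  assume "pt \<phi> p \<in> Et_plus f K U"
  then obtain \<psi> y where y: "iso_pt (\<phi>, p) (\<psi>, y)" "hits f K U \<psi> y" by (auto simp: Et_plus_iff pt_def)
  show "hits f K U \<phi> p" by (rule hits_iso[OF iso_pt_sym[OF y(1)] U y(2)])
next
  assume "hits f K U \<phi> p"
  moreover have "(\<phi>, p) \<in> pt \<phi> p" using iso_pt_refl[OF \<phi>] by (simp add: pt_def)
  ultimately show "pt \<phi> p \<in> Et_plus f K U" using pt_Et[OF \<phi>] by (auto simp: Et_plus_iff)
qed

lemma Et_plus_mono:
  assumes "\<And>\<psi> y. hits f K U \<psi> y \<Longrightarrow> hits g L V \<psi> y"
  shows "Et_plus f K U \<subseteq> Et_plus g L V"
  using assms unfolding Et_plus_iff subset_iff by blast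

text \<open>The developing maps in one class of pairs are all isomorphic, so a single class of
  surfaces contains them and the description operator in \<open>pit\<close> is well defined.\<close>

lemma pit_pt:
  assumes \<phi>: "pointed_lh \<phi>" "p \<in> Dsk"
  shows "pit (pt \<phi> p) = surf \<phi>"
  unfolding pit_def
proof (rule the_equality)
  have "(\<phi>, p) \<in> pt \<phi> p" using iso_pt_refl[OF \<phi>] by (simp add: pt_def)
  moreover have "fst (\<phi>, p) \<in> surf \<phi>" using iso_lh_refl[OF \<phi>(1)] by (simp add: surf_def)
  ultimately show "surf \<phi> \<in> Mt \<and> (\<exists>a\<in>pt \<phi> p. fst a \<in> surf \<phi>)" using surf_Mt[OF \<phi>(1)] by blast
  fix c assume c: "c \<in> Mt \<and> (\<exists>a\<in>pt \<phi> p. fst a \<in> c)"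
  then obtain \<xi> where x: "pointed_lh \<xi>" "c = surf \<xi>" using Mt_cases by blast
  obtain \<psi> q where a: "(\<psi>, q) \<in> pt \<phi> p" "\<psi> \<in> c" using c by auto
  have "iso_lh \<phi> \<psi>" using a(1) iso_pt_iso_lh by (auto simp: pt_def)
  moreover have "iso_lh \<xi> \<psi>" using a(2) x(2) by (simp add: surf_def)
  ultimately show "c = surf \<phi>" using surf_eq x(2) by metis
qed

lemma topspace_Et_top: "topspace Et_top = Et"
  unfolding Et_top_def topology_generated_by_topspace Et_subbasis_def by (auto simp: Et_plus_def)

lemma openin_pit_vimage: "openin Mt_top V \<Longrightarrow> openin Et_top {e \<in> Et. pit e \<in> V}"
  unfolding Et_top_def by (rule topology_generated_by_Basis) (auto simp: Et_subbasis_def)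

lemma openin_Et_plus:
  "pointed_lh \<phi> \<Longrightarrow> compact K \<Longrightarrow> PC K \<Longrightarrow> open U \<Longrightarrow> U \<subseteq> interior K \<Longrightarrow> openin Et_top (Et_plus \<phi> K U)"
  unfolding Et_top_def by (rule topology_generated_by_Basis) (auto simp: Et_subbasis_def)

lemma hits_para:
  assumes k: "para k" and X: "X \<subseteq> Dsk" "0 \<in> X" "W \<subseteq> X"
  shows "hits \<phi> (k ` X) (k ` W) \<psi> y \<longleftrightarrow> hits (\<lambda>x. \<phi> (k x)) X W \<psi> y"
proof -
  obtain g where g: "homeomorphism Dsk (k ` Dsk) k g" using para_homeomorphism[OF k] .
  have gk: "g (k x) = x" if "x \<in> W" for x using g X that by (auto simp: homeomorphism_def)
  show ?thesis
  proof
    assume "hits \<phi> (k ` X) (k ` W) \<psi> y"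
    then obtain \<iota> w where "into \<phi> (k ` X) \<psi> Dsk \<iota>" "w \<in> W" "y = \<iota> (k w)" by (auto simp: hits_def)
    then show "hits (\<lambda>x. \<phi> (k x)) X W \<psi> y" using para_into[OF k X(1)] unfolding hits_def by blast
  next
    assume "hits (\<lambda>x. \<phi> (k x)) X W \<psi> y"
    then obtain \<iota> w where i: "into (\<lambda>x. \<phi> (k x)) X \<psi> Dsk \<iota>" "w \<in> W" "y = \<iota> w" by (auto simp: hits_def)
    have "y = \<iota> (g (k w))" using i(3) gk[OF i(2)] by simp
    then show "hits \<phi> (k ` X) (k ` W) \<psi> y"
      using para_into_inverse[OF k X(1,2) i(1) g] i(2) unfolding hits_def by blast
  qed
qed

lemma models_openin_Et_plus:
  assumes "c \<in> models" "0 < s" "s < 1" "open W" "W \<subseteq> ball 0 s"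
  shows "openin Et_top (Et_plus c (cball 0 s) W)"
proof -
  obtain \<phi> k where ck: "c = (\<lambda>x. \<phi> (k x))" "pointed_lh \<phi>" "para k" using assms(1) by (auto simp: models_def)
  have sub: "cball (0::complex) s \<subseteq> Dsk" "ball (0::complex) s \<subseteq> Dsk" and o: "(0::complex) \<in> cball 0 s" and W: "W \<subseteq> cball 0 s" "W \<subseteq> Dsk"
    using assms by auto
  have "Et_plus c (cball 0 s) W = Et_plus \<phi> (k ` cball 0 s) (k ` W)"
    unfolding ck(1) set_eq_iff Et_plus_iff hits_para[OF ck(3) sub(1) o W(1)] by simp
  moreover have "openin Et_top (Et_plus \<phi> (k ` cball 0 s) (k ` W))"
  proof (rule openin_Et_plus[OF ck(2)])
    show "compact (k ` cball 0 s)"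
      using continuous_on_subset[OF paraD(1)[OF ck(3)] sub(1)] by (intro compact_continuous_image) auto
    show "PC (k ` cball 0 s)" using para_cdisk[OF ck(3) assms(2,3)] by (simp add: cdisk_def)
    show "open (k ` W)" by (rule para_open[OF ck(3) assms(4) W(2)])
    then show "k ` W \<subseteq> interior (k ` cball 0 s)" by (rule interior_maximal[rotated]) (rule image_mono[OF W(1)])
  qed
  ultimately show ?thesis by simp
qed

text \<open>\<open>f\<close> factors through \<open>\<iota>\<close>, so local injectivity passes
  from \<open>f\<close> to \<open>\<iota>\<close>, and invariance of domain applies.\<close>

lemma into_open_image:
  assumes f: "local_imm Dsk f" and i: "into f X c S \<iota>" and U: "open U" "U \<subseteq> X" "U \<subseteq> Dsk"
  shows "open (\<iota> ` U)"
proof (subst open_subopen, intro ballI)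
  fix y assume "y \<in> \<iota> ` U"
  then obtain u where u: "u \<in> U" "y = \<iota> u" by blast
  obtain e where e: "e > 0" "inj_on f (ball u e)" using f u(1) U(3) unfolding local_imm_def by blast
  let ?V = "ball u e \<inter> U"
  have inj: "inj_on \<iota> ?V"
  proof (rule inj_onI)
    fix a b assume ab: "a \<in> ?V" "b \<in> ?V" "\<iota> a = \<iota> b"
    then have "a \<in> X" "b \<in> X" using U(2) by auto
    then have "f a = f b" using intoD(4)[OF i] ab(3) by metis
    then show "a = b" using inj_onD[OF e(2)] ab by simp
  qed
  have "open (\<iota> ` ?V)"
    by (rule invariance_of_domain[OF continuous_on_subset[OF intoD(1)[OF i]] _ inj]) (use U in auto)
  moreover have "y \<in> \<iota> ` ?V" using u e(1) by auto
  ultimately show "\<exists>T. open T \<and> y \<in> T \<and> T \<subseteq> \<iota> ` U" by blast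
qed

text \<open>The marked point is reached through a model: the immersion of \<open>K\<close> equals
  \<open>j\<close> after \<open>q\<close> by uniqueness, the image of \<open>U\<close> under
  \<open>q\<close> is open, and a member of a countable base of the plane inside that image takes
  the place of \<open>U\<close>.\<close>

lemma second_countable_Et_top: "second_countable Et_top"
proof -
  obtain \<C> where \<C>: "dense_models \<C>" using dense_models_exist by blast
  then have cC: "countable \<C>" "\<C> \<subseteq> models" by (auto simp: dense_models_def)
  obtain \<B> where B: "countable \<B>" "\<And>V. V \<in> \<B> \<Longrightarrow> openin Mt_top V"
    "\<And>U x. openin Mt_top U \<Longrightarrow> x \<in> U \<Longrightarrow> \<exists>V\<in>\<B>. x \<in> V \<and> V \<subseteq> U"
    using second_countable_Mt_top unfolding second_countable_def by metis
  obtain \<W> :: "complex set set" where W: "countable \<W>" "topological_basis \<W>" using ex_countable_basis by blast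
  define I where "I = {(c, s, V). (c, s, V) \<in> \<C> \<times> (\<rat> \<inter> {0<..<1::real}) \<times> \<W> \<and> V \<subseteq> ball 0 s}"
  define \<S> where "\<S> = (\<lambda>V. {e \<in> Et. pit e \<in> V}) ` \<B> \<union> (\<lambda>(c, s, V). Et_plus c (cball 0 s) V) ` I"
  have "countable (\<C> \<times> (\<rat> \<inter> {0<..<1::real}) \<times> \<W>)"
    using cC(1) W(1) countable_rat by (intro countable_SIGMA) (auto intro: countable_subset)
  then have "countable I" by (rule countable_subset[rotated]) (auto simp: I_def)
  then have "countable \<S>" unfolding \<S>_def using B(1) by (intro countable_Un countable_image)
  moreover have "openin Et_top u" if "u \<in> \<S>" for u
    using that unfolding \<S>_def
  proof (elim UnE imageE)
    fix V assume "V \<in> \<B>" "u = {e \<in> Et. pit e \<in> V}"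
    then show ?thesis using openin_pit_vimage B(2) by simp
  next
    fix i assume i: "i \<in> I" "u = (\<lambda>(c, s, V). Et_plus c (cball 0 s) V) i"
    obtain c s V where csV: "i = (c, s, V)" by (cases i) auto
    then have "c \<in> models" "0 < s" "s < 1" "V \<in> \<W>" "V \<subseteq> ball 0 s" using i(1) cC(2) by (auto simp: I_def)
    then show ?thesis using models_openin_Et_plus topological_basis_open[OF W(2)] i(2) csV by simp
  qed
  moreover have "b = \<Union>(insert Et Et_subbasis) \<or> (\<exists>u\<in>\<S>. x \<in> u \<and> u \<subseteq> b)"
    if b: "b \<in> insert Et Et_subbasis" and x: "x \<in> b" for b x
  proof -
    have "b = Et \<or> (\<exists>V. b = {e \<in> Et. pit e \<in> V} \<and> openin Mt_top V) \<or>
      (\<exists>\<phi> K U. b = Et_plus \<phi> K U \<and> pointed_lh \<phi> \<and> compact K \<and> PC K \<and> open U \<and> U \<subseteq> interior K)"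
      using b unfolding Et_subbasis_def by blast
    then show ?thesis
    proof (elim disjE exE conjE)
      assume "b = Et"
      moreover have "\<Union>(insert Et Et_subbasis) = Et"
        using topspace_Et_top unfolding Et_top_def topology_generated_by_topspace .
      ultimately show ?thesis by simp
    next
      fix V assume V: "b = {e \<in> Et. pit e \<in> V}" "openin Mt_top V"
      obtain V' where V': "V' \<in> \<B>" "pit x \<in> V'" "V' \<subseteq> V" using B(3)[OF V(2)] x V(1) by blast
      show ?thesis
      proof (intro disjI2 bexI conjI)
        show "{e \<in> Et. pit e \<in> V'} \<in> \<S>" unfolding \<S>_def by (intro UnI1 imageI V'(1))
        show "x \<in> {e \<in> Et. pit e \<in> V'}" "{e \<in> Et. pit e \<in> V'} \<subseteq> b" using x V(1) V'(2,3) by auto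
      qed
    next
      fix \<phi> K U assume bl: "b = Et_plus \<phi> K U" "pointed_lh \<phi>" "compact K" "PC K" "open U" "U \<subseteq> interior K"
      have UK: "U \<subseteq> K" using bl(6) interior_subset by blast
      have KD: "K \<subseteq> Dsk" "0 \<in> K" "connected K" using bl(4) path_connected_imp_connected by (auto simp: PC_def)
      have "x \<in> Et" using x bl(1) by (simp add: Et_plus_iff)
      then obtain \<psi> y where \<psi>: "pointed_lh \<psi>" "y \<in> Dsk" "x = pt \<psi> y" by (rule Et_cases)
      have "hits \<phi> K U \<psi> y" using x pt_Et_plus[OF \<psi>(1,2) UK] bl(1) \<psi>(3) by simp
      then obtain \<iota> u where i: "into \<phi> K \<psi> Dsk \<iota>" "u \<in> U" "y = \<iota> u" by (auto simp: hits_def)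
      obtain c s q where c: "c \<in> \<C>" "s \<in> \<rat>" "0 < s" "s < 1" "into \<phi> K c (ball 0 s) q" "lifts c (cball 0 s) \<psi>"
        by (rule immersion_through_dense_model[OF \<C> pointed_lh_models[OF \<psi>(1)] i(1) bl(3) KD(2)])
      have cs: "ball (0::complex) s \<subseteq> cball 0 s" by (rule ball_subset_cball)
      obtain j where j: "into c (cball 0 s) \<psi> Dsk j" using c(6) by (auto simp: lifts_def immersion_into)
      have uK: "u \<in> K" using i(2) UK by blast
      have "j (q u) = \<iota> u"
        by (rule into_unique[OF pointed_lh_local_imm[OF \<psi>(1)] KD(3,2) into_compose[OF c(5) j cs] i(1) uK])
      then have yj: "y = j (q u)" using i(3) by simp
      have "open (q ` U)" by (rule into_open_image[OF pointed_lh_local_imm[OF bl(2)] c(5) bl(5) UK]) (use UK KD in blast)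
      moreover have "q u \<in> q ` U" using i(2) by (rule imageI)
      ultimately obtain V where V: "V \<in> \<W>" "q u \<in> V" "V \<subseteq> q ` U" using topological_basisE[OF W(2)] by metis
      have Vs: "V \<subseteq> ball 0 s" "V \<subseteq> cball 0 s" using V(3) intoD(2)[OF c(5)] UK cs by blast+
      have "hits c (cball 0 s) V \<psi> y" unfolding hits_def using j yj V(2) by blast
      then have xV: "x \<in> Et_plus c (cball 0 s) V" using pt_Et_plus[OF \<psi>(1,2) Vs(2)] \<psi>(3) by simp
      have sub: "Et_plus c (cball 0 s) V \<subseteq> b" unfolding bl(1)
      proof (rule Et_plus_mono)
        fix \<xi> z assume "hits c (cball 0 s) V \<xi> z"
        then obtain j' w where j': "into c (cball 0 s) \<xi> Dsk j'" "w \<in> V" "z = j' w" by (auto simp: hits_def)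
        obtain u' where u': "u' \<in> U" "w = q u'" using j'(2) V(3) by blast
        have "z = j' (q u')" using j'(3) u'(2) by simp
        then show "hits \<phi> K U \<xi> z" unfolding hits_def using into_compose[OF c(5) j'(1) cs] u'(1) by blast
      qed
      have "(c, s, V) \<in> I" using c V Vs by (simp add: I_def)
      then have "Et_plus c (cball 0 s) V \<in> \<S>" unfolding \<S>_def by (intro UnI2 rev_image_eqI[of "(c, s, V)"]) simp_all
      then show ?thesis using xV sub by (intro disjI2 bexI conjI)
    qed
  qed
  ultimately show ?thesis unfolding Et_top_def by (rule second_countable_topology_generated_by)
qed

text \<open>On surfaces near \<open>\<phi>\<close> the disk \<open>cball 0 t\<close> embeds, and by
  uniqueness every pointed immersion of it is this embedding; so the disjoint sets \<open>U\<close>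
  and \<open>V\<close> have disjoint images there.\<close>

lemma separate_in_fibre:
  assumes \<phi>: "pointed_lh \<phi>" and p: "p \<in> Dsk" "q \<in> Dsk" "p \<noteq> q"
  shows "\<exists>U V. openin Et_top U \<and> openin Et_top V \<and> pt \<phi> p \<in> U \<and> pt \<phi> q \<in> V \<and> disjnt U V"
proof -
  obtain t where t: "max (norm p) (norm q) < t" "t < 1" using p dense[of "max (norm p) (norm q)" 1] by auto
  then have t0: "0 < t" using norm_ge_zero[of p] by linarith
  have pt: "p \<in> ball 0 t" "q \<in> ball 0 t" using t by auto
  obtain A B where AB: "open A" "open B" "p \<in> A" "q \<in> B" "A \<inter> B = {}" using hausdorff[OF p(3)] by blast
  define U where "U = A \<inter> ball 0 t"
  define V where "V = B \<inter> ball 0 t"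
  have UV: "open U" "open V" "p \<in> U" "q \<in> V" "U \<inter> V = {}" "U \<subseteq> ball 0 t" "V \<subseteq> ball 0 t"
    using AB pt by (auto simp: U_def V_def)
  then have UVc: "U \<subseteq> cball 0 t" "V \<subseteq> cball 0 t" by (meson ball_subset_cball order_trans)+
  have sub: "cball (0::complex) t \<subseteq> Dsk" using t by auto
  have con: "connected (cball (0::complex) t)" "(0::complex) \<in> cball 0 t" using t0 by auto
  obtain W where W: "openin Mt_top W" "surf \<phi> \<in> W" "\<And>\<psi>. pointed_lh \<psi> \<Longrightarrow> surf \<psi> \<in> W \<Longrightarrow> embeds \<phi> (cball 0 t) \<psi>"
    by (rule openin_embeds_nhd[OF \<phi> t0 t(2)]) blast
  let ?A = "{e \<in> Et. pit e \<in> W} \<inter> Et_plus \<phi> (cball 0 t) U" and ?B = "Et_plus \<phi> (cball 0 t) V"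
  have "openin Et_top ?A"
    using openin_pit_vimage[OF W(1)] models_openin_Et_plus[OF pointed_lh_models[OF \<phi>] t0 t(2) UV(1,6)] by (rule openin_Int)
  moreover have "openin Et_top ?B" by (rule models_openin_Et_plus[OF pointed_lh_models[OF \<phi>] t0 t(2) UV(2,7)])
  moreover have "pt \<phi> p \<in> ?A"
  proof -
    have "hits \<phi> (cball 0 t) U \<phi> p" unfolding hits_def
      using UV(3) by (intro exI[of _ "\<lambda>x. x"] conjI into_id[OF sub]) simp
    then show ?thesis using pt_Et_plus[OF \<phi> p(1) UVc(1)] pit_pt[OF \<phi> p(1)] W(2) pt_Et[OF \<phi> p(1)] by simp
  qed
  moreover have "pt \<phi> q \<in> ?B"
  proof -
    have "hits \<phi> (cball 0 t) V \<phi> q" unfolding hits_def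
      using UV(4) by (intro exI[of _ "\<lambda>x. x"] conjI into_id[OF sub]) simp
    then show ?thesis using pt_Et_plus[OF \<phi> p(2) UVc(2)] by simp
  qed
  moreover have "disjnt ?A ?B" unfolding disjnt_iff
  proof (intro allI notI, elim conjE IntE CollectE)
    fix e assume e: "e \<in> Et" "pit e \<in> W" "e \<in> Et_plus \<phi> (cball 0 t) U" "e \<in> ?B"
    obtain \<psi> y where \<psi>: "pointed_lh \<psi>" "y \<in> Dsk" "e = pt \<psi> y" using e(1) by (rule Et_cases)
    have "surf \<psi> \<in> W" using e(2) pit_pt[OF \<psi>(1,2)] \<psi>(3) by simp
    then have "embeds \<phi> (cball 0 t) \<psi>" by (rule W(3)[OF \<psi>(1)])
    then obtain \<iota> where i: "into \<phi> (cball 0 t) \<psi> Dsk \<iota>" "inj_on \<iota> (cball 0 t)"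
      by (auto simp: embeds_def embedding_def immersion_into)
    have im: "local_imm Dsk \<psi>" by (rule pointed_lh_local_imm[OF \<psi>(1)])
    obtain i1 u where u: "into \<phi> (cball 0 t) \<psi> Dsk i1" "u \<in> U" "y = i1 u"
      using e(3) pt_Et_plus[OF \<psi>(1,2) UVc(1)] \<psi>(3) by (auto simp: hits_def)
    obtain i2 v where v: "into \<phi> (cball 0 t) \<psi> Dsk i2" "v \<in> V" "y = i2 v"
      using e(4) pt_Et_plus[OF \<psi>(1,2) UVc(2)] \<psi>(3) by (auto simp: hits_def)
    have uv: "u \<in> cball 0 t" "v \<in> cball 0 t" using u(2) v(2) UVc by blast+
    have "\<iota> u = y" using into_unique[OF im con i(1) u(1) uv(1)] u(3) by simp
    moreover have "\<iota> v = y" using into_unique[OF im con i(1) v(1) uv(2)] v(3) by simp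
    ultimately have "u = v" using inj_onD[OF i(2) _ uv] by simp
    then show False using u(2) v(2) UV(5) by blast
  qed
  ultimately show ?thesis by blast
qed

lemma Hausdorff_Et_top: "Hausdorff_space Et_top"
  unfolding Hausdorff_space_def topspace_Et_top
proof (intro allI impI, elim conjE)
  fix a b assume ab: "a \<in> Et" "b \<in> Et" and ne: "a \<noteq> b"
  obtain \<phi> p where \<phi>: "pointed_lh \<phi>" "p \<in> Dsk" "a = pt \<phi> p" using ab(1) by (rule Et_cases)
  obtain \<psi> q where \<psi>: "pointed_lh \<psi>" "q \<in> Dsk" "b = pt \<psi> q" using ab(2) by (rule Et_cases)
  have pit: "pit a = surf \<phi>" "pit b = surf \<psi>" using pit_pt \<phi> \<psi> by auto
  show "\<exists>U V. openin Et_top U \<and> openin Et_top V \<and> a \<in> U \<and> b \<in> V \<and> disjnt U V"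
  proof (cases "surf \<phi> = surf \<psi>")
    case False
    then obtain U V where UV: "openin Mt_top U" "openin Mt_top V" "surf \<phi> \<in> U" "surf \<psi> \<in> V" "disjnt U V"
      using Hausdorff_Mt_top surf_Mt \<phi>(1) \<psi>(1) unfolding Hausdorff_space_def topspace_Mt_top by metis
    then show ?thesis using openin_pit_vimage[OF UV(1)] openin_pit_vimage[OF UV(2)] ab pit
      by (intro exI[of _ "{e \<in> Et. pit e \<in> U}"] exI[of _ "{e \<in> Et. pit e \<in> V}"]) (auto simp: disjnt_iff)
  next
    case True
    have "\<psi> \<in> surf \<phi>" using True iso_lh_refl[OF \<psi>(1)] by (simp add: surf_def)
    then have "iso_lh \<phi> \<psi>" by (simp add: surf_def)
    then have "iso_lh \<psi> \<phi>" by (rule iso_lh_sym)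
    then obtain h g where h: "homeomorphism Dsk Dsk h g" "h 0 = 0" "\<forall>x\<in>Dsk. \<phi> x = \<psi> (g x)"
      unfolding iso_lh_iff by blast
    have hq: "h q \<in> Dsk" using h(1) \<psi>(2) by (auto simp: homeomorphism_def)
    \<comment> \<open>The second point is transported to the representative \<open>\<phi>\<close>,
      which leaves two distinct points of one surface.\<close>
    have "iso_pt (\<psi>, q) (\<phi>, h q)" unfolding iso_pt_iff using \<phi>(1) \<psi>(1,2) hq h by blast
    then have "pt \<psi> q = pt \<phi> (h q)" by (rule pt_eq)
    then have b: "b = pt \<phi> (h q)" using \<psi>(3) by simp
    then have "p \<noteq> h q" using ne \<phi>(3) by auto
    then show ?thesis using separate_in_fibre[OF \<phi>(1,2) hq] unfolding b \<phi>(3) by simp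
  qed
qed

theorem mainTheorem9:
  shows "second_countable Mt_top \<and> Hausdorff_space Mt_top \<and>
         second_countable Et_top \<and> Hausdorff_space Et_top"
  using second_countable_Mt_top Hausdorff_Mt_top second_countable_Et_top Hausdorff_Et_top by blast

end
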